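(* Let $1<p<3$. For each $\omega$ in an interval $(0,\omega_0)$ let $u_{2,\omega}\in H^1(\mathbb{R}^3)$ be a positive solution of $-\Delta u+\omega u-|u|^{p-1}u-|u|^4u=0$ in $\mathbb{R}^3$ with $\lim_{\omega\to0}\|u_{2,\omega}\|_{L^\infty}=\infty$. Put $M_{2,\omega}=\|u_{2,\omega}\|_{L^\infty}$ and $\widetilde u_{2,\omega}(x)=M_{2,\omega}^{-1}u_{2,\omega}(M_{2,\omega}^{-2}x)$. Then $\widetilde u_{2,\omega}\to W$ strongly in $\dot H^1(\mathbb{R}^3)\cap L^q(\mathbb{R}^3)$ for every $q>3$, as $\omega\to0$.
   Context: $W(x)=\left(1+\frac{|x|^2}{3}\right)^{-1/2}$ is the Aubin–Talenti function, solving $-\Delta W=W^5$ in $\mathbb{R}^3$. Positive solutions are radially symmetric about a point; they are normalized (by translation) to be radial about the origin, so that the maximum is attained at $0$. *)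

theory Defs
  imports "HOL-Analysis.Analysis" "HOL-Probability.Essential_Supremum"
begin

coinductive smooth_fun :: "('a::euclidean_space \<Rightarrow> real) \<Rightarrow> bool" where
  "\<lbrakk> \<forall>x. (f has_derivative D x) (at x);
     \<forall>b\<in>Basis. smooth_fun (\<lambda>x. D x b) \<rbrakk> \<Longrightarrow> smooth_fun f"

definition test_fun :: "('a::euclidean_space \<Rightarrow> real) \<Rightarrow> bool" where
  "test_fun \<phi> \<longleftrightarrow> smooth_fun \<phi> \<and> compact (closure {x. \<phi> x \<noteq> 0})"

definition weak_grad :: "('a::euclidean_space \<Rightarrow> real) \<Rightarrow> ('a \<Rightarrow> 'a) \<Rightarrow> bool" where
  "weak_grad u g \<longleftrightarrow> u \<in> borel_measurable lborel \<and> g \<in> borel_measurable lborel \<and>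
     (\<forall>\<phi> D. test_fun \<phi> \<and> (\<forall>x. (\<phi> has_derivative D x) (at x)) \<longrightarrow>
        (\<forall>b\<in>Basis. integrable lborel (\<lambda>x. u x * D x b) \<and>
                    integrable lborel (\<lambda>x. (g x \<bullet> b) * \<phi> x) \<and>
                    (\<integral>x. u x * D x b \<partial>lborel) = - (\<integral>x. (g x \<bullet> b) * \<phi> x \<partial>lborel)))"

definition H1 :: "('a::euclidean_space \<Rightarrow> real) \<Rightarrow> bool" where
  "H1 u \<longleftrightarrow> u \<in> borel_measurable lborel \<and> (\<integral>\<^sup>+x. ennreal ((u x)\<^sup>2) \<partial>lborel) < \<infinity> \<and>
     (\<exists>g. weak_grad u g \<and> (\<integral>\<^sup>+x. ennreal ((norm (g x))\<^sup>2) \<partial>lborel) < \<infinity>)"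

definition weak_solution :: "real \<Rightarrow> real \<Rightarrow> ('a::euclidean_space \<Rightarrow> real) \<Rightarrow> bool" where
  "weak_solution p \<omega> u \<longleftrightarrow> (\<exists>g. weak_grad u g \<and>
     (\<forall>\<phi> D. test_fun \<phi> \<and> (\<forall>x. (\<phi> has_derivative D x) (at x)) \<longrightarrow>
        (let F = (\<lambda>x. (\<Sum>b\<in>Basis. (g x \<bullet> b) * D x b) + \<omega> * u x * \<phi> x
                     - \<bar>u x\<bar> powr (p - 1) * u x * \<phi> x - \<bar>u x\<bar> ^ 4 * u x * \<phi> x)
         in integrable lborel F \<and> (\<integral>x. F x \<partial>lborel) = 0)))"

definition Linf_norm :: "('a::euclidean_space \<Rightarrow> real) \<Rightarrow> ereal" where
  "Linf_norm u = esssup lborel (\<lambda>x. ereal \<bar>u x\<bar>)"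

text \<open>Aubin--Talenti function in R^3.\<close>
definition W :: "real^3 \<Rightarrow> real" where
  "W x = (1 + (norm x)\<^sup>2 / 3) powr (-1/2)"

end

theory Submission
  imports Defs
begin

text \<open>A radial solution \<open>u(x) = V(\<bar>x\<bar>)\<close> solves, after modification on a null set,
  \<open>(r\<^sup>2 V')' = - r\<^sup>2 f(V)\<close>, and finite energy excludes a singularity at \<open>0\<close>. The energy
  \<open>V'\<^sup>2/2 + F(V)\<close> is decreasing and nonnegative, so \<open>V\<close> is decreasing and \<open>\<parallel>u\<parallel>\<^sub>\<infinity> = V(0)\<close>. The rescaled
  profile \<open>w\<close> solves the equation with \<open>f(s) = s\<^sup>5 + \<beta> s\<^sup>p - \<alpha> s\<close> and \<open>w(0) = 1\<close>, where \<open>\<alpha>, \<beta> \<rightarrow> 0\<close>, so it converges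
  to \<open>W\<close> with its derivative on bounded intervals. The Pohozaev functional is nonnegative and makes
  \<open>- w' / (r w\<^sup>3)\<close> nondecreasing; this yields the uniform bound \<open>w \<le> 2 / r\<close>, which dominates the \<open>L\<^sup>q\<close> norms
  for \<open>q > 3\<close>. For the gradient put \<open>z = r w\<close>: since \<open>0 \<le> z \<le> 2\<close> and \<open>z'' = - r f(w)\<close> is uniformly small far out,
  Landau's inequality makes \<open>z'\<close> small there; \<open>z\<close> is unimodal, so \<open>\<integral>z'\<^sup>2 \<le> 4 sup \<bar>z'\<bar>\<close> and the energy cannot
  escape to infinity.\<close>

section \<open>Smooth functions\<close>

text \<open>Two difficulties shape the argument. (1) Only symmetry, finite energy and the weak form
  are given, so the differential equation has to be extracted first. The fields (\<psi>(r)/r^3) x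
  link these data: such a field is the gradient of a radial test function and has divergence
  \<psi>'(r)/r^2, so the unknown weak gradient drops out of the tested equation. (2) The parameters
  \<alpha> = \<omega>/M^4 and \<beta> = M^(p-5) tend to 0, but w \<le> 2/r alone does not control w'
  far out: the flux -r^2 w' is the integral of s^2 f(w), to which \<beta> w^p may contribute about
  \<beta> r^(3-p), unbounded in r. This is why the gradient tail is not estimated from the flux but
  through r w, whose second derivative contains no first-order term. Comparison with W on a ball of
  radius R costs a factor exp(4 R); hence \<omega> tends to 0 at fixed R, and R goes to infinity
  only afterwards. The threshold q > 3 is the integrability of r^2 (2/r)^q at infinity.\<close>

primrec differentiable_times :: "nat \<Rightarrow> ('a::euclidean_space \<Rightarrow> real) \<Rightarrow> bool" where
  "differentiable_times 0 f \<longleftrightarrow> True"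
| "differentiable_times (Suc n) f \<longleftrightarrow>
     (\<exists>D. (\<forall>x. (f has_derivative D x) (at x)) \<and> (\<forall>b\<in>Basis. differentiable_times n (\<lambda>x. D x b)))"

lemma differentiable_times_SucI:
  assumes "\<And>x. (f has_derivative D x) (at x)" "\<And>b. b \<in> Basis \<Longrightarrow> differentiable_times n (\<lambda>x. D x b)"
  shows "differentiable_times (Suc n) f"
  using assms by auto

lemma differentiable_times_SucE:
  assumes "differentiable_times (Suc n) f"
  obtains D where "\<And>x. (f has_derivative D x) (at x)" "\<And>b. b \<in> Basis \<Longrightarrow> differentiable_times n (\<lambda>x. D x b)"
  using assms by auto

lemma smooth_funE:
  assumes "smooth_fun f"
  obtains D where "\<And>x. (f has_derivative D x) (at x)" "\<And>b. b \<in> Basis \<Longrightarrow> smooth_fun (\<lambda>x. D x b)"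
  using assms by (cases rule: smooth_fun.cases) auto

text \<open>Bridge to ordinary induction. Coinduction handles products badly, since the derivative
  of a product is a sum of products and not again a product; at a fixed order \<open>n\<close> the
  closure properties are plain inductions. In the converse direction the derivatives obtained for
  different \<open>n\<close> agree by uniqueness.\<close>

lemma smooth_fun_iff: "smooth_fun f \<longleftrightarrow> (\<forall>n. differentiable_times n f)"
proof
  have "differentiable_times n f" if "smooth_fun f" for n and f :: "'a \<Rightarrow> real"
    using that
  proof (induction n arbitrary: f)
    case (Suc n)
    from Suc.prems obtain D where "\<And>x. (f has_derivative D x) (at x)" "\<And>b. b \<in> Basis \<Longrightarrow> smooth_fun (\<lambda>x. D x b)"
      by (rule smooth_funE) blast
    with Suc.IH show ?case by auto
  qed simp
  then show "smooth_fun f \<Longrightarrow> \<forall>n. differentiable_times n f" by blast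
next
  assume "\<forall>n. differentiable_times n f"
  then show "smooth_fun f"
  proof (coinduction arbitrary: f)
    case smooth_fun
    then have "differentiable_times (Suc 0) f" by blast
    then obtain D where D: "\<And>x. (f has_derivative D x) (at x)" by auto
    have "differentiable_times n (\<lambda>x. D x b)" if "b \<in> Basis" for b n
    proof -
      from smooth_fun have "differentiable_times (Suc n) f" by blast
      then obtain D' where D': "\<And>x. (f has_derivative D' x) (at x)"
          "\<And>b. b \<in> Basis \<Longrightarrow> differentiable_times n (\<lambda>x. D' x b)"
        by (rule differentiable_times_SucE) blast
      have "D' = D" using D D'(1) has_derivative_unique by blast
      with D'(2) that show ?thesis by simp
    qed
    with D show ?case by blast
  qed
qed

lemma differentiable_times_const: "differentiable_times n (\<lambda>x. c)"
proof (induction n arbitrary: c)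
  case (Suc n)
  show ?case by (rule differentiable_times_SucI[where D="\<lambda>x v. 0"]) (use Suc in auto)
qed simp

lemma differentiable_times_linear: "bounded_linear l \<Longrightarrow> differentiable_times n l"
proof (cases n)
  case (Suc m)
  assume "bounded_linear l"
  then show ?thesis unfolding Suc
    by (intro differentiable_times_SucI[where D="\<lambda>x. l"])
       (auto intro: differentiable_times_const bounded_linear_imp_has_derivative)
qed simp

lemma differentiable_times_add:
  "differentiable_times n f \<Longrightarrow> differentiable_times n g \<Longrightarrow> differentiable_times n (\<lambda>x. f x + g x)"
proof (induction n arbitrary: f g)
  case (Suc n)
  from Suc.prems(1) obtain D where D: "\<And>x. (f has_derivative D x) (at x)"
      "\<And>b. b \<in> Basis \<Longrightarrow> differentiable_times n (\<lambda>x. D x b)" by (rule differentiable_times_SucE) blast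
  from Suc.prems(2) obtain E where E: "\<And>x. (g has_derivative E x) (at x)"
      "\<And>b. b \<in> Basis \<Longrightarrow> differentiable_times n (\<lambda>x. E x b)" by (rule differentiable_times_SucE) blast
  show ?case
    by (rule differentiable_times_SucI[where D="\<lambda>x v. D x v + E x v"])
       (auto intro!: has_derivative_add D E Suc.IH)
qed simp

lemma differentiable_times_Suc_imp: "differentiable_times (Suc n) f \<Longrightarrow> differentiable_times n f"
proof (induction n arbitrary: f)
  case (Suc n)
  from Suc.prems obtain D where D: "\<And>x. (f has_derivative D x) (at x)"
      "\<And>b. b \<in> Basis \<Longrightarrow> differentiable_times (Suc n) (\<lambda>x. D x b)" by (rule differentiable_times_SucE) blast
  show ?case by (rule differentiable_times_SucI[OF D(1)]) (auto intro: Suc.IH D(2))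
qed simp

lemma differentiable_times_mult:
  "differentiable_times n f \<Longrightarrow> differentiable_times n g \<Longrightarrow> differentiable_times n (\<lambda>x. f x * g x)"
proof (induction n arbitrary: f g)
  case (Suc n)
  from Suc.prems(1) obtain D where D: "\<And>x. (f has_derivative D x) (at x)"
      "\<And>b. b \<in> Basis \<Longrightarrow> differentiable_times n (\<lambda>x. D x b)" by (rule differentiable_times_SucE) blast
  from Suc.prems(2) obtain E where E: "\<And>x. (g has_derivative E x) (at x)"
      "\<And>b. b \<in> Basis \<Longrightarrow> differentiable_times n (\<lambda>x. E x b)" by (rule differentiable_times_SucE) blast
  show ?case
    by (rule differentiable_times_SucI[where D="\<lambda>x v. f x * E x v + D x v * g x"])
       (auto intro!: has_derivative_mult D E differentiable_times_add Suc.IH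
          differentiable_times_Suc_imp[OF Suc.prems(1)] differentiable_times_Suc_imp[OF Suc.prems(2)])
qed simp

lemma smooth_fun_const [simp, intro]: "smooth_fun (\<lambda>x. c)"
  by (simp add: smooth_fun_iff differentiable_times_const)

lemma smooth_fun_linear: "bounded_linear l \<Longrightarrow> smooth_fun l"
  by (simp add: smooth_fun_iff differentiable_times_linear)

lemma smooth_fun_add: "smooth_fun f \<Longrightarrow> smooth_fun g \<Longrightarrow> smooth_fun (\<lambda>x. f x + g x)"
  by (simp add: smooth_fun_iff differentiable_times_add)

lemma smooth_fun_mult: "smooth_fun f \<Longrightarrow> smooth_fun g \<Longrightarrow> smooth_fun (\<lambda>x. f x * g x)"
  by (simp add: smooth_fun_iff differentiable_times_mult)

lemma smooth_fun_partial:
  assumes "smooth_fun f" "\<And>x. (f has_derivative D x) (at x)" "b \<in> Basis"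
  shows "smooth_fun (\<lambda>x. D x b)"
proof -
  obtain D' where D': "\<And>x. (f has_derivative D' x) (at x)" "\<And>b. b \<in> Basis \<Longrightarrow> smooth_fun (\<lambda>x. D' x b)"
    using assms(1) by (rule smooth_funE) blast
  have "D' = D" using assms(2) D'(1) has_derivative_unique by blast
  with D'(2) assms(3) show ?thesis by simp
qed

lemma smooth_fun_realI:
  fixes f :: "real \<Rightarrow> real"
  assumes "\<And>x. (f has_real_derivative f' x) (at x)" "smooth_fun f'"
  shows "smooth_fun f"
  by (rule smooth_fun.intros[where D="\<lambda>x v. f' x * v"]) (use assms in \<open>auto simp: has_field_derivative_def\<close>)

lemma smooth_fun_realE:
  fixes f :: "real \<Rightarrow> real"
  assumes "smooth_fun f"
  obtains f' where "\<And>x. (f has_real_derivative f' x) (at x)" "smooth_fun f'"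
proof -
  obtain D where D: "\<And>x. (f has_derivative D x) (at x)" "\<And>b. b \<in> Basis \<Longrightarrow> smooth_fun (\<lambda>x. D x b)"
    using assms by (rule smooth_funE) blast
  have "D x = (*) (D x 1)" for x
  proof
    fix v
    have "D x (v *\<^sub>R 1) = v *\<^sub>R D x 1" using D(1)[of x] by (metis has_derivative_linear linear_cmul)
    then show "D x v = D x 1 * v" by simp
  qed
  then have "(f has_real_derivative D x 1) (at x)" for x
    using D(1)[of x] by (simp add: has_field_derivative_def)
  with D(2)[of 1] show ?thesis by (intro that[of "\<lambda>x. D x 1"]) auto
qed

lemma smooth_fun_deriv:
  fixes f :: "real \<Rightarrow> real"
  assumes "smooth_fun f" "\<And>x. (f has_real_derivative f' x) (at x)"
  shows "smooth_fun f'"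
  using smooth_fun_partial[OF assms(1), of "\<lambda>x v. f' x * v" 1] assms(2)
  by (auto simp: has_field_derivative_def)

lemma smooth_fun_continuous: "smooth_fun f \<Longrightarrow> continuous_on S f"
  by (metis smooth_funE has_derivative_continuous_on has_derivative_at_withinI)

section \<open>Smooth bumps on the line and division by powers of the radius\<close>

definition exp_bump :: "real \<Rightarrow> real" where
  "exp_bump t = (if t > 0 then exp (- (1 / t)) else 0)"

lemma exp_bump_bounds: "0 \<le> exp_bump t" "exp_bump t \<le> 1"
  by (auto simp: exp_bump_def)

lemma poly_exp_bump_tendsto_0:
  "((\<lambda>t. poly q (1 / t) * exp_bump t) \<longlongrightarrow> 0) (at (0::real))"
proof -
  have mono: "((\<lambda>x::real. x ^ n * exp (- x)) \<longlongrightarrow> 0) at_top" for n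
    using tendsto_power_div_exp_0[of n] by (simp add: exp_minus field_simps)
  have "((\<lambda>x::real. poly q x * exp (- x)) \<longlongrightarrow> 0) at_top"
  proof -
    have "((\<lambda>x::real. \<Sum>i\<le>degree q. coeff q i * (x ^ i * exp (- x))) \<longlongrightarrow> (\<Sum>i\<le>degree q. coeff q i * 0)) at_top"
      by (intro tendsto_intros mono)
    then show ?thesis by (simp add: poly_altdef sum_distrib_right mult.assoc)
  qed
  then have *: "((\<lambda>t::real. poly q (inverse t) * exp (- inverse t)) \<longlongrightarrow> 0) (at_right 0)"
    using filterlim_inverse_at_top_right filterlim_compose by blast
  have R: "((\<lambda>t. poly q (1 / t) * exp_bump t) \<longlongrightarrow> 0) (at_right (0::real))"
    by (rule Lim_transform_eventually[OF *])
       (auto simp: eventually_at_right_less exp_bump_def inverse_eq_divide intro!: eventually_mono[OF eventually_at_right_less])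
  have L: "((\<lambda>t. poly q (1 / t) * exp_bump t) \<longlongrightarrow> 0) (at_left (0::real))"
    by (rule Lim_transform_eventually[OF tendsto_const])
       (auto simp: exp_bump_def eventually_at_left_field intro!: exI[of _ "-1"])
  show ?thesis using L R by (simp add: filterlim_split_at)
qed

text \<open>In the variable x = 1/t one has d/dt = -x^2 d/dx, and applied to q(x) exp(-x) this gives
  x^2 (q - q') exp(-x): the family is closed under differentiation. At t = 0 the difference quotient
  is again a member of the family, with q multiplied by x, so it tends to 0.\<close>

lemma poly_exp_bump_deriv:
  "((\<lambda>t. poly q (1 / t) * exp_bump t) has_real_derivative
     poly ([:0, 0, 1:] * (q - pderiv q)) (1 / t) * exp_bump t) (at (t::real))"
proof (cases t "0::real" rule: linorder_cases)
  case less
  have "((\<lambda>t::real. 0) has_real_derivative 0) (at t)" by simp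
  then have "((\<lambda>t. poly q (1 / t) * exp_bump t) has_real_derivative 0) (at t)"
    by (rule DERIV_cong_ev[OF refl _ refl, THEN iffD1, rotated])
       (use less in \<open>auto simp: exp_bump_def eventually_nhds intro!: exI[of _ "{..<0}"]\<close>)
  then show ?thesis using less by (simp add: exp_bump_def)
next
  case greater
  have "((\<lambda>t. poly q (1 / t) * exp (- (1 / t))) has_real_derivative
     poly ([:0, 0, 1:] * (q - pderiv q)) (1 / t) * exp (- (1 / t))) (at t)"
    using greater
    by (auto intro!: derivative_eq_intros simp: field_simps power2_eq_square)
  then show ?thesis
    by (subst DERIV_cong_ev[OF refl _ refl, where g="\<lambda>t. poly q (1 / t) * exp (- (1 / t))"])
       (use greater in \<open>auto simp: exp_bump_def eventually_nhds intro!: exI[of _ "{0<..}"]\<close>)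
next
  case equal
  have "((\<lambda>h. poly (pCons 0 q) (1 / h) * exp_bump h) \<longlongrightarrow> 0) (at 0)"
    by (rule poly_exp_bump_tendsto_0)
  then show ?thesis
    unfolding DERIV_def using equal by (simp add: exp_bump_def field_simps)
qed

lemma smooth_poly_exp_bump: "smooth_fun (\<lambda>t. poly q (1 / t) * exp_bump t)"
proof -
  have "differentiable_times n (\<lambda>t. poly q (1 / t) * exp_bump t)" for n
  proof (induction n arbitrary: q)
    case (Suc n)
    show ?case
      by (rule differentiable_times_SucI[where
            D="\<lambda>t v. poly ([:0, 0, 1:] * (q - pderiv q)) (1 / t) * exp_bump t * v"])
         (use poly_exp_bump_deriv[of q] Suc in \<open>auto simp only: has_field_derivative_def Basis_real_def singleton_iff mult_1_right\<close>)
  qed simp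
  then show ?thesis by (simp add: smooth_fun_iff)
qed

lemma smooth_exp_bump: "smooth_fun exp_bump"
  using smooth_poly_exp_bump[of 1] by simp

lemma smooth_fun_affine:
  fixes f :: "real \<Rightarrow> real"
  assumes "smooth_fun f" shows "smooth_fun (\<lambda>x. f (c * x + d))"
proof -
  have "differentiable_times n (\<lambda>x. f (c * x + d))" for n
    using assms
  proof (induction n arbitrary: f)
    case (Suc n)
    obtain f' where f': "\<And>x. (f has_real_derivative f' x) (at x)" "smooth_fun f'"
      using Suc.prems by (rule smooth_fun_realE) blast
    have "((\<lambda>x. f (c * x + d)) has_real_derivative f' (c * x + d) * c) (at x)" for x
      by (rule DERIV_chain2[OF f'(1)]) (auto intro!: derivative_eq_intros)
    moreover have "differentiable_times n (\<lambda>x. f' (c * x + d) * c)"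
      by (rule differentiable_times_mult[OF Suc.IH[OF f'(2)] differentiable_times_const])
    ultimately show ?case
      by (intro differentiable_times_SucI[where D="\<lambda>x v. f' (c * x + d) * c * v"])
         (auto simp: has_field_derivative_def)
  qed simp
  then show ?thesis by (simp add: smooth_fun_iff)
qed

text \<open>Smooth minorants of the indicator of (a, b). The index n only steepens the flanks, since
  exp(-1/(n t)) tends to 1 for t > 0; the support stays inside [a, b] for every n.\<close>

definition interval_bump :: "nat \<Rightarrow> real \<Rightarrow> real \<Rightarrow> real \<Rightarrow> real" where
  "interval_bump n a b t = exp_bump (real n * (t - a)) * exp_bump (real n * (b - t))"

lemma smooth_interval_bump: "smooth_fun (interval_bump n a b)"
proof -
  have "smooth_fun (\<lambda>t. exp_bump (real n * t + (- real n * a)) * exp_bump ((- real n) * t + real n * b))"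
    by (intro smooth_fun_mult smooth_fun_affine smooth_exp_bump)
  moreover have "interval_bump n a b = (\<lambda>t. exp_bump (real n * t + (- real n * a)) * exp_bump ((- real n) * t + real n * b))"
    by (auto simp: interval_bump_def algebra_simps fun_eq_iff)
  ultimately show ?thesis by simp
qed

lemma interval_bump_bounds: "0 \<le> interval_bump n a b t" "interval_bump n a b t \<le> 1"
  using exp_bump_bounds by (auto simp: interval_bump_def mult_le_one)

lemma interval_bump_outside: "t \<notin> {a<..<b} \<Longrightarrow> interval_bump n a b t = 0"
  by (auto simp: interval_bump_def exp_bump_def mult_le_0_iff not_less zero_less_mult_iff)

lemma exp_bump_scale_tendsto: "t > 0 \<Longrightarrow> (\<lambda>n. exp_bump (real n * t)) \<longlonglongrightarrow> 1"
proof -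
  assume "t > 0"
  have "(\<lambda>n. exp (- ((1 / t) * (1 / real n)))) \<longlonglongrightarrow> exp (- ((1 / t) * 0))"
    by (intro tendsto_intros lim_1_over_n)
  then have "(\<lambda>n. exp (- ((1 / t) * (1 / real n)))) \<longlonglongrightarrow> 1" by simp
  then show ?thesis
    by (rule Lim_transform_eventually)
       (use \<open>t > 0\<close> in \<open>auto simp: exp_bump_def eventually_sequentially field_simps intro!: exI[of _ 1]\<close>)
qed

lemma interval_bump_tendsto: "(\<lambda>n. interval_bump n a b t) \<longlonglongrightarrow> indicator {a<..<b} t"
proof (cases "t \<in> {a<..<b}")
  case True
  then have "(\<lambda>n. interval_bump n a b t) \<longlonglongrightarrow> 1 * 1"
    unfolding interval_bump_def by (intro tendsto_mult exp_bump_scale_tendsto) auto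
  with True show ?thesis by simp
qed (simp add: interval_bump_outside)

lemma deriv_zero_left:
  fixes \<psi> :: "real \<Rightarrow> real"
  assumes "\<And>x. (\<psi> has_real_derivative \<psi>' x) (at x)" "smooth_fun \<psi>'"
    and zero: "\<And>r. r \<le> a \<Longrightarrow> \<psi> r = 0" and "r \<le> a"
  shows "\<psi>' r = 0"
proof -
  have "\<psi>' t = 0" if "t < a" for t
  proof -
    have "((\<lambda>_. 0) has_real_derivative \<psi>' t) (at t)"
      by (rule DERIV_cong_ev[OF refl _ refl, THEN iffD1, OF _ assms(1)[of t]])
         (use zero that in \<open>auto simp: eventually_nhds intro!: exI[of _ "{..<a}"]\<close>)
    then show ?thesis by (metis DERIV_const DERIV_unique)
  qed
  moreover from this have "\<psi>' a = 0"
  proof (intro tendsto_unique[of "at_left a"])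
    show "(\<psi>' \<longlongrightarrow> \<psi>' a) (at_left a)"
      using smooth_fun_continuous[OF assms(2), of UNIV]
      by (simp add: continuous_on_eq_continuous_at isCont_def filterlim_at_split)
    show "(\<psi>' \<longlongrightarrow> 0) (at_left a)"
      by (rule Lim_transform_eventually[OF tendsto_const])
         (use \<open>\<And>t. t < a \<Longrightarrow> \<psi>' t = 0\<close> in \<open>auto simp: eventually_at_left_field intro!: exI[of _ "a - 1"]\<close>)
  qed auto
  ultimately show ?thesis using \<open>r \<le> a\<close> by (cases "r = a") auto
qed

text \<open>The singularity of r^(-k) is harmless because \<psi> vanishes up to a > 0. The induction
  runs over all k at once: a derivative turns \<psi>/r^k into \<psi>'/r^k - k \<psi>/r^(k+1), two
  functions of the same kind.\<close>

lemma smooth_fun_divide_power: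
  fixes \<psi> :: "real \<Rightarrow> real"
  assumes "smooth_fun \<psi>" "\<And>r. r \<le> a \<Longrightarrow> \<psi> r = 0" "a > 0"
  shows "smooth_fun (\<lambda>r. \<psi> r / r ^ k)"
proof -
  have "differentiable_times n (\<lambda>r. \<psi> r / r ^ k)" for n
    using assms(1,2)
  proof (induction n arbitrary: \<psi> k)
    case (Suc n)
    obtain \<psi>' where \<psi>': "\<And>x. (\<psi> has_real_derivative \<psi>' x) (at x)" "smooth_fun \<psi>'"
      using Suc.prems(1) by (rule smooth_fun_realE) blast
    note zero = deriv_zero_left[OF \<psi>' Suc.prems(2)]
    have "((\<lambda>r. \<psi> r / r ^ k) has_real_derivative \<psi>' r / r ^ k + - real k * (\<psi> r / r ^ (Suc k))) (at r)" for r
    proof (cases "r < a")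
      case True
      then have "((\<lambda>r. \<psi> r / r ^ k) has_real_derivative 0) (at r)"
        by (intro DERIV_cong_ev[OF refl _ refl, THEN iffD2, OF _ DERIV_const[of 0]])
           (use Suc.prems(2) in \<open>auto simp: eventually_nhds intro!: exI[of _ "{..<a}"]\<close>)
      with True zero[of r] Suc.prems(2)[of r] show ?thesis by simp
    next
      case False
      then have "r > 0" using assms(3) by simp
      have "real k * r ^ (k - Suc 0) = real k * r ^ k / r" using \<open>r > 0\<close> by (cases k) auto
      then have eq: "(\<psi>' r * r ^ k - \<psi> r * (real k * (1 * r ^ (k - Suc 0)))) / (r ^ k * r ^ k)
          = \<psi>' r / r ^ k + - real k * (\<psi> r / r ^ Suc k)"
        using \<open>r > 0\<close> by (simp only: mult_1) (simp add: field_simps)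
      have "((\<lambda>r. r ^ k) has_real_derivative real k * (1 * r ^ (k - Suc 0))) (at r)"
        by (rule DERIV_power[OF DERIV_ident])
      from DERIV_divide[OF \<psi>'(1)[of r] this] eq \<open>r > 0\<close> show ?thesis by simp
    qed
    moreover have "differentiable_times n (\<lambda>r. \<psi>' r / r ^ k + - real k * (\<psi> r / r ^ (Suc k)))"
      by (intro differentiable_times_add differentiable_times_mult differentiable_times_const Suc.IH \<psi>' zero Suc.prems)
    ultimately show ?case
      by (intro differentiable_times_SucI[where D="\<lambda>r v. (\<psi>' r / r ^ k + - real k * (\<psi> r / r ^ (Suc k))) * v"])
         (auto simp: has_field_derivative_def)
  qed simp
  then show ?thesis by (simp add: smooth_fun_iff)
qed

section \<open>Radial functions and polar coordinates\<close>

text \<open>A partial derivative of \<psi>(|x|) is \<psi>'(r)/r times a coordinate, that is, a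
  radial function of the same kind times a linear one, so induction on the order closes. Vanishing
  near 0 hides the point where the norm is not differentiable.\<close>

lemma smooth_fun_norm:
  fixes \<psi> :: "real \<Rightarrow> real"
  assumes "smooth_fun \<psi>" "\<And>r. r \<le> a \<Longrightarrow> \<psi> r = 0" "a > 0"
  shows "smooth_fun (\<lambda>x::'a::euclidean_space. \<psi> (norm x))"
    and "\<And>\<psi>' x. (\<And>x. (\<psi> has_real_derivative \<psi>' x) (at x)) \<Longrightarrow>
       ((\<lambda>x::'a. \<psi> (norm x)) has_derivative (\<lambda>v. \<psi>' (norm x) / norm x * (x \<bullet> v))) (at x)"
proof -
  have deriv: "((\<lambda>x::'a. \<psi> (norm x)) has_derivative (\<lambda>v. \<psi>' (norm x) / norm x * (x \<bullet> v))) (at x)"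
    if \<psi>: "smooth_fun \<psi>" "\<And>r. r \<le> a \<Longrightarrow> \<psi> r = 0" "\<And>x. (\<psi> has_real_derivative \<psi>' x) (at x)" for \<psi> \<psi>' :: "real \<Rightarrow> real" and x
  proof (cases "norm x < a")
    case True
    have "\<psi>' (norm x) = 0"
      using deriv_zero_left[OF \<psi>(3) smooth_fun_deriv[OF \<psi>(1,3)] \<psi>(2)] True by simp
    moreover have "((\<lambda>x::'a. \<psi> (norm x)) has_derivative (\<lambda>v. 0)) (at x)"
      by (rule has_derivative_transform_within_open[OF has_derivative_const[of 0], where s="ball 0 a"])
         (use True \<psi>(2) in auto)
    ultimately show ?thesis by simp
  next
    case False
    then have "x \<noteq> 0" using assms(3) by auto
    have "((\<psi> \<circ> norm) has_derivative ((*) (\<psi>' (norm x)) \<circ> (\<lambda>v. inner v (sgn x)))) (at x)"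
      using has_derivative_norm[OF \<open>x \<noteq> 0\<close>] \<psi>(3)[of "norm x"]
      by (intro diff_chain_at) (auto simp: has_field_derivative_def)
    then show ?thesis
      by (simp add: o_def sgn_div_norm inner_commute divide_inverse mult_ac)
  qed
  then show "\<And>\<psi>' x. (\<And>x. (\<psi> has_real_derivative \<psi>' x) (at x)) \<Longrightarrow>
       ((\<lambda>x::'a. \<psi> (norm x)) has_derivative (\<lambda>v. \<psi>' (norm x) / norm x * (x \<bullet> v))) (at x)"
    using assms by blast
  have "differentiable_times n (\<lambda>x::'a. \<psi> (norm x))" for n
    using assms(1,2)
  proof (induction n arbitrary: \<psi>)
    case (Suc n)
    obtain \<psi>' where \<psi>': "\<And>x. (\<psi> has_real_derivative \<psi>' x) (at x)" "smooth_fun \<psi>'"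
      using Suc.prems(1) by (rule smooth_fun_realE) blast
    have zero: "\<psi>' r = 0" if "r \<le> a" for r by (rule deriv_zero_left[OF \<psi>' Suc.prems(2) that])
    have "smooth_fun (\<lambda>r. \<psi>' r / r)"
      using smooth_fun_divide_power[OF \<psi>'(2) zero assms(3), of 1] by simp
    then have "differentiable_times n (\<lambda>x::'a. \<psi>' (norm x) / norm x)"
      using Suc.IH[of "\<lambda>r. \<psi>' r / r"] zero by simp
    then show ?case
      by (intro differentiable_times_SucI[OF deriv[OF Suc.prems \<psi>'(1)]]
            differentiable_times_mult[OF _ differentiable_times_linear[OF bounded_linear_inner_left]])
  qed simp
  then show "smooth_fun (\<lambda>x::'a. \<psi> (norm x))" by (simp add: smooth_fun_iff)
qed

lemma antiderivative_vanishing_left: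
  fixes k :: "real \<Rightarrow> real"
  assumes "continuous_on UNIV k" "\<And>r. r \<le> a \<Longrightarrow> k r = 0"
  obtains K where "\<And>r. (K has_real_derivative k r) (at r)" "\<And>r. r \<le> a \<Longrightarrow> K r = 0"
proof
  define K where "K = (\<lambda>r. integral {a - 1..r} k)"
  show K0: "K r = 0" if "r \<le> a" for r
    unfolding K_def using assms(2) that by (intro integral_unique has_integral_is_0) auto
  show "(K has_real_derivative k r) (at r)" for r
  proof (cases "r < a")
    case True
    have "(K has_real_derivative 0) (at r)"
      by (intro DERIV_cong_ev[OF refl _ refl, THEN iffD2, OF _ DERIV_const[of 0]])
         (use K0 True in \<open>auto simp: eventually_nhds intro!: exI[of _ "{..<a}"]\<close>)
    then show ?thesis using True assms(2)[of r] by simp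
  next
    case False
    have "(K has_real_derivative k r) (at r within {a - 1..r + 1})"
      unfolding K_def
      by (rule integral_has_real_derivative) (use False assms(1) continuous_on_subset in auto)
    moreover have "at r within {a - 1..r + 1} = at r"
      using False by (intro at_within_interior) auto
    ultimately show ?thesis by simp
  qed
qed

section \<open>Lebesgue measure in polar coordinates\<close>

definition polar_density :: "real \<Rightarrow> real" where
  "polar_density r = indicator {0..} r * (4 * pi * r\<^sup>2)"

lemma polar_density_nonneg [simp]: "0 \<le> polar_density r"
  by (simp add: polar_density_def)

lemma polar_density_measurable [measurable]: "polar_density \<in> borel_measurable borel"
  unfolding polar_density_def by measurable

text \<open>Both measures give the half-line {..r} the volume of the ball of radius r, and
  half-lines form a generator stable under intersection. The radial integration formulas below are
  read off from this push-forward.\<close>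

lemma distr_norm_lborel: "distr lborel borel (norm :: real^3 \<Rightarrow> real) = density lborel (\<lambda>r. ennreal (polar_density r))"
proof (rule measure_eqI_generator_eq[where \<Omega>=UNIV and E="range (\<lambda>a::real. {..a})" and A="\<lambda>i::nat. {..real i}"])
  show "Int_stable (range (\<lambda>a::real. {..a}))"
    by (auto simp: Int_stable_def)
  have *: "emeasure (distr lborel borel (norm :: real^3 \<Rightarrow> real)) {..r} = ennreal (if r < 0 then 0 else 4/3 * pi * r ^ 3)" for r
  proof -
    have "emeasure (distr lborel borel (norm :: real^3 \<Rightarrow> real)) {..r} = emeasure lborel (cball (0::real^3) r)"
      by (subst emeasure_distr) (auto simp: vimage_def cball_def)
    also have "\<dots> = ennreal (if r < 0 then 0 else 4/3 * pi * r ^ 3)"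
      by (cases "r < 0") (auto simp: emeasure_cball eval_unit_ball_vol)
    finally show ?thesis .
  qed
  show "emeasure (distr lborel borel (norm :: real^3 \<Rightarrow> real)) X = emeasure (density lborel (\<lambda>r. ennreal (polar_density r))) X"
    if X: "X \<in> range (\<lambda>a::real. {..a})" for X
  proof -
    from X obtain r where r: "X = {..r}" by auto
    have "emeasure (density lborel (\<lambda>r. ennreal (polar_density r))) X = (\<integral>\<^sup>+s. ennreal (polar_density s) * indicator {..r} s \<partial>lborel)"
      by (subst emeasure_density) (auto simp: r)
    also have "\<dots> = (\<integral>\<^sup>+s. ennreal (4 * pi * s\<^sup>2) * indicator {0..r} s \<partial>lborel)"
      by (intro nn_integral_cong) (auto simp: polar_density_def split: split_indicator)
    also have "\<dots> = ennreal (if r < 0 then 0 else 4/3 * pi * r ^ 3)"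
    proof (cases "r < 0")
      case False
      have "(\<integral>\<^sup>+s. ennreal (4 * pi * s\<^sup>2) * indicator {0..r} s \<partial>lborel) = ennreal (4/3 * pi * r ^ 3 - 4/3 * pi * 0 ^ 3)"
        using False by (intro nn_integral_FTC_Icc) (auto intro!: derivative_eq_intros)
      with False show ?thesis by simp
    qed auto
    finally show ?thesis by (simp only: * r)
  qed
  show "range (\<lambda>i. {..real i}) \<subseteq> range (\<lambda>a::real. {..a})" by auto
  show "(\<Union>i. {..real i}) = UNIV" using real_arch_simple by auto
  show "emeasure (distr lborel borel (norm :: real^3 \<Rightarrow> real)) {..real i} \<noteq> \<infinity>" for i
    by (simp add: *)
  have "sets borel = sigma_sets UNIV (range (\<lambda>a::real. {..a}))"
    by (subst borel_eq_atMost) simp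
  then show "sets (distr lborel borel (norm :: real^3 \<Rightarrow> real)) = sigma_sets UNIV (range (\<lambda>a::real. {..a}))"
    "sets (density lborel (\<lambda>r. ennreal (polar_density r))) = sigma_sets UNIV (range (\<lambda>a::real. {..a}))"
    by auto
qed simp

lemma nn_integral_radial:
  assumes [measurable]: "k \<in> borel_measurable borel"
  shows "(\<integral>\<^sup>+x. k (norm (x::real^3)) \<partial>lborel) = (\<integral>\<^sup>+r. ennreal (polar_density r) * k r \<partial>lborel)"
proof -
  have "(\<integral>\<^sup>+x. k (norm (x::real^3)) \<partial>lborel) = integral\<^sup>N (distr lborel borel (norm :: real^3 \<Rightarrow> real)) k"
    by (subst nn_integral_distr) auto
  then show ?thesis
    by (simp add: distr_norm_lborel nn_integral_density)
qed

lemma integral_radial: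
  fixes k :: "real \<Rightarrow> real"
  assumes [measurable]: "k \<in> borel_measurable borel"
  shows "(\<integral>x. k (norm (x::real^3)) \<partial>lborel) = (\<integral>r. polar_density r * k r \<partial>lborel)"
proof -
  have "(\<integral>x. k (norm (x::real^3)) \<partial>lborel) = integral\<^sup>L (distr lborel borel (norm :: real^3 \<Rightarrow> real)) k"
    by (subst integral_distr) auto
  then show ?thesis
    by (simp add: distr_norm_lborel integral_density)
qed

lemma integrable_radial:
  fixes k :: "real \<Rightarrow> real"
  assumes [measurable]: "k \<in> borel_measurable borel"
  shows "integrable lborel (\<lambda>x. k (norm (x::real^3))) \<longleftrightarrow> integrable lborel (\<lambda>r. polar_density r * k r)"
proof -
  have "integrable lborel (\<lambda>x. k (norm (x::real^3))) \<longleftrightarrow> integrable (distr lborel borel (norm :: real^3 \<Rightarrow> real)) k"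
    by (subst integrable_distr_eq) auto
  then show ?thesis
    by (simp add: distr_norm_lborel integrable_density)
qed

lemma AE_radial:
  assumes [measurable]: "Measurable.pred borel P"
  shows "(AE x in lborel. P (norm (x::real^3))) \<longleftrightarrow> (AE r in lborel. r > 0 \<longrightarrow> P r)"
proof -
  have "(AE x in lborel. P (norm (x::real^3))) \<longleftrightarrow> (AE r in distr lborel borel (norm :: real^3 \<Rightarrow> real). P r)"
    by (subst AE_distr_iff) auto
  also have "\<dots> \<longleftrightarrow> (AE r in lborel. polar_density r > 0 \<longrightarrow> P r)"
    unfolding distr_norm_lborel by (subst AE_density) auto
  also have "\<dots> \<longleftrightarrow> (AE r in lborel. r > 0 \<longrightarrow> P r)"
    by (intro AE_cong) (auto simp: polar_density_def indicator_def)
  finally show ?thesis .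
qed

section \<open>Radial test functions\<close>

text \<open>The positive and the negative part of v have equal integrals over all half-lines, so
  they are densities of the same finite measure; densities are unique almost everywhere.\<close>

lemma AE_zero_if_atMost_integrals_zero:
  fixes v :: "real \<Rightarrow> real"
  assumes v: "integrable lborel v" and zero: "\<And>b. (\<integral>r. indicator {..b} r * v r \<partial>lborel) = 0"
  shows "AE r in lborel. v r = 0"
proof -
  have [measurable]: "v \<in> borel_measurable borel" using v by auto
  have fin: "emeasure (density lborel (\<lambda>r. ennreal (h r))) {..b} = ennreal (\<integral>r. indicator {..b} r * h r \<partial>lborel)"
    if "integrable lborel h" "\<And>r. 0 \<le> h r" for h :: "real \<Rightarrow> real" and b
  proof -
    have [measurable]: "h \<in> borel_measurable borel" using that by auto
    have "emeasure (density lborel (\<lambda>r. ennreal (h r))) {..b} = (\<integral>\<^sup>+r. ennreal (indicator {..b} r * h r) \<partial>lborel)"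
      by (subst emeasure_density) (auto intro!: nn_integral_cong split: split_indicator)
    also have "\<dots> = ennreal (\<integral>r. indicator {..b} r * h r \<partial>lborel)"
      using that integrable_mult_indicator[OF _ that(1), of "{..b}"] by (intro nn_integral_eq_integral) auto
    finally show ?thesis .
  qed
  let ?p = "\<lambda>r. max 0 (v r)" and ?m = "\<lambda>r. max 0 (- v r)"
  have int: "integrable lborel ?p" "integrable lborel ?m" using v by auto
  have "density lborel (\<lambda>r. ennreal (?p r)) = density lborel (\<lambda>r. ennreal (?m r))"
  proof (rule measure_eqI_generator_eq[where \<Omega>=UNIV and E="range (\<lambda>a::real. {..a})" and A="\<lambda>i::nat. {..real i}"])
    show "Int_stable (range (\<lambda>a::real. {..a}))"
      by (auto simp: Int_stable_def)
    show "emeasure (density lborel (\<lambda>r. ennreal (?p r))) X = emeasure (density lborel (\<lambda>r. ennreal (?m r))) X"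
      if X: "X \<in> range (\<lambda>a::real. {..a})" for X
    proof -
      from X obtain b where b: "X = {..b}" by auto
      have "(\<integral>r. indicator {..b} r * ?p r \<partial>lborel) - (\<integral>r. indicator {..b} r * ?m r \<partial>lborel)
        = (\<integral>r. indicator {..b} r * ?p r - indicator {..b} r * ?m r \<partial>lborel)"
        using integrable_mult_indicator[OF _ int(1), of "{..b}"] integrable_mult_indicator[OF _ int(2), of "{..b}"]
        by (intro Bochner_Integration.integral_diff[symmetric]) auto
      also have "\<dots> = (\<integral>r. indicator {..b} r * v r \<partial>lborel)"
        by (intro Bochner_Integration.integral_cong) (auto split: split_indicator)
      finally show ?thesis using fin[OF int(1), of b] fin[OF int(2), of b] zero[of b] by (simp add: b)
    qed
    show "range (\<lambda>i. {..real i}) \<subseteq> range (\<lambda>a::real. {..a})" by auto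
    show "(\<Union>i. {..real i}) = UNIV" using real_arch_simple by auto
    show "emeasure (density lborel (\<lambda>r. ennreal (?p r))) {..real i} \<noteq> \<infinity>" for i
      by (subst fin) (use int in auto)
    have "sets borel = sigma_sets UNIV (range (\<lambda>a::real. {..a}))"
      by (subst borel_eq_atMost) simp
    then show "sets (density lborel (\<lambda>r. ennreal (?p r))) = sigma_sets UNIV (range (\<lambda>a::real. {..a}))"
      "sets (density lborel (\<lambda>r. ennreal (?m r))) = sigma_sets UNIV (range (\<lambda>a::real. {..a}))"
      by auto
  qed simp
  then have "AE r in lborel. ennreal (?p r) = ennreal (?m r)"
    by (intro sigma_finite_measure.density_unique_iff[OF sigma_finite_lborel, THEN iffD1]) auto
  then show ?thesis
    by eventually_elim (auto simp: max_def split: if_splits)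
qed

lemma AE_zero_if_interval_integrals_zero:
  fixes w :: "real \<Rightarrow> real"
  assumes [measurable]: "w \<in> borel_measurable borel"
    and int: "\<And>a b. 0 < a \<Longrightarrow> a < b \<Longrightarrow> integrable lborel (\<lambda>r. indicator {a<..<b} r * w r)"
    and zero: "\<And>a b. 0 < a \<Longrightarrow> a < b \<Longrightarrow> (\<integral>r. indicator {a<..<b} r * w r \<partial>lborel) = 0"
  shows "AE r in lborel. r > 0 \<longrightarrow> w r = 0"
proof -
  \<comment> \<open>These intervals exhaust (0, \<infinity>); the extra 1 on the right keeps the one
    for n = 0 nonempty.\<close>
  have "AE r in lborel. r \<in> {1 / real (Suc n)<..<real (Suc n) + 1} \<longrightarrow> w r = 0" for n
  proof -
    define a where "a = 1 / real (Suc n)"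
    define b where "b = real (Suc n) + 1"
    have "0 < a" "a \<le> 1" "1 < b" by (auto simp: a_def b_def divide_le_eq)
    then have ab: "0 < a" "a < b" by auto
    have "AE r in lborel. indicator {a<..<b} r * w r = 0"
    proof (rule AE_zero_if_atMost_integrals_zero[OF int[OF ab]])
      fix t
      show "(\<integral>r. indicator {..t} r * (indicator {a<..<b} r * w r) \<partial>lborel) = 0"
      proof (cases "t \<le> a")
        case True
        then have "(\<lambda>r. indicator {..t} r * (indicator {a<..<b} r * w r)) = (\<lambda>r. 0)"
          by (auto split: split_indicator)
        then show ?thesis by simp
      next
        case False
        have "(\<integral>r. indicator {..t} r * (indicator {a<..<b} r * w r) \<partial>lborel)
            = (\<integral>r. indicator {a<..<min t b} r * w r \<partial>lborel)"
        proof (rule integral_cong_AE)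
          have "AE r in lborel. r \<noteq> t" by (rule AE_lborel_singleton)
          then show "AE r in lborel. indicator {..t} r * (indicator {a<..<b} r * w r) = indicator {a<..<min t b} r * w r"
            by eventually_elim (auto split: split_indicator)
        qed auto
        then show ?thesis using zero[of a "min t b"] ab False by auto
      qed
    qed
    then show ?thesis unfolding a_def[symmetric] b_def[symmetric]
      by eventually_elim (auto split: split_indicator)
  qed
  then have "AE r in lborel. \<forall>n. r \<in> {1 / real (Suc n)<..<real (Suc n) + 1} \<longrightarrow> w r = 0"
    unfolding AE_all_countable by blast
  then show ?thesis
  proof eventually_elim
    case (elim r)
    show ?case
    proof
      assume "r > 0"
      obtain n where n: "real n \<ge> max r (1 / r)" using real_arch_simple by blast
      then have "r \<le> n" "1 \<le> r * n" using \<open>r > 0\<close> by (auto simp: field_simps)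
      then have "r \<in> {1 / real (Suc n)<..<real (Suc n) + 1}"
        using \<open>r > 0\<close> by (auto simp: field_simps)
      with elim show "w r = 0" by blast
    qed
  qed
qed

lemma interval_bump_integrable:
  assumes "integrable lborel (\<lambda>r. indicator {a<..<b} r * w r :: real)" and [measurable]: "w \<in> borel_measurable borel"
  shows "integrable lborel (\<lambda>r. w r * interval_bump n a b r)"
    "(\<lambda>n. \<integral>r. w r * interval_bump n a b r \<partial>lborel) \<longlonglongrightarrow> (\<integral>r. indicator {a<..<b} r * w r \<partial>lborel)"
proof -
  have [measurable]: "interval_bump n a b \<in> borel_measurable borel" for n
    by (intro borel_measurable_continuous_onI smooth_fun_continuous smooth_interval_bump)
  have bd: "norm (w r * interval_bump n a b r) \<le> norm (indicator {a<..<b} r * w r)" for n r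
    using interval_bump_bounds[of n a b r] interval_bump_outside[of r a b n]
    by (auto simp: abs_mult mult_left_le split: split_indicator)
  show "integrable lborel (\<lambda>r. w r * interval_bump n a b r)"
    by (rule Bochner_Integration.integrable_bound[OF assms(1)]) (use bd in auto)
  show "(\<lambda>n. \<integral>r. w r * interval_bump n a b r \<partial>lborel) \<longlonglongrightarrow> (\<integral>r. indicator {a<..<b} r * w r \<partial>lborel)"
  proof (rule integral_dominated_convergence[where w="\<lambda>r. norm (indicator {a<..<b} r * w r)"])
    show "AE r in lborel. (\<lambda>n. w r * interval_bump n a b r) \<longlonglongrightarrow> indicator {a<..<b} r * w r"
      using tendsto_mult[OF tendsto_const interval_bump_tendsto] by (auto simp: mult.commute)
  qed (use assms(1) bd in auto)
qed

text \<open>The test functions are primitives of mean-zero combinations of two bumps, which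
  approximate differences of averages over two intervals.\<close>

lemma du_Bois_Reymond:
  fixes w :: "real \<Rightarrow> real"
  assumes [measurable]: "w \<in> borel_measurable borel"
    and int: "\<And>a b. 0 < a \<Longrightarrow> a < b \<Longrightarrow> integrable lborel (\<lambda>r. indicator {a<..<b} r * w r)"
    and zero: "\<And>\<psi> \<psi>' a b. smooth_fun \<psi> \<Longrightarrow> (\<And>r. (\<psi> has_real_derivative \<psi>' r) (at r)) \<Longrightarrow> 0 < a \<Longrightarrow> a < b \<Longrightarrow>
                 (\<And>r. r \<notin> {a<..<b} \<Longrightarrow> \<psi> r = 0) \<Longrightarrow> (\<integral>r. w r * \<psi>' r \<partial>lborel) = 0"
  obtains c where "AE r in lborel. r > 0 \<longrightarrow> w r = c"
proof
  \<comment> \<open>The sought constant is the mean of w over every interval; (1, 2) has length 1,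
    so there the integral is the mean.\<close>
  define c where "c = (\<integral>r. indicator {1<..<2} r * w r \<partial>lborel)"
  have key: "(\<integral>r. indicator {a<..<b} r * w r \<partial>lborel) = (b - a) * c" if ab: "0 < a" "a < b" for a b
  proof -
    define I where "I n = (\<integral>r. interval_bump n a b r \<partial>lborel)" for n
    define J where "J n = (\<integral>r. interval_bump n 1 2 r \<partial>lborel)" for n
    have ind: "integrable lborel (\<lambda>r. indicator {a<..<b} r * 1 :: real)" for a b :: real
      by (cases "a \<le> b") auto
    have bint: "integrable lborel (interval_bump n a b)" for n a b
      using interval_bump_integrable(1)[OF ind[of a b]] by simp
    have I: "I \<longlonglongrightarrow> b - a" using interval_bump_integrable(2)[OF ind[of a b]] ab by (simp add: I_def[abs_def])
    have J: "J \<longlonglongrightarrow> 1" using interval_bump_integrable(2)[OF ind[of 1 2]] by (simp add: J_def[abs_def])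
    have eq: "J n * (\<integral>r. w r * interval_bump n a b r \<partial>lborel) = I n * (\<integral>r. w r * interval_bump n 1 2 r \<partial>lborel)" for n
    proof -
      \<comment> \<open>I n and J n are the masses of the two bumps, so k has mean zero and its
        primitive, the test function, vanishes again to the right of hi. In the limit the masses
        become b - a and 1.\<close>
      define k where "k r = J n * interval_bump n a b r + (- I n) * interval_bump n 1 2 r" for r
      define lo where "lo = min a 1"
      define hi where "hi = max b 2"
      have lohi: "0 < lo" "lo < hi" using ab by (auto simp: lo_def hi_def)
      have out: "k r = 0" if "r \<notin> {lo<..<hi}" for r
      proof -
        have "interval_bump n a b r = 0" "interval_bump n 1 2 r = 0"
          using that by (auto simp: lo_def hi_def intro!: interval_bump_outside)
        then show ?thesis by (simp add: k_def)
      qed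
      have sk: "smooth_fun k" unfolding k_def
        by (intro smooth_fun_add smooth_fun_mult smooth_fun_const smooth_interval_bump)
      have ck: "continuous_on UNIV k" using sk by (rule smooth_fun_continuous)
      obtain K where K: "\<And>r. (K has_real_derivative k r) (at r)" "\<And>r. r \<le> lo \<Longrightarrow> K r = 0"
        using antiderivative_vanishing_left[OF ck, of lo] out by (metis greaterThanLessThan_iff not_less)
      have k0: "(\<integral>r. k r \<partial>lborel) = 0"
        unfolding k_def using bint by (simp add: I_def J_def)
      have "K r = 0" if "r \<ge> hi" for r
      proof -
        have "(\<integral>s. k s * indicator {lo..r} s \<partial>lborel) = K r - K lo"
          by (rule integral_FTC_Icc_real) (use that lohi K ck in \<open>auto simp: continuous_on_eq_continuous_at\<close>)
        moreover have "(\<lambda>s. k s * indicator {lo..r} s) = k"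
          using out that by (auto simp: fun_eq_iff split: split_indicator)
        ultimately show ?thesis using k0 K(2)[of lo] by simp
      qed
      then have "(\<integral>r. w r * k r \<partial>lborel) = 0"
        by (intro zero[of K k lo hi] smooth_fun_realI[OF K(1) sk] K(1) lohi) (use K(2) in auto)
      moreover have "(\<integral>r. w r * k r \<partial>lborel) = (\<integral>r. J n * (w r * interval_bump n a b r) + (- I n) * (w r * interval_bump n 1 2 r) \<partial>lborel)"
        by (intro Bochner_Integration.integral_cong) (auto simp: k_def algebra_simps)
      moreover have "\<dots> = J n * (\<integral>r. w r * interval_bump n a b r \<partial>lborel) + (- I n) * (\<integral>r. w r * interval_bump n 1 2 r \<partial>lborel)"
        using interval_bump_integrable(1)[OF int[OF ab], of n] interval_bump_integrable(1)[OF int[of 1 2], of n]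
        by (subst Bochner_Integration.integral_add) auto
      ultimately show ?thesis by simp
    qed
    have 1: "(\<lambda>n. J n * (\<integral>r. w r * interval_bump n a b r \<partial>lborel)) \<longlonglongrightarrow> 1 * (\<integral>r. indicator {a<..<b} r * w r \<partial>lborel)"
      by (intro tendsto_mult J interval_bump_integrable int ab) auto
    have 2: "(\<lambda>n. I n * (\<integral>r. w r * interval_bump n 1 2 r \<partial>lborel)) \<longlonglongrightarrow> (b - a) * c"
      unfolding c_def by (intro tendsto_mult I interval_bump_integrable int) auto
    show ?thesis using LIMSEQ_unique[OF 1] 2 by (simp add: eq)
  qed
  have ic: "integrable lborel (\<lambda>r. indicator {a<..<b} r * c)" for a b :: real
    by (intro integrable_mult_left) (cases "a \<le> b"; simp)
  have "AE r in lborel. r > 0 \<longrightarrow> w r - c = 0"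
  proof (rule AE_zero_if_interval_integrals_zero)
    fix a b :: real assume ab: "0 < a" "a < b"
    have *: "(\<lambda>r. indicator {a<..<b} r * (w r - c)) = (\<lambda>r. indicator {a<..<b} r * w r - indicator {a<..<b} r * c)"
      by (auto simp: algebra_simps)
    show "integrable lborel (\<lambda>r. indicator {a<..<b} r * (w r - c))"
      unfolding * by (intro Bochner_Integration.integrable_diff int ab ic)
    show "(\<integral>r. indicator {a<..<b} r * (w r - c) \<partial>lborel) = 0"
      unfolding * by (subst Bochner_Integration.integral_diff[OF int[OF ab] ic]) (use key[OF ab] ab in simp)
  qed auto
  then show "AE r in lborel. r > 0 \<longrightarrow> w r = c" by simp
qed

text \<open>Encodes the test function \<Theta>(|x|) belonging to a profile \<psi>: its gradient is
  (\<psi>(r)/r^3) x, a field of divergence \<psi>'(r)/r^2. One profile thus serves the weak equation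
  (through \<Theta>) and the weak gradient (through the field). Below a the function is constant but
  in general nonzero, so the equation is tested across the origin.\<close>

definition radial_primitive :: "(real \<Rightarrow> real) \<Rightarrow> real \<Rightarrow> real \<Rightarrow> (real \<Rightarrow> real) \<Rightarrow> bool" where
  "radial_primitive \<psi> a b \<Theta> \<longleftrightarrow> (\<forall>r. (\<Theta> has_real_derivative \<psi> r / r\<^sup>2) (at r)) \<and>
     (\<forall>r\<ge>b. \<Theta> r = 0) \<and> (\<forall>r\<le>a. \<Theta> r = \<Theta> a)"

lemma radial_primitiveD:
  assumes "radial_primitive \<psi> a b \<Theta>"
  shows "(\<Theta> has_real_derivative \<psi> r / r\<^sup>2) (at r)" "r \<ge> b \<Longrightarrow> \<Theta> r = 0" "r \<le> a \<Longrightarrow> \<Theta> r = \<Theta> a"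
  using assms unfolding radial_primitive_def by blast+

lemma radial_primitive_exists:
  assumes \<psi>: "smooth_fun \<psi>" and ab: "0 < a" "a < b" and out: "\<And>r. r \<notin> {a<..<b} \<Longrightarrow> \<psi> r = 0"
  shows "\<exists>\<Theta>. radial_primitive \<psi> a b \<Theta>"
proof -
  define k where "k r = \<psi> r / r ^ 2" for r
  have sk: "smooth_fun k"
    unfolding k_def using smooth_fun_divide_power[OF \<psi> _ ab(1)] out by auto
  have k0: "k r = 0" if "r \<le> a" for r using out[of r] that by (simp add: k_def)
  obtain K where K: "\<And>r. (K has_real_derivative k r) (at r)" "\<And>r. r \<le> a \<Longrightarrow> K r = 0"
    using antiderivative_vanishing_left[OF smooth_fun_continuous[OF sk], of a] k0 by metis
  have Kb: "K r = K b" if "r \<ge> b" for r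
  proof (cases "r = b")
    case False
    with that have "b < r" by simp
    then obtain z where z: "b < z" "K r - K b = (r - b) * k z"
      using MVT2[of b r K k] K(1) by blast
    have "k z = 0" using out[of z] z(1) by (simp add: k_def)
    with z show ?thesis by simp
  qed simp
  have "((\<lambda>r. K r - K b) has_real_derivative \<psi> r / r\<^sup>2) (at r)" for r
    using K(1)[of r] by (auto intro!: derivative_eq_intros simp: k_def)
  moreover have "K r - K b = 0" if "r \<ge> b" for r using Kb[OF that] by simp
  moreover have "K r - K b = K a - K b" if "r \<le> a" for r using K(2)[OF that] K(2)[of a] by simp
  ultimately have "radial_primitive \<psi> a b (\<lambda>r. K r - K b)"
    unfolding radial_primitive_def by blast
  then show ?thesis by blast
qed

lemma compact_support_norm:
  fixes f :: "'a::euclidean_space \<Rightarrow> real"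
  assumes "\<And>x. norm x > b \<Longrightarrow> f x = 0"
  shows "compact (closure {x. f x \<noteq> 0})"
proof -
  have "{x. f x \<noteq> 0} \<subseteq> cball 0 b" using assms by (auto simp: not_less[symmetric])
  then show ?thesis by (meson bounded_cball bounded_subset compact_closure)
qed

lemma radial_primitive_test_fun:
  fixes \<psi> :: "real \<Rightarrow> real"
  assumes \<psi>: "smooth_fun \<psi>" and a: "0 < a" and out: "\<And>r. r \<notin> {a<..<b} \<Longrightarrow> \<psi> r = 0"
    and \<Theta>: "radial_primitive \<psi> a b \<Theta>"
  shows "test_fun (\<lambda>x::'a::euclidean_space. \<Theta> (norm x))"
    "((\<lambda>x. \<Theta> (norm x)) has_derivative (\<lambda>v. \<psi> (norm x) / norm x ^ 3 * (x \<bullet> v))) (at (x::'a))"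
proof -
  have sk: "smooth_fun (\<lambda>r. \<psi> r / r\<^sup>2)"
    using smooth_fun_divide_power[OF \<psi> _ a] out by auto
  define K where "K r = \<Theta> r - \<Theta> a" for r
  have K: "(K has_real_derivative \<psi> r / r\<^sup>2) (at r)" for r
    unfolding K_def using radial_primitiveD(1)[OF \<Theta>] by (auto intro!: derivative_eq_intros)
  have sK: "smooth_fun K" by (rule smooth_fun_realI[OF K sk])
  have K0: "K r = 0" if "r \<le> a" for r using radial_primitiveD(3)[OF \<Theta> that] by (simp add: K_def)
  have K\<Theta>: "(\<lambda>x::'a. \<Theta> (norm x)) = (\<lambda>x. K (norm x) + \<Theta> a)" by (simp add: K_def)
  have "smooth_fun (\<lambda>x::'a. \<Theta> (norm x))"
    unfolding K\<Theta> by (intro smooth_fun_add smooth_fun_const smooth_fun_norm(1)[OF sK K0 a])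
  moreover have "compact (closure {x::'a. \<Theta> (norm x) \<noteq> 0})"
    by (rule compact_support_norm[of b]) (simp add: radial_primitiveD(2)[OF \<Theta>])
  ultimately show "test_fun (\<lambda>x::'a. \<Theta> (norm x))" unfolding test_fun_def by simp
  show "((\<lambda>x. \<Theta> (norm x)) has_derivative (\<lambda>v. \<psi> (norm x) / norm x ^ 3 * (x \<bullet> v))) (at (x::'a))"
    unfolding K\<Theta>
    by (rule has_derivative_eq_rhs[OF has_derivative_add[OF smooth_fun_norm(2)[OF sK K0 a K] has_derivative_const]])
       (auto simp: power2_eq_square power3_eq_cube mult_ac)
qed

lemma radial_field_test_fun:
  fixes \<psi> :: "real \<Rightarrow> real"
  assumes \<psi>: "smooth_fun \<psi>" and a: "0 < a" and out: "\<And>r. r \<notin> {a<..<b} \<Longrightarrow> \<psi> r = 0"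
  shows "test_fun (\<lambda>x::'a::euclidean_space. \<psi> (norm x) / norm x ^ 3 * (x \<bullet> v))"
  unfolding test_fun_def
proof
  have "smooth_fun (\<lambda>r. \<psi> r / r ^ 3)"
    using smooth_fun_divide_power[OF \<psi> _ a] out by auto
  then have "smooth_fun (\<lambda>x::'a. \<psi> (norm x) / norm x ^ 3)"
    using smooth_fun_norm(1)[of "\<lambda>r. \<psi> r / r ^ 3", OF _ _ a] out by auto
  then show "smooth_fun (\<lambda>x::'a. \<psi> (norm x) / norm x ^ 3 * (x \<bullet> v))"
    by (rule smooth_fun_mult[OF _ smooth_fun_linear[OF bounded_linear_inner_left]])
  show "compact (closure {x::'a. \<psi> (norm x) / norm x ^ 3 * (x \<bullet> v) \<noteq> 0})"
    by (rule compact_support_norm[of b]) (use out in auto)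
qed

text \<open>The field x/r^3 is divergence free in dimension three, so only the derivative of the
  profile survives: with k = \<psi>/r^3 the divergence is 3 k + r k', and the terms in \<psi>
  cancel.\<close>

lemma radial_field_deriv:
  fixes \<psi> \<psi>' :: "real \<Rightarrow> real"
  assumes \<psi>: "smooth_fun \<psi>" "\<And>r. (\<psi> has_real_derivative \<psi>' r) (at r)"
    and a: "0 < a" and \<psi>0: "\<And>r. r \<le> a \<Longrightarrow> \<psi> r = 0"
  obtains D where
    "\<And>b x::real^3. ((\<lambda>x. \<psi> (norm x) / norm x ^ 3 * (x \<bullet> b)) has_derivative D b x) (at x)"
    "\<And>x. (\<Sum>b\<in>Basis. D b x b) = \<psi>' (norm x) / (norm x)\<^sup>2"
proof -
  define k where "k r = \<psi> r / r ^ 3" for r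
  define k' where "k' r = \<psi>' r / r ^ 3 - 3 * (\<psi> r / r ^ 4)" for r
  have sk: "smooth_fun k"
    unfolding k_def using smooth_fun_divide_power[OF \<psi>(1) \<psi>0 a] .
  have k0: "k r = 0" if "r \<le> a" for r using \<psi>0[OF that] by (simp add: k_def)
  obtain k'' where k'': "\<And>r. (k has_real_derivative k'' r) (at r)" "smooth_fun k''"
    using sk by (rule smooth_fun_realE) blast
  have z: "\<psi>' r = 0" "k'' r = 0" if "r \<le> a" for r
    using deriv_zero_left[OF \<psi>(2) smooth_fun_deriv[OF \<psi>] \<psi>0 that] deriv_zero_left[OF k'' k0 that] by auto
  have k': "(k has_real_derivative k' r) (at r)" for r
  proof (cases "r \<le> a")
    case True
    with k''(1)[of r] z[OF True] \<psi>0[OF True] show ?thesis by (simp add: k'_def)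
  next
    case False
    then have "r > 0" using a by simp
    then show ?thesis unfolding k_def k'_def
      by (auto intro!: derivative_eq_intros \<psi>(2) simp: field_simps eval_nat_numeral)
  qed
  define D where "D b x v = k (norm x) * (v \<bullet> b) + (k' (norm x) / norm x * (x \<bullet> v)) * (x \<bullet> b)" for b x v :: "real^3"
  show ?thesis
  proof (rule that[of D])
    show "((\<lambda>x. \<psi> (norm x) / norm x ^ 3 * (x \<bullet> b)) has_derivative D b x) (at x)" for b x :: "real^3"
    proof -
      have "((\<lambda>x. k (norm x) * (x \<bullet> b)) has_derivative (\<lambda>v. k (norm x) * (v \<bullet> b) + (k' (norm x) / norm x * (x \<bullet> v)) * (x \<bullet> b))) (at x)"
        by (intro has_derivative_mult smooth_fun_norm(2)[OF sk k0 a k'] has_derivative_inner_left has_derivative_ident)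
      then show ?thesis by (simp add: k_def D_def[abs_def])
    qed
    show "(\<Sum>b\<in>Basis. D b x b) = \<psi>' (norm x) / (norm x)\<^sup>2" for x
    proof -
      have "(\<Sum>b\<in>Basis. D b x b) = k (norm x) * (\<Sum>b\<in>(Basis::(real^3) set). b \<bullet> b) + k' (norm x) / norm x * (\<Sum>b\<in>Basis. (x \<bullet> b) * (x \<bullet> b))"
        unfolding D_def by (simp add: sum.distrib sum_distrib_left mult_ac)
      also have "(\<Sum>b\<in>(Basis::(real^3) set). b \<bullet> b) = 3" by simp
      also have "(\<Sum>b\<in>Basis. (x \<bullet> b) * (x \<bullet> b)) = (norm x)\<^sup>2"
        by (simp add: euclidean_inner[symmetric] power2_norm_eq_inner)
      finally have sum: "(\<Sum>b\<in>Basis. D b x b) = k (norm x) * 3 + k' (norm x) / norm x * (norm x)\<^sup>2" .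
      show ?thesis
      proof (cases "norm x \<le> a")
        case True
        with z[OF True] \<psi>0[OF True] sum show ?thesis by (simp add: k_def k'_def)
      next
        case False
        then have "norm x > 0" using a by linarith
        with sum show ?thesis by (simp add: k_def k'_def field_simps eval_nat_numeral)
      qed
    qed
  qed
qed

section \<open>The radial form of the equation\<close>

definition nonlin :: "real \<Rightarrow> real \<Rightarrow> real \<Rightarrow> real \<Rightarrow> real" where
  "nonlin p \<alpha> \<beta> s = s ^ 5 + \<beta> * s powr p - \<alpha> * s"

lemma nonlin_measurable [measurable]: "nonlin p \<alpha> \<beta> \<in> borel_measurable borel"
  unfolding nonlin_def by measurable

text \<open>Each coordinate of the field (\<psi>(r)/r^3) x is a test function; adding the three
  coordinate identities of the weak gradient gives integration by parts against the field.\<close>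

lemma weak_grad_radial:
  fixes u :: "real^3 \<Rightarrow> real"
  assumes wg: "weak_grad u g"
    and \<psi>: "smooth_fun \<psi>" "\<And>r. (\<psi> has_real_derivative \<psi>' r) (at r)"
    and ab: "0 < a" "a < b" and out: "\<And>r. r \<notin> {a<..<b} \<Longrightarrow> \<psi> r = 0"
  shows "integrable lborel (\<lambda>x. u x * (\<psi>' (norm x) / (norm x)\<^sup>2))"
    and "integrable lborel (\<lambda>x. (g x \<bullet> x) * (\<psi> (norm x) / norm x ^ 3))"
    and "(\<integral>x. u x * (\<psi>' (norm x) / (norm x)\<^sup>2) \<partial>lborel) = - (\<integral>x. (g x \<bullet> x) * (\<psi> (norm x) / norm x ^ 3) \<partial>lborel)"
proof -
  let ?\<phi> = "\<lambda>b x::real^3. \<psi> (norm x) / norm x ^ 3 * (x \<bullet> b)"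
  have test: "test_fun (?\<phi> b)" if "b \<in> Basis" for b
    by (rule radial_field_test_fun[OF \<psi>(1) ab(1) out])
  obtain D where D: "\<And>b x::real^3. (?\<phi> b has_derivative D b x) (at x)"
      "\<And>x. (\<Sum>b\<in>Basis. D b x b) = \<psi>' (norm x) / (norm x)\<^sup>2"
    by (rule radial_field_deriv[OF \<psi> ab(1)]) (use out in auto)
  have *: "integrable lborel (\<lambda>x. u x * D b x b)" "integrable lborel (\<lambda>x. (g x \<bullet> b) * ?\<phi> b x)"
      "(\<integral>x. u x * D b x b \<partial>lborel) = - (\<integral>x. (g x \<bullet> b) * ?\<phi> b x \<partial>lborel)" if "b \<in> Basis" for b
    using wg test[OF that] D(1)[of b] that unfolding weak_grad_def by blast+
  have s1: "(\<lambda>x. \<Sum>b\<in>Basis. u x * D b x b) = (\<lambda>x. u x * (\<psi>' (norm x) / (norm x)\<^sup>2))"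
    by (simp add: sum_distrib_left[symmetric] D(2))
  have s2: "(\<lambda>x. \<Sum>b\<in>Basis. (g x \<bullet> b) * ?\<phi> b x) = (\<lambda>x. (g x \<bullet> x) * (\<psi> (norm x) / norm x ^ 3))"
  proof
    fix x
    have "(\<Sum>b\<in>Basis. (g x \<bullet> b) * ?\<phi> b x) = (\<Sum>b\<in>Basis. (g x \<bullet> b) * (x \<bullet> b)) * (\<psi> (norm x) / norm x ^ 3)"
      by (simp add: sum_distrib_right sum_distrib_left sum_divide_distrib mult_ac)
    then show "(\<Sum>b\<in>Basis. (g x \<bullet> b) * ?\<phi> b x) = (g x \<bullet> x) * (\<psi> (norm x) / norm x ^ 3)"
      by (simp only: euclidean_inner[symmetric])
  qed
  show "integrable lborel (\<lambda>x. u x * (\<psi>' (norm x) / (norm x)\<^sup>2))"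
    unfolding s1[symmetric] by (intro Bochner_Integration.integrable_sum *)
  show "integrable lborel (\<lambda>x. (g x \<bullet> x) * (\<psi> (norm x) / norm x ^ 3))"
    unfolding s2[symmetric] by (intro Bochner_Integration.integrable_sum *)
  have "(\<integral>x. (\<Sum>b\<in>Basis. u x * D b x b) \<partial>lborel) = (\<Sum>b\<in>Basis. (\<integral>x. u x * D b x b \<partial>lborel))"
    by (intro Bochner_Integration.integral_sum *)
  also have "\<dots> = (\<Sum>b\<in>Basis. - (\<integral>x. (g x \<bullet> b) * ?\<phi> b x \<partial>lborel))"
    by (intro sum.cong refl *(3))
  also have "\<dots> = - (\<integral>x. (\<Sum>b\<in>Basis. (g x \<bullet> b) * ?\<phi> b x) \<partial>lborel)"
    by (simp only: Bochner_Integration.integral_sum[OF *(2)] sum_negf)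
  finally show "(\<integral>x. u x * (\<psi>' (norm x) / (norm x)\<^sup>2) \<partial>lborel) = - (\<integral>x. (g x \<bullet> x) * (\<psi> (norm x) / norm x ^ 3) \<partial>lborel)"
    unfolding s1 s2 .
qed

text \<open>Tested against \<Theta>(|x|), the gradient term of the equation is the integral of (g .
  x) \<psi>/r^3, which \<open>weak_grad_radial\<close> rewrites in terms of u. The unknown weak
  gradient disappears and only u and f(u) remain.\<close>

lemma weak_solution_radial:
  fixes u :: "real^3 \<Rightarrow> real"
  assumes ws: "weak_solution p \<alpha> u" and pos: "\<And>x. u x > 0"
    and \<psi>: "smooth_fun \<psi>" "\<And>r. (\<psi> has_real_derivative \<psi>' r) (at r)"
    and ab: "0 < a" "a < b" and out: "\<And>r. r \<notin> {a<..<b} \<Longrightarrow> \<psi> r = 0"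
    and \<Theta>: "radial_primitive \<psi> a b \<Theta>"
  shows "integrable lborel (\<lambda>x. nonlin p \<alpha> 1 (u x) * \<Theta> (norm x))"
    "(\<integral>x. u x * (\<psi>' (norm x) / (norm x)\<^sup>2) \<partial>lborel) = - (\<integral>x. nonlin p \<alpha> 1 (u x) * \<Theta> (norm x) \<partial>lborel)"
proof -
  obtain g where g: "weak_grad u g" and
    eq: "\<And>\<phi> D. test_fun \<phi> \<Longrightarrow> (\<And>x. (\<phi> has_derivative D x) (at x)) \<Longrightarrow>
        (let F = (\<lambda>x. (\<Sum>b\<in>Basis. (g x \<bullet> b) * D x b) + \<alpha> * u x * \<phi> x
                     - \<bar>u x\<bar> powr (p - 1) * u x * \<phi> x - \<bar>u x\<bar> ^ 4 * u x * \<phi> x)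
         in integrable lborel F \<and> (\<integral>x. F x \<partial>lborel) = 0)"
    using ws unfolding weak_solution_def by blast
  have wr: "integrable lborel (\<lambda>x. (g x \<bullet> x) * (\<psi> (norm x) / norm x ^ 3))"
    "(\<integral>x. u x * (\<psi>' (norm x) / (norm x)\<^sup>2) \<partial>lborel) = - (\<integral>x. (g x \<bullet> x) * (\<psi> (norm x) / norm x ^ 3) \<partial>lborel)"
    by (rule weak_grad_radial[OF g \<psi> ab out]; assumption)+
  define F where "F = (\<lambda>x. (\<Sum>b\<in>Basis. (g x \<bullet> b) * (\<psi> (norm x) / norm x ^ 3 * (x \<bullet> b))) + \<alpha> * u x * \<Theta> (norm x)
                     - \<bar>u x\<bar> powr (p - 1) * u x * \<Theta> (norm x) - \<bar>u x\<bar> ^ 4 * u x * \<Theta> (norm x))"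
  have F: "integrable lborel F" "(\<integral>x. F x \<partial>lborel) = 0"
    using eq[OF radial_primitive_test_fun[OF \<psi>(1) ab(1) out \<Theta>]] unfolding F_def Let_def by auto
  have Feq: "F x = (g x \<bullet> x) * (\<psi> (norm x) / norm x ^ 3) - nonlin p \<alpha> 1 (u x) * \<Theta> (norm x)" for x
  proof -
    have "(\<Sum>b\<in>Basis. (g x \<bullet> b) * (\<psi> (norm x) / norm x ^ 3 * (x \<bullet> b)))
       = (\<Sum>b\<in>Basis. (g x \<bullet> b) * (x \<bullet> b)) * (\<psi> (norm x) / norm x ^ 3)"
      by (simp add: sum_distrib_right sum_distrib_left sum_divide_distrib mult_ac)
    also have "\<dots> = (g x \<bullet> x) * (\<psi> (norm x) / norm x ^ 3)"
      by (simp only: euclidean_inner[symmetric])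
    moreover have "\<bar>u x\<bar> powr (p - 1) * u x = u x powr p" "\<bar>u x\<bar> ^ 4 * u x = u x ^ 5"
      using pos[of x] powr_add[of "u x" "p - 1" 1] by (simp_all add: eval_nat_numeral)
    ultimately show ?thesis unfolding F_def nonlin_def by (simp add: algebra_simps)
  qed
  have eq: "(\<lambda>x. nonlin p \<alpha> 1 (u x) * \<Theta> (norm x)) = (\<lambda>x. (g x \<bullet> x) * (\<psi> (norm x) / norm x ^ 3) - F x)"
    by (simp add: Feq fun_eq_iff)
    show "integrable lborel (\<lambda>x. nonlin p \<alpha> 1 (u x) * \<Theta> (norm x))"
      unfolding eq by (intro Bochner_Integration.integrable_diff wr(1) F(1))
    show "(\<integral>x. u x * (\<psi>' (norm x) / (norm x)\<^sup>2) \<partial>lborel) = - (\<integral>x. nonlin p \<alpha> 1 (u x) * \<Theta> (norm x) \<partial>lborel)"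
      using wr(2) F(2) unfolding eq Bochner_Integration.integral_diff[OF wr(1) F(1)] by linarith
qed

lemma AE_pos_ex_in_interval:
  assumes "AE r in lborel. r > (0::real) \<longrightarrow> P r" "0 \<le> a" "a < b"
  obtains r where "a < r" "r < b" "P r"
proof -
  have "\<exists>r. a < r \<and> r < b \<and> P r"
  proof (rule ccontr)
    assume *: "\<not> (\<exists>r. a < r \<and> r < b \<and> P r)"
    have "AE r in lborel. r \<notin> {a<..<b}"
      using assms(1) by eventually_elim (use * assms(2) in auto)
    then have "emeasure lborel {a<..<b} = 0"
      by (subst (asm) AE_iff_measurable[OF _ refl]) (auto simp: Collect_conj_eq greaterThanLessThan_def greaterThan_def lessThan_def)
    with assms(3) show False by simp
  qed
  with that show ?thesis by blast
qed

section \<open>Radial weak solutions and their continuous representative\<close>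

locale radial_weak_solution =
  fixes p \<alpha> :: real and u :: "real^3 \<Rightarrow> real" and U :: "real \<Rightarrow> real"
  assumes U_measurable [measurable]: "U \<in> borel_measurable borel"
    and u_eq: "\<And>x. u x = U (norm x)"
    and U_pos: "\<And>r. U r > 0"
    and ws: "weak_solution p \<alpha> u" and H1: "H1 u"
    and p: "1 < p" "p < 5" and \<alpha>: "\<alpha> > 0"
begin

definition flux_density :: "real \<Rightarrow> real" where
  "flux_density r = r\<^sup>2 * nonlin p \<alpha> 1 (U r)"

lemma flux_density_measurable [measurable]: "flux_density \<in> borel_measurable borel"
  unfolding flux_density_def by measurable

lemma radial_identity:
  assumes \<psi>: "smooth_fun \<psi>" "\<And>r. (\<psi> has_real_derivative \<psi>' r) (at r)"
    and ab: "0 < a" "a < b" and out: "\<And>r. r \<notin> {a<..<b} \<Longrightarrow> \<psi> r = 0"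
    and \<Theta>: "radial_primitive \<psi> a b \<Theta>"
  shows "integrable lborel (\<lambda>r. indicator {0..} r * flux_density r * \<Theta> r)"
    "(\<integral>r. U r * \<psi>' r \<partial>lborel) = - (\<integral>r. indicator {0..} r * flux_density r * \<Theta> r \<partial>lborel)"
proof -
  have pos: "u x > 0" for x by (simp add: u_eq U_pos)
  have wsr: "integrable lborel (\<lambda>x. nonlin p \<alpha> 1 (u x) * \<Theta> (norm x))"
    "(\<integral>x. u x * (\<psi>' (norm x) / (norm x)\<^sup>2) \<partial>lborel) = - (\<integral>x. nonlin p \<alpha> 1 (u x) * \<Theta> (norm x) \<partial>lborel)"
    by (rule weak_solution_radial[OF ws pos \<psi> ab out \<Theta>]; assumption)+
  have [measurable]: "\<Theta> \<in> borel_measurable borel"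
    by (rule borel_measurable_continuous_onI, rule continuous_at_imp_continuous_on)
       (blast intro: DERIV_isCont radial_primitiveD(1)[OF \<Theta>])
  have s\<psi>': "smooth_fun \<psi>'" by (rule smooth_fun_deriv[OF \<psi>])
  then have [measurable]: "\<psi>' \<in> borel_measurable borel"
    by (intro borel_measurable_continuous_onI smooth_fun_continuous)
  have \<psi>'0: "\<psi>' r = 0" if "r \<le> a" for r
    by (rule deriv_zero_left[OF \<psi>(2) s\<psi>' _ that]) (use out in auto)
  have e1: "polar_density r * (U r * (\<psi>' r / r\<^sup>2)) = 4 * pi * (U r * \<psi>' r)" for r
    using \<psi>'0[of r] ab by (cases "r \<le> a") (auto simp: polar_density_def)
  have e2: "polar_density r * (nonlin p \<alpha> 1 (U r) * \<Theta> r) = 4 * pi * (indicator {0..} r * flux_density r * \<Theta> r)" for r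
    by (auto simp: polar_density_def flux_density_def)
    have "integrable lborel (\<lambda>r. polar_density r * (nonlin p \<alpha> 1 (U r) * \<Theta> r))"
      using wsr(1) unfolding u_eq by (subst integrable_radial[symmetric]) auto
    then show "integrable lborel (\<lambda>r. indicator {0..} r * flux_density r * \<Theta> r)"
      unfolding e2 by simp
    have "4 * pi * (\<integral>r. U r * \<psi>' r \<partial>lborel) = (\<integral>r. polar_density r * (U r * (\<psi>' r / r\<^sup>2)) \<partial>lborel)"
      unfolding e1 by simp
    also have "\<dots> = (\<integral>x. u x * (\<psi>' (norm x) / (norm x)\<^sup>2) \<partial>lborel)"
      unfolding u_eq by (subst integral_radial[symmetric]) auto
    also have "\<dots> = - (\<integral>x. nonlin p \<alpha> 1 (u x) * \<Theta> (norm x) \<partial>lborel)" by (rule wsr(2))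
    also have "(\<integral>x. nonlin p \<alpha> 1 (u x) * \<Theta> (norm x) \<partial>lborel) = (\<integral>r. polar_density r * (nonlin p \<alpha> 1 (U r) * \<Theta> r) \<partial>lborel)"
      unfolding u_eq by (subst integral_radial[symmetric]) auto
    also have "\<dots> = 4 * pi * (\<integral>r. indicator {0..} r * flux_density r * \<Theta> r \<partial>lborel)"
      unfolding e2 by simp
    finally have "4 * pi * ((\<integral>r. U r * \<psi>' r \<partial>lborel) + (\<integral>r. indicator {0..} r * flux_density r * \<Theta> r \<partial>lborel)) = 0"
      by (simp add: distrib_left)
    then show "(\<integral>r. U r * \<psi>' r \<partial>lborel) = - (\<integral>r. indicator {0..} r * flux_density r * \<Theta> r \<partial>lborel)"
      by (simp add: eq_neg_iff_add_eq_0)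
qed

text \<open>Integrability of r^2 f(U) up to the origin is extracted from the notion of weak
  solution, which demands an integrable integrand for every test function: take \<Theta> equal to a
  nonzero constant on [0, T].\<close>

lemma flux_density_integrable: "integrable lborel (\<lambda>r. indicator {0..T} r * flux_density r)"
proof -
  define a where "a = max T 1"
  have ab: "0 < a" "a < a + 1" by (auto simp: a_def)
  let ?\<psi> = "interval_bump 1 a (a + 1)"
  obtain \<psi>' where \<psi>': "\<And>r. (?\<psi> has_real_derivative \<psi>' r) (at r)" "smooth_fun \<psi>'"
    using smooth_interval_bump[of 1 a "a + 1"] by (rule smooth_fun_realE) blast
  obtain \<Theta> where \<Theta>: "radial_primitive ?\<psi> a (a + 1) \<Theta>"
    using radial_primitive_exists[OF smooth_interval_bump ab interval_bump_outside] by blast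
  have int: "integrable lborel (\<lambda>r. indicator {0..} r * flux_density r * \<Theta> r)"
    by (rule radial_identity[OF smooth_interval_bump \<psi>'(1) ab interval_bump_outside \<Theta>])
  \<comment> \<open>The increment of \<Theta> over (a, a + 1) is a value of \<psi>/r^2 inside that
    interval, hence positive, while \<Theta> vanishes at a + 1; so \<Theta> a is nonzero.\<close>
  obtain z where z: "a < z" "z < a + 1" "\<Theta> (a + 1) - \<Theta> a = (a + 1 - a) * (?\<psi> z / z\<^sup>2)"
    using MVT2[OF ab(2) radial_primitiveD(1)[OF \<Theta>]] by blast
  have "?\<psi> z > 0" using z by (simp add: interval_bump_def exp_bump_def)
  then have "\<Theta> a \<noteq> 0" using z radial_primitiveD(2)[OF \<Theta>, of "a + 1"] ab by auto
  have "integrable lborel (\<lambda>r. indicator {0..T} r *\<^sub>R (indicator {0..} r * flux_density r * \<Theta> r))"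
    by (intro integrable_mult_indicator int) auto
  then have "integrable lborel (\<lambda>r. (indicator {0..T} r *\<^sub>R (indicator {0..} r * flux_density r * \<Theta> r)) * (1 / \<Theta> a))"
    by (rule integrable_mult_left)
  moreover have "(\<lambda>r. (indicator {0..T} r *\<^sub>R (indicator {0..} r * flux_density r * \<Theta> r)) * (1 / \<Theta> a)) = (\<lambda>r. indicator {0..T} r * flux_density r)"
  proof
    fix r
    have "\<Theta> r = \<Theta> a" if "r \<in> {0..T}"
      by (rule radial_primitiveD(3)[OF \<Theta>]) (use that in \<open>auto simp: a_def\<close>)
    then show "(indicator {0..T} r *\<^sub>R (indicator {0..} r * flux_density r * \<Theta> r)) * (1 / \<Theta> a) = indicator {0..T} r * flux_density r"
      using \<open>\<Theta> a \<noteq> 0\<close> by (cases "r \<in> {0..T}") auto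
  qed
  ultimately show ?thesis by simp
qed

lemma U_square_integrable: "integrable lborel (\<lambda>r. polar_density r * (U r)\<^sup>2)"
proof -
  have "(\<integral>\<^sup>+x. ennreal ((u x)\<^sup>2) \<partial>lborel) < \<infinity>" using H1 by (simp add: H1_def)
  then have "integrable lborel (\<lambda>x. (U (norm (x::real^3)))\<^sup>2)"
    unfolding u_eq by (intro integrableI_bounded) auto
  then show ?thesis by (subst (asm) integrable_radial) auto
qed

lemma U_integrable:
  assumes "0 < a" "a < b"
  shows "integrable lborel (\<lambda>r. indicator {a<..<b} r * U r)"
proof (rule Bochner_Integration.integrable_bound[where f="\<lambda>r. indicator {a<..<b} r * 1 + (1 / (4 * pi * a\<^sup>2)) * (polar_density r * (U r)\<^sup>2)"])
  show "integrable lborel (\<lambda>r. indicator {a<..<b} r * 1 + (1 / (4 * pi * a\<^sup>2)) * (polar_density r * (U r)\<^sup>2))"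
    by (intro Bochner_Integration.integrable_add integrable_mult_right U_square_integrable) (use assms in auto)
  have "indicator {a<..<b} r * U r \<le> indicator {a<..<b} r * 1 + (1 / (4 * pi * a\<^sup>2)) * (polar_density r * (U r)\<^sup>2)" for r
  proof (cases "r \<in> {a<..<b}")
    case True
    then have "1 \<le> r\<^sup>2 / a\<^sup>2" using assms by (auto simp: divide_simps power_mono)
    have "U r \<le> 1 + (U r)\<^sup>2" using sum_power2_ge_zero[of "U r - 1" 0] U_pos[of r] by (simp add: power2_eq_square algebra_simps)
    also have "(U r)\<^sup>2 \<le> (r\<^sup>2 / a\<^sup>2) * (U r)\<^sup>2" using mult_right_mono[OF \<open>1 \<le> r\<^sup>2 / a\<^sup>2\<close>, of "(U r)\<^sup>2"] by simp
    finally show ?thesis using True assms by (simp add: polar_density_def divide_simps)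
  qed (use assms in simp)
  moreover have "0 \<le> indicator {a<..<b} r * U r" for r using U_pos[of r] by simp
  ultimately show "AE r in lborel. norm (indicator {a<..<b} r * U r) \<le> norm (indicator {a<..<b} r * 1 + (1 / (4 * pi * a\<^sup>2)) * (polar_density r * (U r)\<^sup>2))"
    by (intro AE_I2) (smt (verit) real_norm_def)
qed auto

text \<open>To be identified with -r^2 V'. Integrating from 0 without an additive constant is
  correct because the test functions need not vanish at the origin, so no multiple of the
  fundamental solution 1/r can hide there.\<close>

definition flux :: "real \<Rightarrow> real" where
  "flux r = (\<integral>s. indicator {0..r} s * flux_density s \<partial>lborel)"

lemma flux_eq_integral: "flux_density integrable_on {0..r}" "flux r = integral {0..r} flux_density"
proof -
  have "set_integrable lborel {0..r} flux_density"
    using flux_density_integrable[of r] by (simp add: set_integrable_def)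
  from set_borel_integral_eq_integral[OF this]
  show "flux_density integrable_on {0..r}" "flux r = integral {0..r} flux_density"
    by (auto simp: flux_def set_lebesgue_integral_def)
qed

lemma flux_continuous: "continuous_on {0..T} flux"
  unfolding flux_eq_integral(2)[abs_def]
  by (intro indefinite_integral_continuous_1 flux_eq_integral(1))

lemma flux_isCont: "r > 0 \<Longrightarrow> isCont flux r"
  using flux_continuous[of "r + 1"] by (rule continuous_on_interior) auto

lemma flux_tendsto_0: "(flux \<longlongrightarrow> 0) (at_right 0)"
proof -
  have "(flux \<longlongrightarrow> flux 0) (at 0 within {0..1})"
    using flux_continuous[of 1] by (auto simp: continuous_on_def)
  moreover have "flux 0 = 0" by (simp add: flux_eq_integral)
  moreover have "at 0 within {0..1} = at_right (0::real)"
    by (rule at_within_Icc_at_right) simp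
  ultimately show ?thesis by simp
qed

text \<open>Since \<Theta>(s) is minus the integral of \<psi>/r^2 over (s, \<infinity>), Fubini on
  the region s \<le> r replaces the flux density by its integral. The result says that U' = -
  flux/r^2 in the sense of distributions on (0, \<infinity>).\<close>

lemma radial_distributional_equation:
  assumes \<psi>: "smooth_fun \<psi>" "\<And>r. (\<psi> has_real_derivative \<psi>' r) (at r)"
    and ab: "0 < a" "a < b" and out: "\<And>r. r \<notin> {a<..<b} \<Longrightarrow> \<psi> r = 0"
  shows "(\<integral>r. U r * \<psi>' r \<partial>lborel) = (\<integral>r. flux r * (\<psi> r / r\<^sup>2) \<partial>lborel)"
proof -
  obtain \<Theta> where rp: "radial_primitive \<psi> a b \<Theta>"
    using radial_primitive_exists[OF \<psi>(1) ab out] by blast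
  have "(\<integral>r. U r * \<psi>' r \<partial>lborel) = - (\<integral>r. indicator {0..} r * flux_density r * \<Theta> r \<partial>lborel)"
    by (rule radial_identity(2)[OF \<psi> ab out rp])
  note \<Theta> = radial_primitiveD(1,2)[OF rp] this
  define k where "k r = \<psi> r / r\<^sup>2" for r
  have sk: "smooth_fun k"
    unfolding k_def by (rule smooth_fun_divide_power[OF \<psi>(1) _ ab(1)]) (use out in auto)
  note ck = smooth_fun_continuous[OF sk]
  have isCk: "isCont k r" for r using ck[of UNIV] by (simp add: continuous_on_eq_continuous_at)
  have [measurable]: "k \<in> borel_measurable borel"
    by (intro borel_measurable_continuous_onI ck)
  have k0: "k r = 0" if "r \<notin> {a<..<b}" for r using out[OF that] by (simp add: k_def)
  have d\<Theta>: "(\<Theta> has_real_derivative k r) (at r)" for r using \<Theta>(1) by (simp add: k_def)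
  have intk: "integrable lborel k"
  proof -
    have "integrable lborel (\<lambda>r. indicator {a..b} r *\<^sub>R k r)"
      by (intro borel_integrable_compact continuous_on_subset[OF ck]) auto
    moreover have "(\<lambda>r. indicator {a..b} r *\<^sub>R k r) = k"
      using k0 by (auto simp: fun_eq_iff split: split_indicator)
    ultimately show ?thesis by simp
  qed
  have Theta: "(\<integral>r. (if s \<le> r then 1 else 0) * k r \<partial>lborel) = - \<Theta> s" for s
  proof -
    define t where "t = max b s"
    have "(\<integral>r. k r * indicator {s..t} r \<partial>lborel) = \<Theta> t - \<Theta> s"
      by (rule integral_FTC_Icc_real)
         (auto simp: t_def intro: d\<Theta> isCk)
    moreover have "(\<lambda>r. k r * indicator {s..t} r) = (\<lambda>r. (if s \<le> r then 1 else 0) * k r)"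
    proof
      fix r
      have "k r = 0" if "r > t" by (rule k0) (use that in \<open>auto simp: t_def\<close>)
      then show "k r * indicator {s..t} r = (if s \<le> r then 1 else 0) * k r"
        by (cases "r > t") auto
    qed
    ultimately show ?thesis using \<Theta>(2)[of t] by (simp add: t_def)
  qed
  \<comment> \<open>Cutting s at b changes nothing, as \<Theta> vanishes beyond b, and it makes the
    first factor integrable.\<close>
  define F where "F = (\<lambda>(s, r). (indicator {0..b} s * flux_density s) * ((if s \<le> r then 1 else 0) * k r))"
  have F: "integrable (lborel \<Otimes>\<^sub>M lborel) F"
  proof (rule lborel_pair.Fubini_integrable)
    show "F \<in> borel_measurable (lborel \<Otimes>\<^sub>M lborel)" unfolding F_def by measurable
    have i1: "integrable lborel (\<lambda>r. (if s \<le> r then 1 else 0) * k r)" for s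
      by (rule Bochner_Integration.integrable_bound[OF intk]) auto
    show "AE s in lborel. integrable lborel (\<lambda>r. F (s, r))"
      unfolding F_def by (auto intro!: integrable_mult_right i1)
    show "integrable lborel (\<lambda>s. \<integral>r. norm (F (s, r)) \<partial>lborel)"
    proof (rule Bochner_Integration.integrable_bound[where f="\<lambda>s. (indicator {0..b} s * flux_density s) * (\<integral>r. norm (k r) \<partial>lborel)"])
      show "integrable lborel (\<lambda>s. (indicator {0..b} s * flux_density s) * (\<integral>r. norm (k r) \<partial>lborel))"
        by (intro integrable_mult_left flux_density_integrable)
      show "(\<lambda>s. \<integral>r. norm (F (s, r)) \<partial>lborel) \<in> borel_measurable lborel"
        unfolding F_def by measurable
      have "(\<integral>r. norm (F (s, r)) \<partial>lborel) \<le> \<bar>indicator {0..b} s * flux_density s\<bar> * (\<integral>r. norm (k r) \<partial>lborel)" for s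
      proof -
        have "(\<integral>r. norm (F (s, r)) \<partial>lborel) = \<bar>indicator {0..b} s * flux_density s\<bar> * (\<integral>r. norm ((if s \<le> r then 1 else 0) * k r) \<partial>lborel)"
          unfolding F_def by (simp add: abs_mult)
        also have "\<dots> \<le> \<bar>indicator {0..b} s * flux_density s\<bar> * (\<integral>r. norm (k r) \<partial>lborel)"
          by (intro mult_left_mono integral_mono integrable_norm i1 intk) auto
        finally show ?thesis .
      qed
      then show "AE s in lborel. norm (\<integral>r. norm (F (s, r)) \<partial>lborel) \<le> norm ((indicator {0..b} s * flux_density s) * (\<integral>r. norm (k r) \<partial>lborel))"
        by (intro AE_I2) (simp add: abs_mult)
    qed
  qed
  have "(\<integral>r. U r * \<psi>' r \<partial>lborel) = (\<integral>s. (\<integral>r. F (s, r) \<partial>lborel) \<partial>lborel)"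
  proof -
    have "(\<integral>r. F (s, r) \<partial>lborel) = - (indicator {0..} s * flux_density s * \<Theta> s)" for s
    proof -
      have "(\<integral>r. F (s, r) \<partial>lborel) = (indicator {0..b} s * flux_density s) * (- \<Theta> s)"
        unfolding F_def by (simp add: Theta)
      then show ?thesis using \<Theta>(2)[of s] by (auto split: split_indicator)
    qed
    then show ?thesis by (simp add: \<Theta>(3))
  qed
  also have "\<dots> = (\<integral>r. (\<integral>s. F (s, r) \<partial>lborel) \<partial>lborel)"
    using lborel_pair.Fubini_integral[of "\<lambda>s r. F (s, r)"] F by simp
  also have "\<dots> = (\<integral>r. flux r * k r \<partial>lborel)"
  proof (intro Bochner_Integration.integral_cong refl)
    fix r
    have "(\<integral>s. F (s, r) \<partial>lborel) = (\<integral>s. indicator {0..r} s * flux_density s * k r \<partial>lborel)"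
      unfolding F_def using k0[of r]
      by (intro Bochner_Integration.integral_cong refl) (auto split: split_indicator)
    then show "(\<integral>s. F (s, r) \<partial>lborel) = flux r * k r" by (simp add: flux_def)
  qed
  finally show ?thesis by (simp add: k_def)
qed

end

lemma nonlin_continuous: "0 < p \<Longrightarrow> continuous_on {0..} (nonlin p \<alpha> \<beta>)"
  unfolding nonlin_def by (intro continuous_intros continuous_on_powr') auto

context radial_weak_solution
begin

text \<open>With B a primitive of flux/r^2, the function U + B has zero distributional derivative,
  so U = c - B almost everywhere by \<open>du_Bois_Reymond\<close>. The right-hand side is
  differentiable, and inserting it into the flux density makes the flux differentiable as
  well.\<close>

lemma continuous_representative:
  obtains V where "AE r in lborel. r > 0 \<longrightarrow> U r = V r"
    "\<And>r. r > 0 \<Longrightarrow> (V has_real_derivative - flux r / r\<^sup>2) (at r)"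
    "\<And>r. r > 0 \<Longrightarrow> (flux has_real_derivative r\<^sup>2 * nonlin p \<alpha> 1 (V r)) (at r)"
    "\<And>r. r > 0 \<Longrightarrow> V r \<ge> 0"
proof -
  define B where "B r = (LBINT s=ereal 1..ereal r. flux s / s\<^sup>2)" for r
  have cont_q: "isCont (\<lambda>s. flux s / s\<^sup>2) r" if "r > 0" for r
    using flux_isCont[OF that] that by (intro isCont_divide) (auto intro!: continuous_intros)
  have B: "(B has_real_derivative flux r / r\<^sup>2) (at r)" if "r > 0" for r
  proof -
    define a where "a = min r 1 / 2"
    define b where "b = max r 1 + 1"
    have ab: "0 < a" "a < 1" "a < r" "1 < b" "r < b" using that by (auto simp: a_def b_def)
    have "(B has_vector_derivative flux r / r\<^sup>2) (at r within {a..b})"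
      unfolding B_def
      by (rule interval_integral_FTC2)
         (use ab in \<open>auto intro!: continuous_at_imp_continuous_on cont_q\<close>)
    moreover have "at r within {a..b} = at r"
      using ab by (intro at_within_interior) auto
    ultimately show ?thesis by (simp add: has_real_derivative_iff_has_vector_derivative)
  qed
  have B_cont: "isCont B r" if "r > 0" for r using B[OF that] by (rule DERIV_isCont)
  define w where "w r = U r + indicator {0<..} r *\<^sub>R B r" for r
  have Bm: "(\<lambda>r. indicator {0<..} r *\<^sub>R B r) \<in> borel_measurable borel"
    by (rule borel_measurable_continuous_on_indicator)
       (auto intro!: continuous_at_imp_continuous_on B_cont)
  have [measurable]: "w \<in> borel_measurable borel"
    unfolding w_def using Bm by measurable
  have intB: "integrable lborel (\<lambda>r. indicator {a..b} r *\<^sub>R h r)" if "0 < a" "\<And>r. r > 0 \<Longrightarrow> isCont h r" for a b and h :: "real \<Rightarrow> real"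
    by (intro borel_integrable_compact continuous_at_imp_continuous_on) (use that in auto)
  obtain c where c: "AE r in lborel. r > 0 \<longrightarrow> w r = c"
  proof (rule du_Bois_Reymond[of w])
    show "w \<in> borel_measurable borel" by measurable
    show "integrable lborel (\<lambda>r. indicator {a<..<b} r * w r)" if "0 < a" "a < b" for a b
    proof -
      have "integrable lborel (\<lambda>r. indicator {a<..<b} r *\<^sub>R (indicator {a..b} r *\<^sub>R B r))"
        by (intro integrable_mult_indicator intB B_cont that) auto
      with U_integrable[OF that]
      have "integrable lborel (\<lambda>r. indicator {a<..<b} r * U r + indicator {a<..<b} r *\<^sub>R (indicator {a..b} r *\<^sub>R B r))"
        by (rule Bochner_Integration.integrable_add)
      moreover have "(\<lambda>r. indicator {a<..<b} r * U r + indicator {a<..<b} r *\<^sub>R (indicator {a..b} r *\<^sub>R B r)) = (\<lambda>r. indicator {a<..<b} r * w r)"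
        using that by (auto simp: fun_eq_iff w_def split: split_indicator)
      ultimately show ?thesis by simp
    qed
    show "(\<integral>r. w r * \<psi>' r \<partial>lborel) = 0"
      if \<psi>: "smooth_fun \<psi>" "\<And>r. (\<psi> has_real_derivative \<psi>' r) (at r)" and ab: "0 < a" "a < b"
        and out: "\<And>r. r \<notin> {a<..<b} \<Longrightarrow> \<psi> r = 0" for \<psi> \<psi>' a b
    proof -
      have s\<psi>': "smooth_fun \<psi>'" by (rule smooth_fun_deriv[OF \<psi>])
      have c\<psi>: "isCont \<psi> r" "isCont \<psi>' r" for r
        using smooth_fun_continuous[OF \<psi>(1), of UNIV] smooth_fun_continuous[OF s\<psi>', of UNIV]
        by (simp_all add: continuous_on_eq_continuous_at)
      have l0: "\<psi>' r = 0" if "r \<le> a" for r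
        by (rule deriv_zero_left[OF \<psi>(2) s\<psi>' _ that]) (use out in auto)
      have r0: "\<psi>' r = 0" if "r > b" for r
      proof -
        have "(\<psi> has_real_derivative 0) (at r)"
          by (intro DERIV_cong_ev[OF refl _ refl, THEN iffD2, OF _ DERIV_const[of 0]])
             (use out that in \<open>auto simp: eventually_nhds intro!: exI[of _ "{b<..}"]\<close>)
        then show ?thesis using \<psi>(2) DERIV_unique by blast
      qed
      have i1: "integrable lborel (\<lambda>r. indicator {a..b} r *\<^sub>R (B r * \<psi>' r))"
        by (intro intB ab isCont_mult B_cont c\<psi>)
      have i2: "integrable lborel (\<lambda>r. indicator {a..b} r *\<^sub>R (flux r / r\<^sup>2 * \<psi> r))"
        by (intro intB ab isCont_mult cont_q c\<psi>)
      have "integrable lborel (\<lambda>r. U r * \<psi>' r)"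
      proof -
        obtain C where C: "\<And>r. r \<in> {a..b} \<Longrightarrow> norm (\<psi>' r) \<le> C"
          using compact_continuous_image[OF smooth_fun_continuous[OF s\<psi>', of "{a..b}"] compact_Icc]
          by (metis (no_types, lifting) bounded_iff compact_imp_bounded imageI)
        show ?thesis
        proof (rule Bochner_Integration.integrable_bound[OF integrable_mult_right[OF U_integrable[of a "b + 1"], of C]])
          have [measurable]: "\<psi>' \<in> borel_measurable borel"
            by (intro borel_measurable_continuous_onI smooth_fun_continuous s\<psi>')
          show "(\<lambda>r. U r * \<psi>' r) \<in> borel_measurable lborel" by measurable
          have "norm (U r * \<psi>' r) \<le> norm (C * (indicator {a<..<b + 1} r * U r))" for r
          proof (cases "r \<le> a \<or> r > b")
            case False
            then have "\<bar>\<psi>' r\<bar> \<le> \<bar>C\<bar>" using C[of r] by auto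
            from mult_left_mono[OF this, of "\<bar>U r\<bar>"] False show ?thesis by (simp add: abs_mult mult.commute)
          qed (use l0 r0 in auto)
          then show "AE r in lborel. norm (U r * \<psi>' r) \<le> norm (C * (indicator {a<..<b + 1} r * U r))" by simp
        qed (use ab in auto)
      qed
      moreover have "(\<lambda>r. w r * \<psi>' r) = (\<lambda>r. U r * \<psi>' r + indicator {a..b} r *\<^sub>R (B r * \<psi>' r))"
      proof
        fix r
        show "w r * \<psi>' r = U r * \<psi>' r + indicator {a..b} r *\<^sub>R (B r * \<psi>' r)"
          by (cases "r \<le> a \<or> r > b") (use l0 r0 ab in \<open>auto simp: w_def algebra_simps\<close>)
      qed
      ultimately have "(\<integral>r. w r * \<psi>' r \<partial>lborel) = (\<integral>r. U r * \<psi>' r \<partial>lborel) + (\<integral>r. indicator {a..b} r *\<^sub>R (B r * \<psi>' r) \<partial>lborel)"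
        using i1 by simp
      also have "(\<integral>r. U r * \<psi>' r \<partial>lborel) = (\<integral>r. flux r * (\<psi> r / r\<^sup>2) \<partial>lborel)"
        by (rule radial_distributional_equation[OF \<psi> ab out])
      also have "(\<lambda>r. flux r * (\<psi> r / r\<^sup>2)) = (\<lambda>r. indicator {a..b} r *\<^sub>R (flux r / r\<^sup>2 * \<psi> r))"
        using out by (auto simp: fun_eq_iff split: split_indicator)
      also have "(\<integral>r. indicator {a..b} r *\<^sub>R (flux r / r\<^sup>2 * \<psi> r) \<partial>lborel) + (\<integral>r. indicator {a..b} r *\<^sub>R (B r * \<psi>' r) \<partial>lborel)
          = (\<integral>r. (flux r / r\<^sup>2 * \<psi> r + B r * \<psi>' r) * indicator {a..b} r \<partial>lborel)"
        using i1 i2 by (subst Bochner_Integration.integral_add[symmetric]) (auto simp: algebra_simps)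
      also have "\<dots> = B b * \<psi> b - B a * \<psi> a"
      proof (rule integral_FTC_Icc_real)
        show "((\<lambda>r. B r * \<psi> r) has_real_derivative flux r / r\<^sup>2 * \<psi> r + B r * \<psi>' r) (at r)" if "a \<le> r" for r
          by (rule derivative_eq_intros B \<psi> refl | use that ab in simp)+
        show "isCont (\<lambda>r. flux r / r\<^sup>2 * \<psi> r + B r * \<psi>' r) r" if "a \<le> r" for r
          by (intro isCont_add isCont_mult cont_q c\<psi> B_cont) (use that ab in auto)
      qed (use ab in auto)
      also have "\<dots> = 0" using out[of a] out[of b] by simp
      finally show ?thesis .
    qed
  qed
  define V where "V r = c - B r" for r
  have UV: "AE r in lborel. r > 0 \<longrightarrow> U r = V r"
    using c by eventually_elim (auto simp: w_def V_def)
  have V: "(V has_real_derivative - flux r / r\<^sup>2) (at r)" if "r > 0" for r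
    unfolding V_def[abs_def] using B[OF that] by (auto intro!: derivative_eq_intros)
  have V_cont: "isCont V r" if "r > 0" for r using V[OF that] by (rule DERIV_isCont)
  \<comment> \<open>V agrees with the positive U only almost everywhere, so continuity is used: a
    negative value would persist on an interval, which contains a point of agreement. Strict
    positivity is recovered later from the energy.\<close>
  have V_nonneg: "V r \<ge> 0" if r: "r > 0" for r
  proof (rule ccontr)
    assume "\<not> V r \<ge> 0"
    then have "V r < 0" by simp
    then have "eventually (\<lambda>x. V x < 0) (at r)"
      using V_cont[OF r] unfolding isCont_def by (metis order_tendstoD(2))
    then obtain d where d: "d > 0" "\<And>x. x \<noteq> r \<Longrightarrow> dist x r < d \<Longrightarrow> V x < 0"
      unfolding eventually_at by blast
    obtain s where s: "r < s" "s < r + d" "U s = V s"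
      by (rule AE_pos_ex_in_interval[OF UV, of r "r + d"]) (use r d in auto)
    then have "V s < 0" by (intro d) (auto simp: dist_real_def)
    with s U_pos[of s] show False by simp
  qed
  have "(flux has_real_derivative r\<^sup>2 * nonlin p \<alpha> 1 (V r)) (at r)" if r: "r > 0" for r
  proof -
    \<comment> \<open>The part over [0, e] is split off because nothing is known yet about V at the
      origin; on [e, t] the integrand h is continuous.\<close>
    define e where "e = r / 2"
    define h where "h s = s\<^sup>2 * nonlin p \<alpha> 1 (V s)" for s
    have e: "0 < e" "e < r" using r by (auto simp: e_def)
    have h_cont: "continuous_on {e..T} h" for T
    proof -
      have cV: "continuous_on {e..T} V"
        using e by (intro continuous_at_imp_continuous_on ballI V_cont) auto
      have "continuous_on {e..T} (\<lambda>s. nonlin p \<alpha> 1 (V s))"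
        by (rule continuous_on_compose2[OF nonlin_continuous cV]) (use e V_nonneg p in auto)
      then show ?thesis unfolding h_def by (intro continuous_on_mult continuous_on_power continuous_on_id)
    qed
    have eq: "flux t = flux e + integral {e..t} h" if "e \<le> t" for t
    proof -
      have "integral {0..t} flux_density = integral {0..e} flux_density + integral {e..t} flux_density"
        using e that by (intro Henstock_Kurzweil_Integration.integral_combine[symmetric] flux_eq_integral) auto
      moreover have "integral {e..t} flux_density = integral {e..t} h"
      proof -
        have si: "set_integrable lborel {e..t} flux_density"
          using integrable_mult_indicator[OF _ flux_density_integrable[of t], of "{e..t}"] e
          unfolding set_integrable_def
          by (auto simp: indicator_inter_arith[symmetric] Int_absorb2 mult.assoc[symmetric])
        have hi: "set_integrable lborel {e..t} h"
          unfolding set_integrable_def by (intro borel_integrable_compact h_cont) auto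
        have "(LINT s:{e..t}|lborel. flux_density s) = (LINT s:{e..t}|lborel. h s)"
          unfolding set_lebesgue_integral_def
        proof (rule integral_cong_AE)
          show "AE s in lborel. indicator {e..t} s *\<^sub>R flux_density s = indicator {e..t} s *\<^sub>R h s"
            using UV by eventually_elim (use e in \<open>auto simp: flux_density_def h_def split: split_indicator\<close>)
        qed (use si hi in \<open>auto simp: set_integrable_def intro: borel_measurable_integrable\<close>)
        then show ?thesis
          using set_borel_integral_eq_integral(2)[OF si] set_borel_integral_eq_integral(2)[OF hi] by simp
      qed
      ultimately show ?thesis by (simp add: flux_eq_integral(2))
    qed
    have "((\<lambda>t. flux e + integral {e..t} h) has_real_derivative h r) (at r within {e..r + 1})"
      using integral_has_real_derivative[OF h_cont[of "r + 1"], of r] e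
      by (auto intro!: derivative_eq_intros)
    moreover have "at r within {e..r + 1} = at r"
      using e by (intro at_within_interior) auto
    ultimately have d: "((\<lambda>t. flux e + integral {e..t} h) has_real_derivative h r) (at r)" by simp
    have ev: "eventually (\<lambda>t. flux t = flux e + integral {e..t} h) (nhds r)"
      unfolding eventually_nhds by (rule exI[of _ "{e<..}"]) (use e in \<open>auto intro: eq\<close>)
    have "(flux has_real_derivative h r) (at r)"
      using DERIV_cong_ev[OF refl ev refl] d by simp
    then show ?thesis by (simp add: h_def)
  qed
  with UV V V_nonneg show ?thesis by (intro that)
qed

end

context radial_weak_solution
begin

text \<open>Pairing the weak gradient with a radial bump supported in \<open>(a, b)\<close> and using
  \<open>\<bar>g\<bar> s \<le> \<lambda> \<bar>g\<bar>\<^sup>2 / 2 + s\<^sup>2 / (2 \<lambda>)\<close> bounds the oscillation by the energy in a small ball; this excludes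
  the singular behaviour \<open>r powr (-1/2)\<close>.\<close>

lemma oscillation_bound:
  assumes V: "\<And>r. r > 0 \<Longrightarrow> (V has_real_derivative - flux r / r\<^sup>2) (at r)" and \<kappa>: "\<kappa> > 0"
  obtains b where "b > 0" "\<And>a. 0 < a \<Longrightarrow> a < b \<Longrightarrow> \<bar>V a - V b\<bar> \<le> \<kappa> / sqrt a"
proof -
  obtain g where g: "weak_grad u g" "(\<integral>\<^sup>+x. ennreal ((norm (g x))\<^sup>2) \<partial>lborel) < \<infinity>"
    using H1 unfolding H1_def by blast
  have [measurable]: "g \<in> borel_measurable borel" using g(1) by (simp add: weak_grad_def)
  have gint: "integrable lborel (\<lambda>x. (norm (g x))\<^sup>2)"
    using g(2) by (intro integrableI_bounded) auto
  \<comment> \<open>Energy in the ball of radius b. By dominated convergence it tends to 0 with b,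
    which allows E b < \<kappa>^2.\<close>
  define E where "E b = (\<integral>x. indicator (ball 0 b) x * (norm (g x))\<^sup>2 \<partial>lborel)" for b
  have Eint: "integrable lborel (\<lambda>x. indicator (ball 0 b) x * (norm (g x))\<^sup>2)" for b
    using integrable_mult_indicator[OF _ gint, of "ball 0 b"] by simp
  have "(\<lambda>n. E (1 / real (Suc n))) \<longlonglongrightarrow> (\<integral>x. 0 \<partial>(lborel :: (real^3) measure))"
    unfolding E_def
  proof (rule integral_dominated_convergence[where w="\<lambda>x. (norm (g x))\<^sup>2"])
    have "AE x in lborel. x \<noteq> (0::real^3)" by (rule AE_lborel_singleton)
    then show "AE x in lborel. (\<lambda>n. indicator (ball 0 (1 / real (Suc n))) x * (norm (g x))\<^sup>2) \<longlonglongrightarrow> 0"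
    proof eventually_elim
      case (elim x)
      then have "norm x > 0" by simp
      then obtain N where N: "1 / real (Suc N) < norm x" using nat_approx_posE by metis
      have "indicator (ball 0 (1 / real (Suc n))) x * (norm (g x))\<^sup>2 = 0" if "n \<ge> N" for n
      proof -
        have "1 / real (Suc n) \<le> 1 / real (Suc N)" using that by (intro divide_left_mono) auto
        with N show ?thesis by (auto split: split_indicator)
      qed
      then show ?case by (intro tendsto_eventually) (auto simp: eventually_sequentially)
    qed
    show "(\<lambda>x. indicator (ball 0 (1 / real (Suc n))) x * (norm (g x))\<^sup>2) \<in> borel_measurable lborel" for n
      using Eint by (rule borel_measurable_integrable)
    show "AE x in lborel. norm (indicator (ball 0 (1 / real (Suc n))) x * (norm (g x))\<^sup>2) \<le> (norm (g x))\<^sup>2" for n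
      by (auto split: split_indicator)
  qed (use gint in auto)
  then have "(\<lambda>n. E (1 / real (Suc n))) \<longlonglongrightarrow> 0" by simp
  then have "eventually (\<lambda>n. E (1 / real (Suc n)) < \<kappa>\<^sup>2) sequentially"
    using \<kappa> by (intro order_tendstoD) auto
  then obtain n where n: "E (1 / real (Suc n)) < \<kappa>\<^sup>2" by (auto simp: eventually_sequentially)
  define b where "b = 1 / real (Suc n)"
  have b: "b > 0" "E b < \<kappa>\<^sup>2" using n by (auto simp: b_def)
  have cont_q: "isCont (\<lambda>s. flux s / s\<^sup>2) r" if "r > 0" for r
    using flux_isCont[OF that] that by (intro isCont_divide) (auto intro!: continuous_intros)
  show ?thesis
  proof (rule that[OF b(1)])
    fix a assume a: "0 < a" "a < b"
    \<comment> \<open>This weight balances Young's inequality: the energy is below \<kappa>^2 and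
      the integral of |x|^(-4) over the shell is at most 4 pi/a, so both terms become multiples of
      \<kappa>/sqrt a.\<close>
    define l where "l = 1 / (\<kappa> * sqrt a)"
    have l: "l > 0" using \<kappa> a by (simp add: l_def)
    let ?\<psi> = "\<lambda>n. interval_bump n a b"
    have bound: "\<bar>\<integral>r. flux r * (?\<psi> n r / r\<^sup>2) \<partial>lborel\<bar> \<le> \<kappa> / sqrt a" for n
    proof -
      obtain \<psi>' where \<psi>': "\<And>r. (?\<psi> n has_real_derivative \<psi>' r) (at r)" "smooth_fun \<psi>'"
        using smooth_interval_bump[of n a b] by (rule smooth_fun_realE) blast
      have [measurable]: "\<psi>' \<in> borel_measurable borel"
        by (intro borel_measurable_continuous_onI smooth_fun_continuous \<psi>')
      have [measurable]: "?\<psi> n \<in> borel_measurable borel"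
        by (intro borel_measurable_continuous_onI smooth_fun_continuous smooth_interval_bump)
      note prem = smooth_interval_bump \<psi>'(1) a interval_bump_outside
      have \<psi>'0: "\<psi>' r = 0" if "r \<le> a" for r
        by (rule deriv_zero_left[OF \<psi>' _ that]) (auto intro: interval_bump_outside)
      have "polar_density r * (U r * (\<psi>' r / r\<^sup>2)) = 4 * pi * (U r * \<psi>' r)" for r
        using \<psi>'0[of r] a by (cases "r \<le> a") (auto simp: polar_density_def)
      then have "4 * pi * (\<integral>r. U r * \<psi>' r \<partial>lborel) = (\<integral>r. polar_density r * (U r * (\<psi>' r / r\<^sup>2)) \<partial>lborel)"
        by simp
      also have "\<dots> = (\<integral>x. u x * (\<psi>' (norm x) / (norm x)\<^sup>2) \<partial>lborel)"
        unfolding u_eq by (subst integral_radial[symmetric]) auto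
      also have "\<dots> = - (\<integral>x. (g x \<bullet> x) * (?\<psi> n (norm x) / norm x ^ 3) \<partial>lborel)"
        by (rule weak_grad_radial(3)[OF g(1) prem])
      finally have "\<bar>4 * pi * (\<integral>r. U r * \<psi>' r \<partial>lborel)\<bar> = \<bar>- (\<integral>x. (g x \<bullet> x) * (?\<psi> n (norm x) / norm x ^ 3) \<partial>lborel)\<bar>"
        by (rule arg_cong)
      then have 1: "4 * pi * \<bar>\<integral>r. U r * \<psi>' r \<partial>lborel\<bar> = \<bar>\<integral>x. (g x \<bullet> x) * (?\<psi> n (norm x) / norm x ^ 3) \<partial>lborel\<bar>"
        by (simp add: abs_mult)
      let ?k = "\<lambda>r. indicator {a<..<b} r / r ^ 4 :: real"
      have pk: "polar_density r * ?k r = indicator {a<..<b} r * (4 * pi / r\<^sup>2)" for r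
        using a by (auto simp: polar_density_def field_simps eval_nat_numeral split: split_indicator)
      have FTC: "has_bochner_integral lborel (\<lambda>r. 4 * pi / r\<^sup>2 * indicator {a..b} r) (- 4 * pi / b - (- 4 * pi / a))"
      proof (rule has_bochner_integral_FTC_Icc_real)
        show "((\<lambda>r. - 4 * pi / r) has_real_derivative 4 * pi / r\<^sup>2) (at r)" if "a \<le> r" for r
          using that a by (auto intro!: derivative_eq_intros simp: power2_eq_square)
        show "isCont (\<lambda>r. 4 * pi / r\<^sup>2) r" if "a \<le> r" for r
          using that a by (intro continuous_intros) auto
      qed (use a in auto)
      have pki: "integrable lborel (\<lambda>r. polar_density r * ?k r)"
        unfolding pk
        by (rule Bochner_Integration.integrable_bound[OF integrable.intros[OF FTC]]) (auto split: split_indicator)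
      have "(\<integral>r. polar_density r * ?k r \<partial>lborel) \<le> (\<integral>r. 4 * pi / r\<^sup>2 * indicator {a..b} r \<partial>lborel)"
        by (rule integral_mono[OF pki integrable.intros[OF FTC]])
           (simp only: pk, auto split: split_indicator)
      also have "\<dots> \<le> 4 * pi / a" using has_bochner_integral_integral_eq[OF FTC] b by simp
      finally have k_le: "(\<integral>x. ?k (norm (x::real^3)) \<partial>lborel) \<le> 4 * pi / a"
        by (subst integral_radial) auto
      have k_int: "integrable lborel (\<lambda>x. ?k (norm (x::real^3)))"
        using pki by (subst integrable_radial) auto
      have dom: "\<bar>(g x \<bullet> x) * (?\<psi> n (norm x) / norm x ^ 3)\<bar>
          \<le> l / 2 * (indicator (ball 0 b) x * (norm (g x))\<^sup>2) + 1 / (2 * l) * ?k (norm x)" (is "?L x \<le> ?R x") for x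
      proof (cases "norm x \<in> {a<..<b}")
        case True
        then have x: "norm x > 0" using a by auto
        define G where "G = norm (g x)"
        define s where "s = 1 / (norm x)\<^sup>2"
        have "\<bar>g x \<bullet> x\<bar> \<le> G * norm x" unfolding G_def by (rule Cauchy_Schwarz_ineq2)
        then have "?L x \<le> (G * norm x) * (1 / norm x ^ 3)"
          unfolding abs_mult using interval_bump_bounds[of n a b "norm x"] x
          by (intro mult_mono) (auto simp: divide_right_mono)
        also have "\<dots> = G * s" using x by (simp add: s_def field_simps eval_nat_numeral)
        also have "\<dots> \<le> l / 2 * G\<^sup>2 + 1 / (2 * l) * s\<^sup>2"
        proof -
          have "0 \<le> (l * G - s)\<^sup>2" by simp
          then show ?thesis using l by (simp add: field_simps power2_eq_square)
        qed
        also have "\<dots> = ?R x" using True by (simp add: G_def s_def power_divide)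
        finally show ?thesis .
      next
        case False
        then have "?\<psi> n (norm x) = 0" by (rule interval_bump_outside)
        then show ?thesis using l by simp
      qed
      have Rint: "integrable lborel ?R"
        by (intro Bochner_Integration.integrable_add integrable_mult_right Eint k_int)
      have "\<bar>\<integral>x. (g x \<bullet> x) * (?\<psi> n (norm x) / norm x ^ 3) \<partial>lborel\<bar> \<le> (\<integral>x. ?L x \<partial>lborel)"
        by (rule integral_abs_bound)
      also have "\<dots> \<le> (\<integral>x. ?R x \<partial>lborel)"
        by (rule integral_mono'[OF Rint dom order_trans[OF abs_ge_zero dom]])
      also have "\<dots> = l / 2 * E b + 1 / (2 * l) * (\<integral>x. ?k (norm (x::real^3)) \<partial>lborel)"
        unfolding E_def
        by (subst Bochner_Integration.integral_add) (intro integrable_mult_right Eint k_int | simp only: integral_mult_right_zero)+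
      also have "\<dots> \<le> l / 2 * \<kappa>\<^sup>2 + 1 / (2 * l) * (4 * pi / a)"
        using b l k_le by (intro add_mono mult_left_mono) auto
      also have "\<dots> = \<kappa> / sqrt a * (1 / 2 + 2 * pi)"
      proof -
        have "sqrt a * sqrt a = a" using a by simp
        then show ?thesis using a \<kappa> unfolding l_def by (simp add: field_simps power2_eq_square)
      qed
      \<comment> \<open>1/2 + 2 pi is below 4 pi, the factor that polar coordinates put on the
        left-hand side.\<close>
      also have "\<dots> \<le> \<kappa> / sqrt a * (4 * pi)"
        using \<kappa> a pi_gt3 by (intro mult_left_mono) auto
      finally have "4 * pi * \<bar>\<integral>r. U r * \<psi>' r \<partial>lborel\<bar> \<le> 4 * pi * (\<kappa> / sqrt a)"
        unfolding 1 by (simp add: mult.commute)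
      then have "\<bar>\<integral>r. U r * \<psi>' r \<partial>lborel\<bar> \<le> \<kappa> / sqrt a"
        by (rule mult_left_le_imp_le) simp
      then show ?thesis
        using radial_distributional_equation[OF prem] by simp
    qed
    \<comment> \<open>Passing from bumps to the indicator of (a, b) turns the bound into one for the
      increment of V.\<close>
    define w where "w r = indicator {a..b} r *\<^sub>R (flux r / r\<^sup>2)" for r
    have [measurable]: "w \<in> borel_measurable borel"
      unfolding w_def by (rule borel_measurable_continuous_on_indicator)
        (use a in \<open>auto intro!: continuous_at_imp_continuous_on cont_q\<close>)
    have wint: "integrable lborel w"
      unfolding w_def by (intro borel_integrable_compact continuous_at_imp_continuous_on)
        (use a in \<open>auto intro!: cont_q\<close>)
    have wi: "integrable lborel (\<lambda>r. indicator {a<..<b} r * w r)"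
      using integrable_mult_indicator[OF _ wint, of "{a<..<b}"] by simp
    have eq1: "w r * ?\<psi> n r = flux r * (?\<psi> n r / r\<^sup>2)" for n r
      using interval_bump_outside[of r a b n] by (cases "r \<in> {a<..<b}") (auto simp: w_def)
    have "(\<integral>r. indicator {a<..<b} r * w r \<partial>lborel) = (\<integral>r. flux r / r\<^sup>2 * indicator {a..b} r \<partial>lborel)"
    proof (rule integral_cong_AE)
      have "AE r in lborel. r \<noteq> a \<and> r \<noteq> b" using AE_lborel_singleton[of a] AE_lborel_singleton[of b] by eventually_elim auto
      then show "AE r in lborel. indicator {a<..<b} r * w r = flux r / r\<^sup>2 * indicator {a..b} r"
        by eventually_elim (auto simp: w_def split: split_indicator)
      show "(\<lambda>r. indicator {a<..<b} r * w r) \<in> borel_measurable lborel" by measurable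
      have "(\<lambda>r. flux r / r\<^sup>2 * indicator {a..b} r) = w" by (auto simp: w_def fun_eq_iff)
      then show "(\<lambda>r. flux r / r\<^sup>2 * indicator {a..b} r) \<in> borel_measurable lborel" by simp
    qed
    also have "\<dots> = - V b - (- V a)"
    proof (rule integral_FTC_Icc_real)
      show "((\<lambda>r. - V r) has_real_derivative flux r / r\<^sup>2) (at r)" if "a \<le> r" for r
        using V[of r] that a by (auto intro!: derivative_eq_intros)
      show "isCont (\<lambda>r. flux r / r\<^sup>2) r" if "a \<le> r" for r using that a by (intro cont_q) auto
    qed (use a in auto)
    finally have "(\<lambda>n. \<integral>r. flux r * (?\<psi> n r / r\<^sup>2) \<partial>lborel) \<longlonglongrightarrow> V a - V b"
      using interval_bump_integrable(2)[OF wi] by (simp add: eq1)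
    then have "(\<lambda>n. \<bar>\<integral>r. flux r * (?\<psi> n r / r\<^sup>2) \<partial>lborel\<bar>) \<longlonglongrightarrow> \<bar>V a - V b\<bar>"
      by (rule tendsto_rabs)
    then show "\<bar>V a - V b\<bar> \<le> \<kappa> / sqrt a"
      by (rule LIMSEQ_le_const2) (use bound in auto)
  qed
qed

end

section \<open>The radial ordinary differential equation\<close>

definition energy_potential :: "real \<Rightarrow> real \<Rightarrow> real \<Rightarrow> real \<Rightarrow> real" where
  "energy_potential p \<alpha> \<beta> s = s ^ 6 / 6 + \<beta> * s powr (p + 1) / (p + 1) - \<alpha> * s\<^sup>2 / 2"

lemma nonlin_eq:
  assumes "s > 0"
  shows "nonlin p \<alpha> \<beta> s = s * (s ^ 4 + \<beta> * s powr (p - 1) - \<alpha>)"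
proof -
  have "s powr p = s * s powr (p - 1)" using assms by (simp add: powr_diff)
  then show ?thesis by (simp add: nonlin_def algebra_simps eval_nat_numeral)
qed

lemma powr_add_one_eq: "s powr (p + 1) = s\<^sup>2 * s powr (p - 1)" if "s > 0" for s p :: real
proof -
  have "s powr (p + 1) = s powr (2 + (p - 1))" by (rule arg_cong[of _ _ "\<lambda>t. s powr t"]) simp
  also have "\<dots> = s powr 2 * s powr (p - 1)" by (rule powr_add)
  finally show ?thesis using that by simp
qed

lemma energy_potential_eq:
  assumes "s > 0"
  shows "energy_potential p \<alpha> \<beta> s = s\<^sup>2 * (s ^ 4 / 6 + \<beta> * s powr (p - 1) / (p + 1) - \<alpha> / 2)"
proof -
  show ?thesis
    unfolding energy_potential_def powr_add_one_eq[OF assms] by (simp add: algebra_simps eval_nat_numeral)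
qed

text \<open>Divided by s^2 and doubled, F(s) \<ge> 0 reads \<alpha> \<le> s^4/3 + 2 y/(p+1) with y =
  \<beta> s^(p-1); both coefficients are below 1, so \<alpha> < s^4 + y, which is f(s) > 0. It is
  applied where w' = 0 and the energy reduces to F(w).\<close>

lemma nonlin_pos_if_potential_nonneg:
  assumes "s > 0" "p > 1" "\<beta> > 0" "energy_potential p \<alpha> \<beta> s \<ge> 0"
  shows "nonlin p \<alpha> \<beta> s > 0"
proof -
  define y where "y = \<beta> * s powr (p - 1)"
  have y: "y > 0" using assms by (simp add: y_def)
  have "s ^ 4 / 6 + y / (p + 1) - \<alpha> / 2 \<ge> 0"
    using assms(4) \<open>s > 0\<close> unfolding energy_potential_eq[OF \<open>s > 0\<close>] y_def by (simp add: zero_le_mult_iff)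
  moreover have "y / (p + 1) < y / 2" using y assms(2) by (intro divide_strict_left_mono) auto
  moreover have "s ^ 4 > 0" using assms(1) by simp
  ultimately have "s ^ 4 + y - \<alpha> > 0" by linarith
  then show ?thesis using assms(1) by (simp add: nonlin_eq y_def)
qed

text \<open>At a zero of w the difference quotient is computed directly, with q > 1 forcing the
  derivative 0. Such zeros cannot be excluded beforehand: positivity of w follows from the energy
  identity, which rests on this lemma.\<close>

lemma has_real_derivative_powr_nonneg:
  fixes w :: "real \<Rightarrow> real"
  assumes w: "(w has_real_derivative d) (at r)" and nonneg: "eventually (\<lambda>t. w t \<ge> 0) (nhds r)" and q: "q > 1"
  shows "((\<lambda>t. w t powr q) has_real_derivative q * w r powr (q - 1) * d) (at r)"
proof (cases "w r > 0")
  case True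
  then show ?thesis using w by (auto intro!: derivative_eq_intros simp: powr_diff)
next
  case False
  then have w0: "w r = 0" using eventually_nhds_x_imp_x[OF nonneg] by simp
  have "isCont w r" using w by (rule DERIV_isCont)
  then have lim: "(w \<longlongrightarrow> 0) (at r)" using w0 by (simp add: isCont_def)
  have nonneg': "eventually (\<lambda>t. w t \<ge> 0) (at r)" using nonneg by (simp add: eventually_nhds_conv_at)
  have "((\<lambda>t. w t powr (q - 1)) \<longlongrightarrow> 0 powr (q - 1)) (at r)"
    by (rule tendsto_powr'[OF lim tendsto_const]) (use nonneg' q in auto)
  moreover have "((\<lambda>t. (w t - w r) / (t - r)) \<longlongrightarrow> d) (at r)"
    using w by (simp add: has_field_derivative_iff)
  ultimately have "((\<lambda>t. w t powr (q - 1) * ((w t - w r) / (t - r))) \<longlongrightarrow> 0 powr (q - 1) * d) (at r)"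
    by (intro tendsto_mult)
  then have "((\<lambda>t. (w t powr q - w r powr q) / (t - r)) \<longlongrightarrow> 0) (at r)"
  proof (rule Lim_transform_eventually[THEN tendsto_eq_rhs])
    show "eventually (\<lambda>t. w t powr (q - 1) * ((w t - w r) / (t - r)) = (w t powr q - w r powr q) / (t - r)) (at r)"
      using nonneg' by eventually_elim (use q w0 in \<open>auto simp: powr_diff\<close>)
  qed simp
  then show ?thesis using w0 q by (simp add: has_field_derivative_iff)
qed

lemma DERIV_nonneg_ge_limit:
  fixes g :: "real \<Rightarrow> real"
  assumes g: "\<And>t. 0 < t \<Longrightarrow> t \<le> r \<Longrightarrow> \<exists>y. (g has_real_derivative y) (at t) \<and> 0 \<le> y"
    and lim: "(g \<longlongrightarrow> L) (at_right 0)" and r: "r > 0"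
  shows "L \<le> g r"
proof (rule tendsto_upperbound[OF lim])
  show "eventually (\<lambda>t. g t \<le> g r) (at_right 0)"
    unfolding eventually_at_right_field
    by (rule exI[of _ r]) (use r g in \<open>auto intro!: DERIV_nonneg_imp_nondecreasing[of _ r g]\<close>)
qed simp

lemma DERIV_nonpos_le_limit:
  fixes g :: "real \<Rightarrow> real"
  assumes g: "\<And>t. 0 < t \<Longrightarrow> t \<le> r \<Longrightarrow> \<exists>y. (g has_real_derivative y) (at t) \<and> y \<le> 0"
    and lim: "(g \<longlongrightarrow> L) (at_right 0)" and r: "r > 0"
  shows "g r \<le> L"
proof -
  have "- L \<le> - g r"
  proof (rule DERIV_nonneg_ge_limit[of r "\<lambda>t. - g t"])
    show "\<exists>y. ((\<lambda>t. - g t) has_real_derivative y) (at t) \<and> 0 \<le> y" if "0 < t" "t \<le> r" for t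
    proof -
      from g[OF that] obtain y where "(g has_real_derivative y) (at t)" "y \<le> 0" by blast
      then show ?thesis by (intro exI[of _ "- y"] conjI DERIV_minus) auto
    qed
  qed (use lim r in \<open>auto intro: tendsto_minus\<close>)
  then show ?thesis by simp
qed

text \<open>Collects what a weak solution yields, in a form stable under rescaling.
  \<open>w1_lim\<close> expresses regularity at 0, where the Laplacian is 3 w''(0);
  \<open>decay\<close> is what a finite L^2 norm gives pointwise, smallness along some sequence;
  \<open>w_nontrivial\<close> rules out a profile that vanishes from some radius on.\<close>

locale radial_ode =
  fixes p \<alpha> \<beta> m :: real and w w1 :: "real \<Rightarrow> real"
  assumes p: "1 < p" "p < 5" and \<alpha>: "0 < \<alpha>" and \<beta>: "0 < \<beta>"
    and w_deriv: "\<And>r. r > 0 \<Longrightarrow> (w has_real_derivative w1 r) (at r)"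
    and w1_deriv: "\<And>r. r > 0 \<Longrightarrow> (w1 has_real_derivative - 2 * w1 r / r - nonlin p \<alpha> \<beta> (w r)) (at r)"
    and w_nonneg: "\<And>r. r > 0 \<Longrightarrow> w r \<ge> 0"
    and w_nontrivial: "\<And>R. \<exists>r>R. w r \<noteq> 0"
    and w_lim: "(w \<longlongrightarrow> m) (at_right 0)"
    and w1_lim: "((\<lambda>r. w1 r / r) \<longlongrightarrow> - nonlin p \<alpha> \<beta> m / 3) (at_right 0)"
    and decay: "\<And>\<epsilon> R. \<epsilon> > 0 \<Longrightarrow> \<exists>r>R. r ^ 3 * (w r)\<^sup>2 < \<epsilon>"
begin

abbreviation "nl \<equiv> nonlin p \<alpha> \<beta>"
abbreviation "pot \<equiv> energy_potential p \<alpha> \<beta>"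

section \<open>Energy, positivity and monotonicity of the profile\<close>

definition E :: "real \<Rightarrow> real" where "E r = (w1 r)\<^sup>2 / 2 + pot (w r)"

lemma pot_deriv:
  assumes "r > 0"
  shows "((\<lambda>t. pot (w t)) has_real_derivative nl (w r) * w1 r) (at r)"
proof -
  have "eventually (\<lambda>t. w t \<ge> 0) (nhds r)"
    unfolding eventually_nhds by (rule exI[of _ "{0<..}"]) (use assms w_nonneg in auto)
  then have "((\<lambda>t. w t powr (p + 1)) has_real_derivative (p + 1) * w r powr (p + 1 - 1) * w1 r) (at r)"
    by (rule has_real_derivative_powr_nonneg[OF w_deriv[OF assms]]) (use p in simp)
  then have "((\<lambda>t. \<beta> * w t powr (p + 1) / (p + 1)) has_real_derivative \<beta> * ((p + 1) * w r powr (p + 1 - 1) * w1 r) / (p + 1)) (at r)"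
    by (intro DERIV_cdivide DERIV_cmult)
  moreover have "((\<lambda>t. w t ^ 6 / 6) has_real_derivative w r ^ 5 * w1 r) (at r)"
    "((\<lambda>t. \<alpha> * (w t)\<^sup>2 / 2) has_real_derivative \<alpha> * w r * w1 r) (at r)"
    using w_deriv[OF assms] by (auto intro!: derivative_eq_intros)
  ultimately have "((\<lambda>t. pot (w t)) has_real_derivative w r ^ 5 * w1 r
      + \<beta> * ((p + 1) * w r powr (p + 1 - 1) * w1 r) / (p + 1) - \<alpha> * w r * w1 r) (at r)"
    unfolding energy_potential_def by (intro DERIV_diff DERIV_add)
  moreover have "\<beta> * ((p + 1) * w r powr (p + 1 - 1) * w1 r) / (p + 1) = \<beta> * w r powr p * w1 r"
    using p by simp
  ultimately show ?thesis by (simp add: nonlin_def algebra_simps)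
qed

lemma E_deriv: "r > 0 \<Longrightarrow> (E has_real_derivative - 2 * (w1 r)\<^sup>2 / r) (at r)"
proof -
  assume r: "r > 0"
  have "((\<lambda>r. (w1 r)\<^sup>2 / 2) has_real_derivative w1 r * (- 2 * w1 r / r - nl (w r))) (at r)"
    using w1_deriv[OF r] by (auto intro!: derivative_eq_intros)
  from DERIV_add[OF this pot_deriv[OF r]]
  show ?thesis unfolding E_def[abs_def] by (rule DERIV_cong) (simp add: algebra_simps power2_eq_square)
qed

lemma E_decreasing: "r > 0 \<Longrightarrow> \<exists>y. (E has_real_derivative y) (at r) \<and> y \<le> 0"
  by (rule exI[of _ "- 2 * (w1 r)\<^sup>2 / r"]) (use E_deriv[of r] in simp)

lemma E_antimono: "0 < r \<Longrightarrow> r \<le> s \<Longrightarrow> E s \<le> E r"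
  by (rule DERIV_nonpos_imp_nonincreasing[of r s E]) (auto intro: E_decreasing)

lemma pot_ge: "s \<ge> 0 \<Longrightarrow> pot s \<ge> - (\<alpha> / 2) * s\<^sup>2"
  using \<beta> p by (simp add: energy_potential_def)

lemma pot_0 [simp]: "pot 0 = 0" using p by (simp add: energy_potential_def)

text \<open>E is nonincreasing, and E \<ge> F(w) \<ge> -(\<alpha>/2) w^2, where w^2 is arbitrarily
  small along the sequence from \<open>decay\<close>.\<close>

lemma E_nonneg: assumes "r > 0" shows "E r \<ge> 0"
proof (rule ccontr)
  assume "\<not> E r \<ge> 0"
  then have neg: "E r < 0" by simp
  obtain t where t: "t > max r 1" "t ^ 3 * (w t)\<^sup>2 < - E r * 2 / \<alpha>"
    using decay[of "- E r * 2 / \<alpha>" "max r 1"] neg \<alpha> by (auto simp: divide_neg_pos)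
  have "- (\<alpha> / 2) * (w t)\<^sup>2 \<le> pot (w t)" using t assms by (intro pot_ge w_nonneg) auto
  also have "\<dots> \<le> E t" by (simp add: E_def)
  also have "\<dots> \<le> E r" using t assms by (intro E_antimono) auto
  finally have "- E r * 2 / \<alpha> \<le> (w t)\<^sup>2" using \<alpha> by (simp add: field_simps)
  also have "1 \<le> t ^ 3" using t by simp
  then have "(w t)\<^sup>2 \<le> t ^ 3 * (w t)\<^sup>2" using mult_right_mono[of 1 "t ^ 3" "(w t)\<^sup>2"] by simp
  finally show False using t by simp
qed

text \<open>Rigidity at zero energy takes the place of a uniqueness theorem for the differential
  equation: once E = 0 it stays 0, the dissipation 2 w1^2/r vanishes and w is frozen. Both
  \<open>w_pos\<close> and \<open>E_pos\<close> contradict this with the behaviour far out.\<close>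

lemma w1_zero_after:
  assumes "r > 0" "E r = 0" "s > r" shows "w1 s = 0"
proof -
  have E0: "E t = 0" if "t > r" for t
    using E_antimono[of r t] E_nonneg[of t] assms that by simp
  have "(E has_real_derivative 0) (at s)"
    by (intro DERIV_cong_ev[OF refl _ refl, THEN iffD2, OF _ DERIV_const[of 0]])
       (use E0 assms in \<open>auto simp: eventually_nhds intro!: exI[of _ "{r<..}"]\<close>)
  then have "- 2 * (w1 s)\<^sup>2 / s = 0" using E_deriv[of s] assms DERIV_unique by force
  then show ?thesis using assms by simp
qed

lemma w_const_after:
  assumes "r > 0" "E r = 0" "s > r" shows "w s = w r"
proof -
  obtain z where "r < z" "w s - w r = (s - r) * w1 z"
    using MVT2[of r s w w1] w_deriv assms by (metis less_le_trans)
  with w1_zero_after[OF assms(1,2)] show ?thesis by simp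
qed

lemma w_pos: assumes "r > 0" shows "w r > 0"
proof (rule ccontr)
  assume "\<not> w r > 0"
  with w_nonneg[OF assms] have w0: "w r = 0" by simp
  have "(w1 r) = 0"
  proof (rule DERIV_local_min[OF w_deriv[OF assms]])
    show "\<forall>y. \<bar>r - y\<bar> < r \<longrightarrow> w r \<le> w y" using w0 w_nonneg by (auto simp: abs_less_iff)
  qed fact
  then have "E r = 0" using w0 by (simp add: E_def)
  then have "w s = 0" if "s > r" for s using w_const_after[OF assms _ that] w0 by simp
  then show False using w_nontrivial[of r] by blast
qed

lemma small_after:
  assumes "\<epsilon> > 0" obtains r where "r > R" "r > 1" "r ^ 3 * (w r)\<^sup>2 < \<epsilon>" "(w r)\<^sup>2 < \<epsilon>"
proof -
  obtain r where r: "r > max R 1" "r ^ 3 * (w r)\<^sup>2 < \<epsilon>" using decay[OF assms] by blast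
  have "1 \<le> r ^ 3" using r by simp
  then have "(w r)\<^sup>2 \<le> r ^ 3 * (w r)\<^sup>2" using mult_right_mono[of 1 "r ^ 3" "(w r)\<^sup>2"] by simp
  with r show ?thesis by (intro that[of r]) auto
qed

lemma E_pos: assumes "r > 0" shows "E r > 0"
proof (rule ccontr)
  assume "\<not> E r > 0"
  with E_nonneg[OF assms] have "E r = 0" by simp
  obtain s where "s > r" "(w s)\<^sup>2 < (w r)\<^sup>2" using small_after[of "(w r)\<^sup>2" r] w_pos[OF assms] by auto
  with w_const_after[OF assms \<open>E r = 0\<close>, of s] show False by simp
qed

lemma w1_tendsto_0: "(w1 \<longlongrightarrow> 0) (at_right 0)"
proof -
  have "((\<lambda>r. w1 r / r * r) \<longlongrightarrow> - nl m / 3 * 0) (at_right 0)"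
    by (intro tendsto_mult w1_lim tendsto_ident_at)
  then have "((\<lambda>r. w1 r / r * r) \<longlongrightarrow> 0) (at_right 0)" by simp
  then show ?thesis
    by (rule Lim_transform_eventually) (rule eventually_mono[OF eventually_at_right_less[of 0]], simp)
qed

lemma m_nonneg: "m \<ge> 0"
  by (rule tendsto_lowerbound[OF w_lim]) (auto intro!: eventually_mono[OF eventually_at_right_less[of 0]] w_nonneg)

lemma pot_continuous: "continuous_on {0..} pot"
  unfolding energy_potential_def using p by (intro continuous_intros continuous_on_powr') auto

lemma pot_lim: "((\<lambda>r. pot (w r)) \<longlongrightarrow> pot m) (at_right 0)"
proof (rule continuous_on_tendsto_compose[OF pot_continuous w_lim])
  show "\<forall>\<^sub>F r in at_right 0. w r \<in> {0..}"
    by (auto intro!: eventually_mono[OF eventually_at_right_less[of 0]] w_nonneg)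
qed (use m_nonneg in simp)

lemma E_lim: "(E \<longlongrightarrow> pot m) (at_right 0)"
proof -
  have "(E \<longlongrightarrow> 0\<^sup>2 / 2 + pot m) (at_right 0)"
    unfolding E_def by (intro tendsto_intros w1_tendsto_0 pot_lim) auto
  then show ?thesis by simp
qed

lemma pot_m_pos: "pot m > 0"
proof -
  have "E 1 \<le> pot m"
    by (rule DERIV_nonpos_le_limit[OF E_decreasing E_lim]) auto
  with E_pos[of 1] show ?thesis by simp
qed

lemma m_pos: "m > 0"
  using pot_m_pos m_nonneg pot_0 by (cases "m = 0") auto

lemma nl_m_pos: "nl m > 0"
  using nonlin_pos_if_potential_nonneg[OF m_pos] p \<beta> pot_m_pos by simp

text \<open>At a first zero s of w1 the energy is F(w s) \<ge> 0, so f(w s) > 0 and w1 has negative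
  derivative at s; then w1 would be positive just before s. Near the origin the sign comes from the
  limit of w1/r.\<close>

lemma w1_neg: assumes "r > 0" shows "w1 r < 0"
proof (rule ccontr)
  assume nneg: "\<not> w1 r < 0"
  have "eventually (\<lambda>r. w1 r / r < 0) (at_right 0)"
    by (rule order_tendstoD(2)[OF w1_lim]) (use nl_m_pos in simp)
  then obtain d where d: "d > 0" "\<And>t. 0 < t \<Longrightarrow> t < d \<Longrightarrow> w1 t / t < 0"
    unfolding eventually_at_right_field by blast
  then have d: "d > 0" "\<And>t. 0 < t \<Longrightarrow> t < d \<Longrightarrow> w1 t < 0" by (auto simp: divide_less_0_iff)
  have "r \<ge> d" using d(2)[of r] nneg assms by force
  \<comment> \<open>Starting at d/2, where w1 is still negative, makes this set compact; its least
    element is the first zero of w1.\<close>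
  define S where "S = {d / 2..r} \<inter> w1 -` {0..}"
  have cont: "continuous_on {d / 2..r} w1"
    using d by (intro continuous_at_imp_continuous_on ballI DERIV_isCont[OF w1_deriv]) auto
  have "closed S" unfolding S_def
    by (rule continuous_closed_preimage[OF cont]) auto
  moreover have "bounded S" by (rule bounded_subset[OF bounded_closed_interval[of "d / 2" r]]) (auto simp: S_def)
  ultimately have "compact S" by (simp add: compact_eq_bounded_closed)
  moreover have "r \<in> S" using nneg d \<open>r \<ge> d\<close> by (auto simp: S_def)
  ultimately obtain s where s: "s \<in> S" "\<And>t. t \<in> S \<Longrightarrow> s \<le> t"
    using compact_attains_inf[of S] by blast
  have spos: "s > 0" "s \<ge> d / 2" "s \<le> r" "w1 s \<ge> 0" using s(1) d by (auto simp: S_def)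
  have "s > d / 2" using spos d(2)[of s] d(1) by (cases "s = d / 2") auto
  have left: "w1 t < 0" if "d / 2 \<le> t" "t < s" for t
    using s(2)[of t] that spos by (force simp: S_def)
  have "w1 s = 0"
  proof (rule antisym)
    have "(w1 \<longlongrightarrow> w1 s) (at_left s)"
      using DERIV_isCont[OF w1_deriv[OF spos(1)]] by (simp add: isCont_def filterlim_at_split)
    then show "w1 s \<le> 0"
      by (rule tendsto_upperbound)
         (use left \<open>s > d / 2\<close> in \<open>auto simp: eventually_at_left_field intro!: exI[of _ "d / 2"] less_imp_le\<close>)
  qed (use spos in simp)
  then have "pot (w s) \<ge> 0" using E_nonneg[OF spos(1)] by (simp add: E_def)
  then have "nl (w s) > 0"
    by (intro nonlin_pos_if_potential_nonneg w_pos spos) (use p \<beta> in auto)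
  then have "- 2 * w1 s / s - nl (w s) < 0" using \<open>w1 s = 0\<close> by simp
  from DERIV_neg_dec_left[OF w1_deriv[OF spos(1)] this]
  obtain e where e: "e > 0" "\<And>h. 0 < h \<Longrightarrow> h < e \<Longrightarrow> w1 s < w1 (s - h)" by blast
  define h where "h = min (e / 2) (s - d / 2)"
  have "h \<le> s - d / 2" by (simp add: h_def)
  then have "d / 2 \<le> s - h" by linarith
  have "0 < h" "h < e" using e \<open>s > d / 2\<close> by (auto simp: h_def)
  have "w1 s < w1 (s - h)" by (rule e(2)) fact+
  moreover have "w1 (s - h) < 0" by (rule left) (use \<open>d / 2 \<le> s - h\<close> \<open>0 < h\<close> in auto)
  ultimately show False using \<open>w1 s = 0\<close> by simp
qed

lemma w_decreasing: "r > 0 \<Longrightarrow> \<exists>y. (w has_real_derivative y) (at r) \<and> y \<le> 0"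
  by (rule exI[of _ "w1 r"]) (use w_deriv[of r] w1_neg[of r] in simp)

lemma w_antimono: "0 < r \<Longrightarrow> r \<le> s \<Longrightarrow> w s \<le> w r"
  by (rule DERIV_nonpos_imp_nonincreasing[of r s w]) (auto intro: w_decreasing)

lemma w_le_m: "r > 0 \<Longrightarrow> w r \<le> m"
  by (rule DERIV_nonpos_le_limit[OF w_decreasing w_lim]) auto

lemma pot_abs_le:
  assumes "0 < s" "s \<le> m"
  shows "\<bar>pot s\<bar> \<le> (m ^ 4 / 6 + \<beta> * m powr (p - 1) / (p + 1) + \<alpha> / 2) * s\<^sup>2"
proof -
  have "\<bar>s ^ 4 / 6 + \<beta> * s powr (p - 1) / (p + 1) - \<alpha> / 2\<bar> \<le> m ^ 4 / 6 + \<beta> * m powr (p - 1) / (p + 1) + \<alpha> / 2"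
  proof -
    have "s ^ 4 \<le> m ^ 4" using assms by (intro power_mono) auto
    moreover have "\<beta> * s powr (p - 1) / (p + 1) \<le> \<beta> * m powr (p - 1) / (p + 1)"
      using assms \<beta> p by (intro divide_right_mono mult_left_mono powr_mono2) auto
    moreover have "0 \<le> \<beta> * s powr (p - 1) / (p + 1)" "0 \<le> s ^ 4" using \<beta> p by auto
    ultimately show ?thesis using \<alpha> by linarith
  qed
  then have "s\<^sup>2 * \<bar>s ^ 4 / 6 + \<beta> * s powr (p - 1) / (p + 1) - \<alpha> / 2\<bar> \<le> s\<^sup>2 * (m ^ 4 / 6 + \<beta> * m powr (p - 1) / (p + 1) + \<alpha> / 2)"
    by (intro mult_left_mono) auto
  then show ?thesis unfolding energy_potential_eq[OF assms(1)] by (simp add: abs_mult mult.commute)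
qed

section \<open>Pohozaev functional and pointwise decay\<close>

definition a where "a r = - r\<^sup>2 * w1 r" for r

lemma a_pos: "r > 0 \<Longrightarrow> a r > 0"
  using w1_neg by (simp add: a_def mult_pos_neg)

lemma a_deriv: "r > 0 \<Longrightarrow> (a has_real_derivative r\<^sup>2 * nl (w r)) (at r)"
  unfolding a_def[abs_def]
  by (rule derivative_eq_intros w1_deriv refl | assumption)+
     (simp add: field_simps power2_eq_square)

text \<open>Far out w is so small that the linear term dominates and f(w) \<le> 0, so a is
  nonincreasing there. The bound is not uniform in the parameters; it serves to make P small along a
  sequence.\<close>

lemma a_bounded: obtains K R where "R > 0" "\<And>r. r \<ge> R \<Longrightarrow> a r \<le> K"
proof -
  have "((\<lambda>s. s ^ 4 + \<beta> * s powr (p - 1)) \<longlongrightarrow> 0 ^ 4 + \<beta> * 0 powr (p - 1)) (at_right (0::real))"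
    by (intro tendsto_intros tendsto_powr') (use p in \<open>auto simp: eventually_at_right_less less_imp_le intro!: eventually_mono[OF eventually_at_right_less]\<close>)
  then have "eventually (\<lambda>s. s ^ 4 + \<beta> * s powr (p - 1) < \<alpha>) (at_right 0)"
    by (rule order_tendstoD(2)) (use \<alpha> in simp)
  then obtain d where d: "d > 0" "\<And>s. 0 < s \<Longrightarrow> s < d \<Longrightarrow> s ^ 4 + \<beta> * s powr (p - 1) < \<alpha>"
    unfolding eventually_at_right_field by blast
  obtain R where R: "R > 1" "(w R)\<^sup>2 < d\<^sup>2" by (rule small_after[of "d\<^sup>2" 0]) (use d(1) in auto)
  have "w R < d" by (rule power2_less_imp_less[OF R(2)]) (use d(1) in simp)
  have "a r \<le> a R" if "r \<ge> R" for r
  proof (rule DERIV_nonpos_imp_nonincreasing[OF that])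
    fix t assume t: "R \<le> t"
    have wt: "0 < w t" "w t < d" using w_pos[of t] w_antimono[of R t] t R \<open>w R < d\<close> by auto
    have "nl (w t) \<le> 0" unfolding nonlin_eq[OF wt(1)] using wt d(2)[OF wt] by (simp add: mult_le_0_iff)
    then show "\<exists>y. (a has_real_derivative y) (at t) \<and> y \<le> 0"
      by (intro exI[of _ "t\<^sup>2 * nl (w t)"] conjI a_deriv) (use t R in \<open>auto intro: mult_nonneg_nonpos\<close>)
  qed
  with R show ?thesis by (intro that[of R "a R"]) auto
qed

text \<open>Equal to 3/(p+1) - 1/2, the coefficient that the power p leaves in 3 F(s) - s f(s)/2,
  where the critical power cancels. It is positive because p < 5.\<close>

definition c where "c = (5 - p) / (2 * (p + 1))"
definition h where "h s = c * \<beta> * s powr (p + 1) - \<alpha> * s\<^sup>2" for s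
definition P where "P r = r ^ 3 * E r + r\<^sup>2 * w r * w1 r / 2" for r

lemma h_eq: "s > 0 \<Longrightarrow> h s = s\<^sup>2 * (c * \<beta> * s powr (p - 1) - \<alpha>)"
  by (simp only: h_def powr_add_one_eq) (simp add: algebra_simps)

lemma c_pos: "c > 0" using p by (simp add: c_def)

text \<open>h(s)/s^2 is nondecreasing, so h changes sign at most once, from minus to plus. Along the
  decreasing w this means that P first grows and then declines.\<close>

lemma h_mono:
  assumes "0 < s" "s \<le> t" shows "h t \<le> 0 \<Longrightarrow> h s \<le> 0" "h s > 0 \<Longrightarrow> h s \<le> h t"
proof -
  have *: "c * \<beta> * s powr (p - 1) - \<alpha> \<le> c * \<beta> * t powr (p - 1) - \<alpha>"
    using assms p \<beta> c_pos by (intro diff_right_mono mult_left_mono powr_mono2) auto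
  show "h s \<le> 0" if "h t \<le> 0"
    using that * assms by (auto simp: h_eq mult_le_0_iff)
  show "h s \<le> h t" if "h s > 0"
  proof -
    have "c * \<beta> * s powr (p - 1) - \<alpha> > 0" using that assms by (simp add: h_eq zero_less_mult_iff)
    then show ?thesis using * assms unfolding h_eq[OF assms(1)] h_eq[OF less_le_trans[OF assms]]
      by (intro mult_mono power_mono) auto
  qed
qed

lemma pohozaev_identity: "s \<ge> 0 \<Longrightarrow> 3 * pot s - s * nl s / 2 = h s"
proof -
  assume "s \<ge> 0"
  then have "s * s powr p = s powr (p + 1)" by (cases "s = 0") (auto simp: powr_add)
  then have sn: "s * nl s = s ^ 6 + \<beta> * s powr (p + 1) - \<alpha> * s\<^sup>2"
    by (simp add: nonlin_def algebra_simps eval_nat_numeral)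
  have c: "c = 3 / (p + 1) - 1 / 2" using p by (simp add: c_def field_simps)
  have "3 * (A / 6 + y / (p + 1) - B / 2) - (A + y - B) / 2 = (3 / (p + 1) - 1 / 2) * y - B" for A B y :: real
    by (simp add: algebra_simps diff_divide_distrib add_divide_distrib)
  then show ?thesis unfolding sn h_def energy_potential_def c by (simp add: mult.assoc)
qed

lemma P_deriv: assumes "r > 0" shows "(P has_real_derivative r\<^sup>2 * h (w r)) (at r)"
proof -
  have p3: "((\<lambda>r. r ^ 3) has_real_derivative 3 * r\<^sup>2) (at r)" and p2: "((\<lambda>r. r\<^sup>2) has_real_derivative 2 * r) (at r)"
    by (auto intro!: derivative_eq_intros)
  note d = DERIV_add[OF DERIV_mult'[OF p3 E_deriv[OF assms]]
      DERIV_cdivide[OF DERIV_mult'[OF DERIV_mult'[OF p2 w_deriv[OF assms]] w1_deriv[OF assms]], of 2]]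
  have "(P has_real_derivative r\<^sup>2 * (3 * pot (w r) - w r * nl (w r) / 2)) (at r)"
    unfolding P_def[abs_def]
    by (rule DERIV_cong[OF d]) (use assms in \<open>simp add: E_def field_simps eval_nat_numeral\<close>)
  then show ?thesis using pohozaev_identity[of "w r"] w_pos[OF assms] by simp
qed

lemma P_lim: "(P \<longlongrightarrow> 0) (at_right 0)"
proof -
  have "(P \<longlongrightarrow> 0 ^ 3 * pot m + 0\<^sup>2 * m * 0 / 2) (at_right 0)"
    unfolding P_def[abs_def] by (intro tendsto_intros E_lim w_lim w1_tendsto_0) auto
  then show ?thesis by simp
qed

text \<open>In terms of a = -r^2 w1 the three contributions have size a^2/(2 r), r^3 |F(w)| and a
  w/2; as a is bounded and |F(w)| \<le> C w^2, all are small where r is large and r^3 w^2 is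
  small.\<close>

lemma P_small: assumes "\<epsilon> > 0" shows "\<exists>r>R. \<bar>P r\<bar> < \<epsilon>"
proof -
  obtain K R0 where K: "R0 > 0" "\<And>r. r \<ge> R0 \<Longrightarrow> a r \<le> K" using a_bounded by blast
  define C where "C = m ^ 4 / 6 + \<beta> * m powr (p - 1) / (p + 1) + \<alpha> / 2"
  have C: "C > 0" using m_pos \<alpha> \<beta> p unfolding C_def by (intro add_pos_pos) auto
  have Kpos: "K > 0" using K(2)[of R0] a_pos[OF K(1)] by simp
  \<comment> \<open>The first bound serves the term r^3 F(w), the second the term a w; the kinetic
    term is handled by r > 3 K^2/\<epsilon>.\<close>
  define \<delta> where "\<delta> = min (\<epsilon> / (3 * C)) ((\<epsilon> / (3 * K))\<^sup>2)"
  have "\<delta> > 0" using assms C Kpos by (simp add: \<delta>_def)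
  then obtain r where r: "r > max (max R R0) (3 * K\<^sup>2 / \<epsilon>)" "r > 1" "r ^ 3 * (w r)\<^sup>2 < \<delta>" "(w r)\<^sup>2 < \<delta>"
    using small_after by blast
  have rp: "r > 0" "r \<ge> R0" using r by auto
  have ar: "0 < a r" "a r \<le> K" using a_pos[OF rp(1)] K(2)[OF rp(2)] by auto
  have w1: "w1 r = - a r / r\<^sup>2" using rp by (simp add: a_def)
  have "r ^ 3 * ((w1 r)\<^sup>2 / 2) = (a r)\<^sup>2 / (2 * r)"
    unfolding w1 using rp by (simp add: field_simps eval_nat_numeral)
  also have "\<dots> \<le> K\<^sup>2 / (2 * r)" using ar rp by (intro divide_right_mono power_mono) auto
  also have "\<dots> < \<epsilon> / 3"
  proof -
    have "3 * K\<^sup>2 < \<epsilon> * r" using r assms by (simp add: field_simps)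
    moreover have "0 < \<epsilon> * r" using assms rp by simp
    ultimately have "3 * K\<^sup>2 < 2 * (\<epsilon> * r)" by linarith
    then show ?thesis using rp by (simp add: field_simps)
  qed
  finally have 1: "\<bar>r ^ 3 * ((w1 r)\<^sup>2 / 2)\<bar> < \<epsilon> / 3" using rp by simp
  have "\<bar>r ^ 3 * pot (w r)\<bar> \<le> r ^ 3 * (C * (w r)\<^sup>2)"
    unfolding abs_mult C_def using rp pot_abs_le[OF w_pos w_le_m, of r] by (simp add: mult_left_mono)
  also have "\<dots> = C * (r ^ 3 * (w r)\<^sup>2)" by simp
  also have "\<dots> < C * \<delta>" using r C by simp
  also have "\<dots> \<le> \<epsilon> / 3" using C by (simp add: \<delta>_def min_def field_simps)
  finally have 2: "\<bar>r ^ 3 * pot (w r)\<bar> < \<epsilon> / 3" .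
  have "(w r)\<^sup>2 < (\<epsilon> / (3 * K))\<^sup>2" using r(4) by (simp add: \<delta>_def)
  then have "w r < \<epsilon> / (3 * K)" by (rule power2_less_imp_less) (use assms Kpos in simp)
  then have "K * w r < \<epsilon> / 3" using Kpos by (simp add: field_simps)
  moreover have "\<bar>r\<^sup>2 * w r * w1 r / 2\<bar> = a r * w r / 2"
    unfolding w1 using rp w_pos[OF rp(1)] ar by (simp add: abs_mult)
  moreover have "a r * w r \<le> K * w r" using ar w_pos[OF rp(1)] by (intro mult_right_mono) auto
  moreover have "0 < a r * w r" using ar w_pos[OF rp(1)] by simp
  ultimately have 3: "\<bar>r\<^sup>2 * w r * w1 r / 2\<bar> < \<epsilon> / 3" by linarith
  have "P r = r ^ 3 * ((w1 r)\<^sup>2 / 2) + r ^ 3 * pot (w r) + r\<^sup>2 * w r * w1 r / 2"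
    by (simp add: P_def E_def algebra_simps)
  with 1 2 3 have "\<bar>P r\<bar> < \<epsilon>" by linarith
  with r show ?thesis by auto
qed

text \<open>If h(w r) \<le> 0, then P is nonincreasing from r on and comes arbitrarily close to 0
  far out, so P r \<ge> 0. Otherwise h(w t) \<ge> h(w r) for all t \<le> r, and integrating t^2 h(w
  t) from the origin produces the factor r^3/3.\<close>

lemma P_ge: assumes r: "r > 0" shows "P r \<ge> r ^ 3 * h (w r) / 3"
proof (cases "h (w r) \<le> 0")
  case True
  have anti: "P s \<le> P r" if "r \<le> s" for s
  proof (rule DERIV_nonpos_imp_nonincreasing[OF that])
    fix t assume t: "r \<le> t"
    have "h (w t) \<le> 0" using h_mono(1)[OF w_pos w_antimono True] r t by auto
    then show "\<exists>y. (P has_real_derivative y) (at t) \<and> y \<le> 0"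
      by (intro exI[of _ "t\<^sup>2 * h (w t)"] conjI P_deriv) (use t r in \<open>auto intro: mult_nonneg_nonpos\<close>)
  qed
  have "P r \<ge> 0"
  proof (rule ccontr)
    assume neg: "\<not> P r \<ge> 0"
    then obtain s where "s > r" "\<bar>P s\<bar> < - P r" using P_small[of "- P r" r] by auto
    with anti[of s] neg show False by simp
  qed
  moreover have "r ^ 3 * h (w r) / 3 \<le> 0" using True r by (simp add: mult_nonneg_nonpos)
  ultimately show ?thesis by simp
next
  case False
  define g where "g t = P t - t ^ 3 * h (w r) / 3" for t
  have "0 \<le> g r"
  proof (rule DERIV_nonneg_ge_limit[OF _ _ r])
    show "\<exists>y. (g has_real_derivative y) (at t) \<and> 0 \<le> y" if t: "0 < t" "t \<le> r" for t
    proof (intro exI conjI)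
      show "(g has_real_derivative t\<^sup>2 * h (w t) - t\<^sup>2 * h (w r)) (at t)"
        unfolding g_def[abs_def] by (rule derivative_eq_intros P_deriv t refl | simp)+
      have "h (w r) \<le> h (w t)" using False t r by (intro h_mono(2) w_pos w_antimono) auto
      then show "0 \<le> t\<^sup>2 * h (w t) - t\<^sup>2 * h (w r)" by (simp add: mult_left_mono)
    qed
    have "(g \<longlongrightarrow> 0 - 0 ^ 3 * h (w r) / 3) (at_right 0)"
      unfolding g_def[abs_def] by (intro tendsto_intros P_lim) auto
    then show "(g \<longlongrightarrow> 0) (at_right 0)" by simp
  qed
  then show ?thesis by (simp add: g_def)
qed

text \<open>The derivative of 1/w^2 with respect to r^2. For the Aubin-Talenti functions 1/w^2 is
  affine in r^2 and Q is constant, so monotonicity of Q is a one-sided comparison with them.\<close>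

definition Q where "Q r = - w1 r / (r * w r ^ 3)" for r

text \<open>Inserting the equation for the derivative of w1 and the Pohozaev identity for h leaves
  exactly the quantity whose sign \<open>P_ge\<close> controls.\<close>

lemma Q_deriv:
  assumes r: "r > 0"
  shows "(Q has_real_derivative 6 * (P r - r ^ 3 * h (w r) / 3) / (r ^ 4 * w r ^ 4)) (at r)"
proof -
  have wp: "w r > 0" by (rule w_pos[OF r])
  have w3: "((\<lambda>t. w t ^ 3) has_real_derivative 3 * (w r)\<^sup>2 * w1 r) (at r)"
    using w_deriv[OF r] by (auto intro!: derivative_eq_intros)
  note den = DERIV_mult'[OF DERIV_ident[of "at r"] w3]
  have nz: "r * w r ^ 3 \<noteq> 0" using r wp by simp
  have h: "h (w r) = 3 * pot (w r) - w r * nl (w r) / 2" using pohozaev_identity[of "w r"] wp by simp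
  show ?thesis
    unfolding Q_def[abs_def]
    by (rule DERIV_cong[OF DERIV_divide[OF DERIV_minus[OF w1_deriv[OF r]] den nz]])
       (use r wp in \<open>simp add: P_def E_def h field_simps eval_nat_numeral\<close>)
qed

text \<open>The limit of Q at the origin, since w1/r tends to -f(m)/3 there.\<close>

definition slope where "slope = nl m / (3 * m ^ 3)"

lemma Q_ge: assumes r: "r > 0" shows "Q r \<ge> slope"
proof (rule DERIV_nonneg_ge_limit[OF _ _ r])
  show "\<exists>y. (Q has_real_derivative y) (at t) \<and> 0 \<le> y" if "0 < t" for t
    by (rule exI, rule conjI, rule Q_deriv[OF that]) (use P_ge[OF that] that w_pos[OF that] in simp)
  have "((\<lambda>r. - (w1 r / r) / (w r ^ 3)) \<longlongrightarrow> - (- nl m / 3) / m ^ 3) (at_right 0)"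
    by (intro tendsto_intros w_lim w1_lim) (use m_pos in simp)
  then show "(Q \<longlongrightarrow> slope) (at_right 0)" by (simp add: Q_def[abs_def] slope_def)
qed

text \<open>The Pohozaev functional makes \<open>Q\<close> nondecreasing, so \<open>w\<close> lies below the Aubin--Talenti
  profile with the same value and the same second derivative at the origin.\<close>

lemma profile_bound: assumes r: "r > 0" shows "1 / (w r)\<^sup>2 \<ge> 1 / m\<^sup>2 + slope * r\<^sup>2"
proof -
  define g where "g t = 1 / (w t)\<^sup>2 - slope * t\<^sup>2" for t
  have "1 / m\<^sup>2 \<le> g r"
  proof (rule DERIV_nonneg_ge_limit[OF _ _ r])
    show "\<exists>y. (g has_real_derivative y) (at t) \<and> 0 \<le> y" if t: "0 < t" for t
    proof (intro exI conjI)
      have wp: "w t > 0" by (rule w_pos[OF t])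
      have w2: "((\<lambda>t. (w t)\<^sup>2) has_real_derivative 2 * w t * w1 t) (at t)"
        using w_deriv[OF t] by (auto intro!: derivative_eq_intros)
      have t2: "((\<lambda>t. slope * t\<^sup>2) has_real_derivative slope * (2 * t)) (at t)"
        by (auto intro!: derivative_eq_intros)
      have nz: "(w t)\<^sup>2 \<noteq> 0" using wp by simp
      show "(g has_real_derivative 2 * t * (Q t - slope)) (at t)"
        unfolding g_def[abs_def]
        by (rule DERIV_cong[OF DERIV_diff[OF DERIV_divide[OF DERIV_const[of 1] w2 nz] t2]])
           (use t wp in \<open>simp add: Q_def field_simps eval_nat_numeral\<close>)
      show "0 \<le> 2 * t * (Q t - slope)" using Q_ge[OF t] t by simp
    qed
    have "(g \<longlongrightarrow> 1 / m\<^sup>2 - slope * 0\<^sup>2) (at_right 0)"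
      unfolding g_def[abs_def] by (intro tendsto_intros w_lim) (use m_pos in auto)
    then show "(g \<longlongrightarrow> 1 / m\<^sup>2) (at_right 0)" by simp
  qed
  then show ?thesis by (simp add: g_def)
qed

end

section \<open>Regularity at the origin\<close>

lemma powr_le_add_power5:
  fixes s p :: real
  assumes "0 \<le> s" "1 \<le> p" "p \<le> 5"
  shows "s powr p \<le> s + s ^ 5"
proof (cases "s \<le> 1")
  case True
  have "s powr p \<le> s powr 1"
    by (rule powr_mono') (use assms True in auto)
  also have "s powr 1 = s" using assms by simp
  finally show ?thesis using zero_le_power[OF assms(1), of 5] by linarith
next
  case False
  then have "s powr p \<le> s powr 5" using assms by (intro powr_mono) auto
  also have "s powr 5 = s ^ 5" using False by simp
  finally show ?thesis using assms by simp
qed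

lemma nonlin_abs_le:
  assumes "0 \<le> s" "1 < p" "p < 5" "0 < \<alpha>"
  shows "nonlin p \<alpha> 1 s \<le> s + 2 * s ^ 5" "\<bar>nonlin p \<alpha> 1 s\<bar> \<le> (1 + \<alpha>) * s + 2 * s ^ 5"
proof -
  have 1: "s powr p \<le> s + s ^ 5" using powr_le_add_power5[of s p] assms by simp
  have 2: "0 \<le> s powr p" "0 \<le> s ^ 5" "0 \<le> \<alpha> * s" using assms by auto
  show "nonlin p \<alpha> 1 s \<le> s + 2 * s ^ 5" using 1 2 by (simp add: nonlin_def)
  show "\<bar>nonlin p \<alpha> 1 s\<bar> \<le> (1 + \<alpha>) * s + 2 * s ^ 5"
    using 1 2 assms(1) unfolding nonlin_def by (simp add: algebra_simps abs_le_iff)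
qed

lemma at_right_limit_of_mono:
  fixes g :: "real \<Rightarrow> real"
  assumes \<rho>: "\<rho> > 0" and mono: "\<And>r s. 0 < r \<Longrightarrow> r \<le> s \<Longrightarrow> s \<le> \<rho> \<Longrightarrow> g r \<le> g s"
    and bd: "\<And>r. 0 < r \<Longrightarrow> r \<le> \<rho> \<Longrightarrow> B \<le> g r"
  shows "\<exists>L. (g \<longlongrightarrow> L) (at_right 0)"
proof
  define L where "L = Inf (g ` {0<..\<rho>})"
  have bdd: "bdd_below (g ` {0<..\<rho>})" by (rule bdd_belowI2) (use bd in auto)
  show "(g \<longlongrightarrow> L) (at_right 0)"
  proof (rule order_tendstoI)
    fix y assume "y < L"
    then show "eventually (\<lambda>r. y < g r) (at_right 0)"
      unfolding eventually_at_right_field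
    proof (intro exI[of _ \<rho>] conjI \<rho> allI impI)
      fix r assume "0 < r" "r < \<rho>"
      then have "L \<le> g r" unfolding L_def by (intro cINF_lower bdd) auto
      with \<open>y < L\<close> show "y < g r" by simp
    qed
  next
    fix y assume "L < y"
    then obtain s where s: "0 < s" "s \<le> \<rho>" "g s < y"
      unfolding L_def using cInf_lessD[of "g ` {0<..\<rho>}" y] \<rho> by auto
    then show "eventually (\<lambda>r. g r < y) (at_right 0)"
      unfolding eventually_at_right_field
    proof (intro exI[of _ s] conjI s(1) allI impI)
      fix r assume "0 < r" "r < s"
      then have "g r \<le> g s" using s(2) by (intro mono) auto
      with s(3) show "g r < y" by simp
    qed
  qed
qed

context radial_weak_solution
begin

text \<open>The comparison functions \<open>r powr (-1/4)\<close> and \<open>r powr (-3/4)\<close> both satisfy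
  \<open>- \<Delta> \<Phi> = 3/16 r\<^sup>-\<^sup>2 \<Phi>\<close>, and \<open>V = o(r powr (-1/2))\<close> lies strictly between them.\<close>

lemma bounded_by_weak_singularity:
  assumes V: "\<And>r. r > 0 \<Longrightarrow> (V has_real_derivative - flux r / r\<^sup>2) (at r)"
    and flux: "\<And>r. r > 0 \<Longrightarrow> (flux has_real_derivative r\<^sup>2 * nonlin p \<alpha> 1 (V r)) (at r)"
    and V0: "\<And>r. r > 0 \<Longrightarrow> V r \<ge> 0"
  shows "\<exists>\<rho> C. 0 < \<rho> \<and> \<rho> \<le> 1 \<and> 0 < C \<and> (\<forall>r. 0 < r \<longrightarrow> r \<le> \<rho> \<longrightarrow> V r \<le> C * r powr (-1/4))"
proof -
  \<comment> \<open>The value 1/8 leads to V \<le> 1/(4 sqrt r) near 0, hence to r^2 V^4 \<le>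
    1/256.\<close>
  obtain b where b: "b > 0" "\<And>r. 0 < r \<Longrightarrow> r < b \<Longrightarrow> \<bar>V r - V b\<bar> \<le> (1/8) / sqrt r"
    using oscillation_bound[OF V, of "1/8"] by auto
  \<comment> \<open>Three requirements: the oscillation estimate applies, r^2 \<le> 1/64 for the
    linear term, and sqrt r (V b + 1) \<le> 1/8 to absorb the constant V b.\<close>
  define \<rho> where "\<rho> = min (b / 2) (min (1/8) ((1 / (8 * (V b + 1)))\<^sup>2))"
  have Vb: "V b \<ge> 0" using V0 b by simp
  have \<rho>: "0 < \<rho>" "\<rho> < b" "\<rho> \<le> 1/8" using b Vb by (auto simp: \<rho>_def)
  have half: "V r \<le> (1/4) / sqrt r" if r: "0 < r" "r \<le> \<rho>" for r
  proof -
    have "r \<le> (1 / (8 * (V b + 1)))\<^sup>2" using r by (simp add: \<rho>_def)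
    then have "sqrt r \<le> 1 / (8 * (V b + 1))" using Vb by (intro real_le_lsqrt) auto
    then have "V b + 1 \<le> (1/8) / sqrt r" using Vb r by (simp add: field_simps)
    moreover have "\<bar>V r - V b\<bar> \<le> (1/8) / sqrt r" using r \<rho> by (intro b) auto
    ultimately have "V r \<le> (1/8) / sqrt r + (1/8) / sqrt r" by linarith
    then show ?thesis by simp
  qed
  \<comment> \<open>3/32 is half the constant 3/16 of the comparison functions; the spare factor
    turns K into K/2 in the bootstrap below.\<close>
  have rhs: "r\<^sup>2 * nonlin p \<alpha> 1 (V r) \<le> 3/32 * V r" if r: "0 < r" "r \<le> \<rho>" for r
  proof -
    have "(sqrt r * V r) \<le> 1/4" using half[OF r] r by (simp add: field_simps)
    then have "(sqrt r * V r) ^ 4 \<le> (1/4) ^ 4" using V0[OF r(1)] r by (intro power_mono) auto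
    moreover have "sqrt r ^ 4 = r\<^sup>2" using r
      by (metis less_imp_le mult_2_right numeral_Bit0 power2_eq_square power_add real_sqrt_pow2)
    ultimately have "r\<^sup>2 * V r ^ 4 \<le> (1/4) ^ 4" by (simp only: power_mult_distrib)
    then have V4: "r\<^sup>2 * V r ^ 4 \<le> 1/256" by (simp add: power_divide)
    have "r\<^sup>2 \<le> (1/8)\<^sup>2" using r \<rho> by (intro power_mono) auto
    then have "r\<^sup>2 + 2 * (r\<^sup>2 * V r ^ 4) \<le> 3/32" using V4 by (simp add: power2_eq_square)
    then have "(r\<^sup>2 + 2 * (r\<^sup>2 * V r ^ 4)) * V r \<le> 3/32 * V r" using V0[OF r(1)] by (intro mult_right_mono)
    moreover have "r\<^sup>2 * nonlin p \<alpha> 1 (V r) \<le> r\<^sup>2 * (V r + 2 * V r ^ 5)"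
      using nonlin_abs_le(1)[OF V0[OF r(1)] p \<alpha>] by (intro mult_left_mono) auto
    moreover have "r\<^sup>2 * (V r + 2 * V r ^ 5) = (r\<^sup>2 + 2 * (r\<^sup>2 * V r ^ 4)) * V r"
      by (simp add: algebra_simps eval_nat_numeral)
    ultimately show ?thesis by linarith
  qed
  \<comment> \<open>The term with \<delta> is more singular than the known bound on V, so V/\<Phi>
    has a finite supremum; the resulting estimate with 2 V \<rho> does not depend on \<delta>, which
    is finally sent to 0.\<close>
  have main: "V r \<le> 2 * V \<rho> * (r powr (-1/4) + \<delta> * r powr (-3/4))" if \<delta>: "\<delta> > 0" and r: "0 < r" "r \<le> \<rho>" for \<delta> r
  proof -
    define \<Phi> where "\<Phi> r = r powr (-1/4) + \<delta> * r powr (-3/4)" for r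
    have \<Phi>1: "\<Phi> r \<ge> 1" if "0 < r" "r \<le> \<rho>" for r
    proof -
      have "1 powr (-1/4) \<le> r powr (-1/4)" using that \<rho> by (intro powr_mono2') auto
      then show ?thesis using \<delta> by (simp add: \<Phi>_def add_increasing2)
    qed
    have step: "V r \<le> (K / 2 + V \<rho>) * \<Phi> r" if K: "K \<ge> 0" "\<And>r. 0 < r \<Longrightarrow> r \<le> \<rho> \<Longrightarrow> V r \<le> K * \<Phi> r" and r: "0 < r" "r \<le> \<rho>" for K r
    proof -
      define G where "G r = 3/32 * K * (4/3 * r powr (3/4) + 4 * \<delta> * r powr (1/4))" for r
      have G: "(G has_real_derivative 3/32 * (K * \<Phi> r)) (at r)" if "r > 0" for r
      proof -
        have d1: "((\<lambda>r. r powr (3/4)) has_real_derivative 3/4 * r powr (-1/4)) (at r)"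
          using has_real_derivative_powr[OF that, of "3/4"] by simp
        have d2: "((\<lambda>r. r powr (1/4)) has_real_derivative 1/4 * r powr (-3/4)) (at r)"
          using has_real_derivative_powr[OF that, of "1/4"] by simp
        have "(G has_real_derivative 3/32 * K * (4/3 * (3/4 * r powr (-1/4)) + 4 * \<delta> * (1/4 * r powr (-3/4)))) (at r)"
          unfolding G_def[abs_def] by (intro DERIV_cmult DERIV_add d1 d2)
        then show ?thesis by (simp add: \<Phi>_def mult.assoc)
      qed
      have GL: "(G \<longlongrightarrow> 0) (at_right 0)"
      proof -
        have "(G \<longlongrightarrow> 3/32 * K * (4/3 * 0 powr (3/4) + 4 * \<delta> * 0 powr (1/4))) (at_right 0)"
          unfolding G_def[abs_def]
          by (intro tendsto_intros tendsto_powr') (auto intro!: eventually_mono[OF eventually_at_right_less[of 0]])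
        then show ?thesis by simp
      qed
      have flux_le: "flux r \<le> G r" if r: "0 < r" "r \<le> \<rho>" for r
      proof -
        have "flux r - G r \<le> 0"
        proof (rule DERIV_nonpos_le_limit[OF _ _ r(1), of "\<lambda>r. flux r - G r"])
          show "\<exists>y. ((\<lambda>r. flux r - G r) has_real_derivative y) (at t) \<and> y \<le> 0" if t: "0 < t" "t \<le> r" for t
          proof (intro exI conjI)
            show "((\<lambda>r. flux r - G r) has_real_derivative t\<^sup>2 * nonlin p \<alpha> 1 (V t) - 3/32 * (K * \<Phi> t)) (at t)"
              by (intro DERIV_diff flux G t)
            show "t\<^sup>2 * nonlin p \<alpha> 1 (V t) - 3/32 * (K * \<Phi> t) \<le> 0"
              using rhs[of t] K(2)[of t] t r by auto
          qed
          show "((\<lambda>r. flux r - G r) \<longlongrightarrow> 0) (at_right 0)"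
            using tendsto_diff[OF flux_tendsto_0 GL] by simp
        qed
        then show ?thesis by simp
      qed
      \<comment> \<open>H satisfies -r^2 H' = G, so G is its flux: comparing the fluxes and
        integrating from r to \<rho> compares V with H.\<close>
      define H where "H r = K / 2 * \<Phi> r" for r
      have H: "(H has_real_derivative - G r / r\<^sup>2) (at r)" if "r > 0" for r
      proof -
        have *: "r powr (3/4) / r\<^sup>2 = r powr (-5/4)" "r powr (1/4) / r\<^sup>2 = r powr (-7/4)"
          using that powr_diff[of r "3/4" 2] powr_diff[of r "1/4" 2] by simp_all
        have d1: "((\<lambda>r. r powr (-1/4)) has_real_derivative (-1/4) * r powr (-5/4)) (at r)"
          using has_real_derivative_powr[OF that, of "-1/4"] by simp
        have d2: "((\<lambda>r. r powr (-3/4)) has_real_derivative (-3/4) * r powr (-7/4)) (at r)"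
          using has_real_derivative_powr[OF that, of "-3/4"] by simp
        have "(H has_real_derivative K / 2 * ((-1/4) * r powr (-5/4) + \<delta> * ((-3/4) * r powr (-7/4)))) (at r)"
          unfolding H_def[abs_def] \<Phi>_def by (intro DERIV_cmult DERIV_add d1 d2)
        moreover have "K / 2 * ((-1/4) * r powr (-5/4) + \<delta> * ((-3/4) * r powr (-7/4))) = - G r / r\<^sup>2"
          unfolding *[symmetric] using that by (simp add: G_def field_simps)
        ultimately show ?thesis by (rule DERIV_cong)
      qed
      have "V r - H r \<le> V \<rho> - H \<rho>"
      proof (rule DERIV_nonneg_imp_nondecreasing[OF r(2)])
        fix t assume t: "r \<le> t" "t \<le> \<rho>"
        then have "t > 0" using r by simp
        show "\<exists>y. ((\<lambda>r. V r - H r) has_real_derivative y) (at t) \<and> 0 \<le> y"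
        proof (intro exI conjI)
          show "((\<lambda>r. V r - H r) has_real_derivative - flux t / t\<^sup>2 - - G t / t\<^sup>2) (at t)"
            by (intro DERIV_diff V H \<open>t > 0\<close>)
          have "flux t / t\<^sup>2 \<le> G t / t\<^sup>2" by (intro divide_right_mono flux_le t \<open>t > 0\<close>) simp
          then show "0 \<le> - flux t / t\<^sup>2 - - G t / t\<^sup>2" by simp
        qed
      qed
      moreover have "H \<rho> \<ge> 0" using K(1) \<delta> by (simp add: H_def \<Phi>_def)
      moreover have "V \<rho> \<le> V \<rho> * \<Phi> r" using \<Phi>1[OF r] V0[OF \<rho>(1)] by (simp add: mult_le_cancel_left1)
      ultimately show ?thesis by (simp add: H_def algebra_simps)
    qed
    define S where "S = (\<lambda>r. V r / \<Phi> r) ` {0<..\<rho>}"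
    have \<Phi>p: "\<Phi> r > 0" if "0 < r" "r \<le> \<rho>" for r using \<Phi>1[OF that] by simp
    have bdd: "bdd_above S"
      unfolding S_def
    proof (rule bdd_aboveI2)
      fix r assume "r \<in> {0<..\<rho>}"
      then have r: "0 < r" "r \<le> \<rho>" by auto
      have "V r \<le> (1/4) / sqrt r" by (rule half[OF r])
      also have "\<dots> = 1/4 * r powr (-1/2)" using r by (simp add: powr_minus_divide powr_half_sqrt)
      also have "\<dots> \<le> 1/4 * r powr (-3/4)" using r \<rho> by (intro mult_left_mono powr_mono') auto
      also have "\<dots> = 1 / (4 * \<delta>) * (\<delta> * r powr (-3/4))" using \<delta> by simp
      also have "\<dots> \<le> 1 / (4 * \<delta>) * \<Phi> r" using \<delta> unfolding \<Phi>_def by (intro mult_left_mono) auto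
      finally show "V r / \<Phi> r \<le> 1 / (4 * \<delta>)" using \<Phi>p[OF r] by (simp add: divide_le_eq)
    qed
    define K where "K = Sup S"
    have K: "V r \<le> K * \<Phi> r" if "0 < r" "r \<le> \<rho>" for r
    proof -
      have "V r / \<Phi> r \<le> K" unfolding K_def using that by (intro cSup_upper bdd) (auto simp: S_def)
      then show ?thesis using \<Phi>p[OF that] by (simp add: divide_le_eq)
    qed
    have "K \<ge> 0"
    proof -
      have "0 \<le> V \<rho> / \<Phi> \<rho>" using V0[OF \<rho>(1)] \<Phi>p[of \<rho>] \<rho> by simp
      also have "\<dots> \<le> K" unfolding K_def using \<rho> by (intro cSup_upper bdd) (auto simp: S_def)
      finally show ?thesis .
    qed
    \<comment> \<open>As K is finite, this inequality can be solved for K.\<close>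
    have "K \<le> K / 2 + V \<rho>"
      unfolding K_def
    proof (rule cSup_least)
      show "S \<noteq> {}" using \<rho> by (auto simp: S_def)
      fix x assume "x \<in> S"
      then obtain r where r: "0 < r" "r \<le> \<rho>" "x = V r / \<Phi> r" by (auto simp: S_def)
      show "x \<le> Sup S / 2 + V \<rho>"
        using step[OF \<open>K \<ge> 0\<close> K r(1,2)] \<Phi>p[OF r(1,2)] by (simp add: r(3) divide_le_eq K_def)
    qed
    then have "K \<le> 2 * V \<rho>" by simp
    then have "K * \<Phi> r \<le> 2 * V \<rho> * \<Phi> r" using \<Phi>p[OF r] by (intro mult_right_mono) auto
    with K[OF r] show ?thesis by (simp add: \<Phi>_def)
  qed
  show ?thesis
  proof (rule exI[of _ \<rho>], rule exI[of _ "2 * V \<rho> + 1"], intro conjI allI impI)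
    show "V r \<le> (2 * V \<rho> + 1) * r powr (-1/4)" if r: "0 < r" "r \<le> \<rho>" for r
    proof -
      have "((\<lambda>\<delta>. 2 * V \<rho> * (r powr (-1/4) + \<delta> * r powr (-3/4))) \<longlongrightarrow> 2 * V \<rho> * (r powr (-1/4) + 0 * r powr (-3/4))) (at_right 0)"
        by (intro tendsto_intros)
      then have "V r \<le> 2 * V \<rho> * (r powr (-1/4) + 0 * r powr (-3/4))"
        by (rule tendsto_lowerbound)
           (rule eventually_mono[OF eventually_at_right_less[of 0]], erule main[OF _ r], simp)
      also have "\<dots> = 2 * V \<rho> * r powr (-1/4)" by simp
      also have "\<dots> \<le> (2 * V \<rho> + 1) * r powr (-1/4)" by (intro mult_right_mono) auto
      finally show ?thesis .
    qed
  qed (use \<rho> V0[OF \<rho>(1)] in auto)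
qed

text \<open>From V = O(r^(-1/4)) the source r^2 f(V) is O(r^(3/4)) and the flux is at most of order
  r^(7/4), so V' is bounded below by a multiple of -r^(-1/4). Adding a multiple of r^(3/4) makes V
  nondecreasing, which yields the limit m; l'Hospital's rule then gives flux/r^3.\<close>

lemma limit_at_origin:
  assumes V: "\<And>r. r > 0 \<Longrightarrow> (V has_real_derivative - flux r / r\<^sup>2) (at r)"
    and flux: "\<And>r. r > 0 \<Longrightarrow> (flux has_real_derivative r\<^sup>2 * nonlin p \<alpha> 1 (V r)) (at r)"
    and V0: "\<And>r. r > 0 \<Longrightarrow> V r \<ge> 0"
  obtains m where "(V \<longlongrightarrow> m) (at_right 0)"
    "((\<lambda>r. - flux r / r\<^sup>2 / r) \<longlongrightarrow> - nonlin p \<alpha> 1 m / 3) (at_right 0)"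
proof -
  obtain \<rho> C where \<rho>: "0 < \<rho>" "\<rho> \<le> 1" "C > 0" and VC: "\<And>r. 0 < r \<Longrightarrow> r \<le> \<rho> \<Longrightarrow> V r \<le> C * r powr (-1/4)"
    using bounded_by_weak_singularity[OF V flux V0] by blast
  define B where "B = (1 + \<alpha>) * C + 2 * C ^ 5"
  have B: "B > 0" using \<alpha> \<rho> by (simp add: B_def add_pos_pos)
  have rhs: "\<bar>r\<^sup>2 * nonlin p \<alpha> 1 (V r)\<bar> \<le> B * r powr (3/4)" if r: "0 < r" "r \<le> \<rho>" for r
  proof -
    have "\<bar>nonlin p \<alpha> 1 (V r)\<bar> \<le> (1 + \<alpha>) * V r + 2 * V r ^ 5"
      using nonlin_abs_le(2)[OF V0[OF r(1)] p \<alpha>] .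
    also have "\<dots> \<le> (1 + \<alpha>) * (C * r powr (-1/4)) + 2 * (C * r powr (-1/4)) ^ 5"
      using VC[OF r] V0[OF r(1)] \<alpha> by (intro add_mono mult_left_mono power_mono) auto
    also have "(C * r powr (-1/4)) ^ 5 = C ^ 5 * r powr (-5/4)"
      using r by (simp add: power_mult_distrib powr_power)
    also have "(1 + \<alpha>) * (C * r powr (-1/4)) \<le> (1 + \<alpha>) * (C * r powr (-5/4))"
      using r \<rho> \<alpha> by (intro mult_left_mono powr_mono') auto
    finally have "\<bar>nonlin p \<alpha> 1 (V r)\<bar> \<le> B * r powr (-5/4)" by (simp add: B_def algebra_simps)
    then have "\<bar>r\<^sup>2 * nonlin p \<alpha> 1 (V r)\<bar> \<le> r\<^sup>2 * (B * r powr (-5/4))"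
      by (simp add: abs_mult mult_left_mono)
    also have "\<dots> = B * (r powr 2 * r powr (-5/4))" using r by simp
    also have "\<dots> = B * r powr (3/4)" by (simp only: powr_add[symmetric]) simp
    finally show ?thesis .
  qed
  have d7: "((\<lambda>r. r powr (7/4)) has_real_derivative 7/4 * r powr (3/4)) (at r)" if "r > 0" for r
    using has_real_derivative_powr[OF that, of "7/4"] by simp
  have d3: "((\<lambda>r. r powr (3/4)) has_real_derivative 3/4 * r powr (-1/4)) (at r)" if "r > 0" for r
    using has_real_derivative_powr[OF that, of "3/4"] by simp
  have lim7: "((\<lambda>r. B * r powr (7/4)) \<longlongrightarrow> B * 0 powr (7/4)) (at_right 0)"
    by (intro tendsto_intros tendsto_powr') (auto intro!: eventually_mono[OF eventually_at_right_less[of 0]])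
  have flux_le: "flux r \<le> B * r powr (7/4)" if r: "0 < r" "r \<le> \<rho>" for r
  proof -
    have "flux r - B * r powr (7/4) \<le> 0"
    proof (rule DERIV_nonpos_le_limit[OF _ _ r(1), of "\<lambda>r. flux r - B * r powr (7/4)"])
      show "\<exists>y. ((\<lambda>r. flux r - B * r powr (7/4)) has_real_derivative y) (at t) \<and> y \<le> 0" if t: "0 < t" "t \<le> r" for t
      proof (intro exI conjI)
        show "((\<lambda>r. flux r - B * r powr (7/4)) has_real_derivative t\<^sup>2 * nonlin p \<alpha> 1 (V t) - B * (7/4 * t powr (3/4))) (at t)"
          by (intro DERIV_diff DERIV_cmult flux d7 t)
        have "0 \<le> B * t powr (3/4)" using B by simp
        then show "t\<^sup>2 * nonlin p \<alpha> 1 (V t) - B * (7/4 * t powr (3/4)) \<le> 0"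
          using rhs[of t] t r by auto
      qed
      show "((\<lambda>r. flux r - B * r powr (7/4)) \<longlongrightarrow> 0) (at_right 0)"
        using tendsto_diff[OF flux_tendsto_0 lim7] by simp
    qed
    then show ?thesis by simp
  qed
  define g where "g r = V r + 4/3 * B * r powr (3/4)" for r
  have gm: "g r \<le> g s" if rs: "0 < r" "r \<le> s" "s \<le> \<rho>" for r s
  proof (rule DERIV_nonneg_imp_nondecreasing[OF rs(2)])
    fix t assume t: "r \<le> t" "t \<le> s"
    then have tp: "t > 0" using rs by simp
    show "\<exists>y. (g has_real_derivative y) (at t) \<and> 0 \<le> y"
    proof (intro exI conjI)
      show "(g has_real_derivative - flux t / t\<^sup>2 + 4/3 * B * (3/4 * t powr (-1/4))) (at t)"
        unfolding g_def[abs_def] by (intro DERIV_add DERIV_cmult V d3 tp)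
      have "flux t / t\<^sup>2 \<le> B * t powr (7/4) / t\<^sup>2" using flux_le[of t] tp t rs by (intro divide_right_mono) auto
      also have "\<dots> = B * (t powr (7/4) / t powr 2)" using tp by simp
      also have "\<dots> = B * t powr (-1/4)" by (simp only: powr_diff[symmetric]) simp
      finally show "0 \<le> - flux t / t\<^sup>2 + 4/3 * B * (3/4 * t powr (-1/4))" by simp
    qed
  qed
  have gb: "0 \<le> g r" if "0 < r" for r using V0[OF that] B by (simp add: g_def)
  obtain m where m: "(g \<longlongrightarrow> m) (at_right 0)"
    using at_right_limit_of_mono[OF \<rho>(1), of g 0] gm gb by blast
  have "((\<lambda>r. 4/3 * B * r powr (3/4)) \<longlongrightarrow> 4/3 * B * 0 powr (3/4)) (at_right 0)"
    by (intro tendsto_intros tendsto_powr') (auto intro!: eventually_mono[OF eventually_at_right_less[of 0]])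
  from tendsto_diff[OF m this] have Vm: "(V \<longlongrightarrow> m) (at_right 0)" by (simp add: g_def)
  have ev: "\<forall>\<^sub>F r in at_right 0. V r \<in> {0..}"
    by (auto intro!: eventually_mono[OF eventually_at_right_less[of 0]] V0)
  have "m \<ge> 0"
    by (rule tendsto_lowerbound[OF Vm]) (use ev in auto)
  have "((\<lambda>r. nonlin p \<alpha> 1 (V r)) \<longlongrightarrow> nonlin p \<alpha> 1 m) (at_right 0)"
    by (rule continuous_on_tendsto_compose[OF nonlin_continuous Vm _ ev]) (use \<open>m \<ge> 0\<close> p in auto)
  then have n3: "((\<lambda>r. nonlin p \<alpha> 1 (V r) / 3) \<longlongrightarrow> nonlin p \<alpha> 1 m / 3) (at_right 0)"
    by (intro tendsto_intros) auto
  have pos: "eventually (\<lambda>r. r > 0) (at_right (0::real))" by (rule eventually_at_right_less)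
  have "((\<lambda>r. flux r / r ^ 3) \<longlongrightarrow> nonlin p \<alpha> 1 m / 3) (at_right 0)"
  proof (rule lhopital_right_0[OF flux_tendsto_0, where f'="\<lambda>r. r\<^sup>2 * nonlin p \<alpha> 1 (V r)" and g'="\<lambda>r. 3 * r\<^sup>2"])
    show "((\<lambda>r::real. r ^ 3) \<longlongrightarrow> 0) (at_right 0)" by (intro tendsto_eq_intros) auto
    show "\<forall>\<^sub>F r in at_right 0. ((\<lambda>r::real. r ^ 3) has_real_derivative 3 * r\<^sup>2) (at r)"
      by (intro always_eventually allI) (auto intro!: derivative_eq_intros)
    show "\<forall>\<^sub>F r in at_right 0. (flux has_real_derivative r\<^sup>2 * nonlin p \<alpha> 1 (V r)) (at r)"
      using pos by eventually_elim (rule flux)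
    show "((\<lambda>r. r\<^sup>2 * nonlin p \<alpha> 1 (V r) / (3 * r\<^sup>2)) \<longlongrightarrow> nonlin p \<alpha> 1 m / 3) (at_right 0)"
      by (rule Lim_transform_eventually[OF n3]) (use pos in eventually_elim, simp)
  qed (use pos in \<open>eventually_elim, simp\<close>)+
  then have "((\<lambda>r. - (flux r / r ^ 3)) \<longlongrightarrow> - (nonlin p \<alpha> 1 m / 3)) (at_right 0)"
    by (rule tendsto_minus)
  then have "((\<lambda>r. - flux r / r\<^sup>2 / r) \<longlongrightarrow> - nonlin p \<alpha> 1 m / 3) (at_right 0)"
    by (simp add: eval_nat_numeral mult_ac)
  with Vm show ?thesis by (rule that)
qed

text \<open>Otherwise r^2 U^2 \<ge> \<epsilon>/r almost everywhere far out, and the L^2 norm would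
  diverge logarithmically.\<close>

lemma decay_at_infinity:
  assumes UV: "AE r in lborel. r > 0 \<longrightarrow> U r = V r" and \<epsilon>: "\<epsilon> > 0"
  shows "\<exists>r>R. r ^ 3 * (V r)\<^sup>2 < \<epsilon>"
proof (rule ccontr)
  assume "\<not> ?thesis"
  then have ge: "r ^ 3 * (V r)\<^sup>2 \<ge> \<epsilon>" if "r > R" for r using that by auto
  define R1 where "R1 = max R 1"
  define I where "I = (\<integral>r. polar_density r * (U r)\<^sup>2 \<partial>lborel)"
  have bound: "4 * pi * \<epsilon> * (ln T - ln R1) \<le> I" if T: "T \<ge> R1" for T
  proof -
    have FTC: "has_bochner_integral lborel (\<lambda>r. 4 * pi * \<epsilon> / r * indicator {R1..T} r) (4 * pi * \<epsilon> * ln T - 4 * pi * \<epsilon> * ln R1)"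
    proof (rule has_bochner_integral_FTC_Icc_real[OF T])
      show "((\<lambda>r. 4 * pi * \<epsilon> * ln r) has_real_derivative 4 * pi * \<epsilon> / r) (at r)" if "R1 \<le> r" for r
        using that by (auto simp: R1_def intro!: derivative_eq_intros)
      show "isCont (\<lambda>r. 4 * pi * \<epsilon> / r) r" if "R1 \<le> r" for r
        using that by (intro continuous_intros) (auto simp: R1_def)
    qed
    have "(\<integral>r. 4 * pi * \<epsilon> / r * indicator {R1..T} r \<partial>lborel) \<le> I"
      unfolding I_def
    proof (rule integral_mono_AE[OF integrable.intros[OF FTC] U_square_integrable])
      have "AE r in lborel. r \<noteq> R1" by (rule AE_lborel_singleton)
      with UV show "AE r in lborel. 4 * pi * \<epsilon> / r * indicator {R1..T} r \<le> polar_density r * (U r)\<^sup>2"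
      proof eventually_elim
        case (elim r)
        show ?case
        proof (cases "r \<in> {R1..T}")
          case True
          then have r: "r > 0" "r > R" "U r = V r" using elim by (auto simp: R1_def)
          have "\<epsilon> / r \<le> r\<^sup>2 * (V r)\<^sup>2" using ge[OF r(2)] r(1) by (simp add: field_simps eval_nat_numeral)
          from mult_left_mono[OF this, of "4 * pi"]
          show ?thesis using True r by (simp add: polar_density_def mult.assoc)
        qed simp
      qed
    qed
    then show ?thesis using has_bochner_integral_integral_eq[OF FTC] by (simp add: right_diff_distrib)
  qed
  define T where "T = exp (\<bar>I\<bar> / (4 * pi * \<epsilon>) + ln R1 + 1)"
  have "ln T = \<bar>I\<bar> / (4 * pi * \<epsilon>) + ln R1 + 1" by (simp add: T_def)
  moreover have "T \<ge> R1"
  proof -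
    have "exp (ln R1) \<le> T" unfolding T_def exp_le_cancel_iff using \<epsilon> by simp
    then show ?thesis by (simp add: R1_def)
  qed
  ultimately have "4 * pi * \<epsilon> * (\<bar>I\<bar> / (4 * pi * \<epsilon>) + 1) \<le> I" using bound[of T] by simp
  moreover have "4 * pi * \<epsilon> * (\<bar>I\<bar> / (4 * pi * \<epsilon>)) = \<bar>I\<bar>" using \<epsilon> by simp
  ultimately have "\<bar>I\<bar> + 4 * pi * \<epsilon> \<le> I" by (simp only: distrib_left mult_1_right)
  moreover have "4 * pi * \<epsilon> > 0" using \<epsilon> by simp
  ultimately show False by linarith
qed

lemma regular_representative:
  obtains V V1 m where "AE r in lborel. r > 0 \<longrightarrow> U r = V r" "radial_ode p \<alpha> 1 m V V1"
proof -
  obtain V where V: "AE r in lborel. r > 0 \<longrightarrow> U r = V r"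
    "\<And>r. r > 0 \<Longrightarrow> (V has_real_derivative - flux r / r\<^sup>2) (at r)"
    "\<And>r. r > 0 \<Longrightarrow> (flux has_real_derivative r\<^sup>2 * nonlin p \<alpha> 1 (V r)) (at r)"
    "\<And>r. r > 0 \<Longrightarrow> V r \<ge> 0"
    by (rule continuous_representative) blast
  obtain m where m: "(V \<longlongrightarrow> m) (at_right 0)"
    "((\<lambda>r. - flux r / r\<^sup>2 / r) \<longlongrightarrow> - nonlin p \<alpha> 1 m / 3) (at_right 0)"
    by (rule limit_at_origin[OF V(2-4)]) blast
  have "radial_ode p \<alpha> 1 m V (\<lambda>r. - flux r / r\<^sup>2)"
  proof
    fix r :: real assume r: "r > 0"
    have r2: "((\<lambda>r. r\<^sup>2) has_real_derivative 2 * r) (at r)" by (auto intro!: derivative_eq_intros)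
    show "((\<lambda>r. - flux r / r\<^sup>2) has_real_derivative - 2 * (- flux r / r\<^sup>2) / r - nonlin p \<alpha> 1 (V r)) (at r)"
      by (rule DERIV_cong[OF DERIV_divide[OF DERIV_minus[OF V(3)[OF r]] r2]])
         (use r in \<open>simp_all add: field_simps eval_nat_numeral\<close>)
  next
    fix R :: real
    obtain r where "max R 0 < r" "U r = V r"
      by (rule AE_pos_ex_in_interval[OF V(1), of "max R 0" "max R 0 + 1"]) auto
    then show "\<exists>r>R. V r \<noteq> 0" using U_pos[of r] by auto
  next
    show "\<exists>r>R. r ^ 3 * (V r)\<^sup>2 < \<epsilon>" if "\<epsilon> > 0" for \<epsilon> R
      by (rule decay_at_infinity[OF V(1) that])
  qed (use p \<alpha> V m in auto)
  with V(1) show ?thesis by (rule that)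
qed

end

section \<open>Comparison with the Aubin--Talenti profile\<close>

definition talenti :: "real \<Rightarrow> real" where "talenti r = (1 + r\<^sup>2 / 3) powr (-1/2)"
definition talenti' :: "real \<Rightarrow> real" where "talenti' r = - (r / 3) * talenti r ^ 3"

lemma talenti_pos [simp]: "talenti r > 0"
proof -
  have "1 + r\<^sup>2 / 3 > 0" by (simp add: add_pos_nonneg)
  then show ?thesis unfolding talenti_def by simp
qed

lemma talenti_power2: "(talenti r)\<^sup>2 = 1 / (1 + r\<^sup>2 / 3)"
proof -
  have *: "1 + r\<^sup>2 / 3 > 0" by (simp add: add_pos_nonneg)
  have "(talenti r)\<^sup>2 = (1 + r\<^sup>2 / 3) powr (-1)"
    unfolding talenti_def using * by (simp add: powr_power)
  also have "\<dots> = 1 / (1 + r\<^sup>2 / 3)" using * by (simp add: powr_minus_divide)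
  finally show ?thesis .
qed

lemma talenti_le: "talenti r \<le> 1" "r > 0 \<Longrightarrow> talenti r \<le> 2 / r"
proof -
  have *: "1 + r\<^sup>2 / 3 > 0" by (simp add: add_pos_nonneg)
  have "(talenti r)\<^sup>2 \<le> 1\<^sup>2" unfolding talenti_power2 using * by simp
  then show "talenti r \<le> 1" by (rule power2_le_imp_le) simp
  show "talenti r \<le> 2 / r" if "r > 0"
  proof (rule power2_le_imp_le)
    show "(talenti r)\<^sup>2 \<le> (2 / r)\<^sup>2" unfolding talenti_power2 using * that by (simp add: field_simps)
  qed (use that in simp)
qed

lemma talenti_deriv: "(talenti has_real_derivative talenti' r) (at r)"
proof -
  have *: "1 + r\<^sup>2 / 3 > 0" by (simp add: add_pos_nonneg)
  have d: "((\<lambda>r. 1 + r\<^sup>2 / 3) has_real_derivative 2 * r / 3) (at r)"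
    by (auto intro!: derivative_eq_intros)
  have "(talenti has_real_derivative (-1/2) * (1 + r\<^sup>2 / 3) powr (-1/2 - 1) * (2 * r / 3)) (at r)"
    unfolding talenti_def[abs_def]
    using DERIV_fun_powr[OF d *, of "-1/2"] by simp
  moreover have "(1 + r\<^sup>2 / 3) powr (-1/2 - 1) = talenti r ^ 3"
    unfolding talenti_def using * by (simp add: powr_power)
  ultimately show ?thesis by (simp add: talenti'_def mult.commute)
qed

lemma talenti'_deriv:
  assumes r: "r > 0"
  shows "(talenti' has_real_derivative - 2 * talenti' r / r - talenti r ^ 5) (at r)"
proof -
  have d3: "((\<lambda>r. talenti r ^ 3) has_real_derivative 3 * (talenti r)\<^sup>2 * talenti' r) (at r)"
    using talenti_deriv[of r] by (auto intro!: derivative_eq_intros)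
  have dr: "((\<lambda>r. - (r / 3)) has_real_derivative - (1 / 3)) (at r)"
    by (auto intro!: derivative_eq_intros)
  have *: "1 + r\<^sup>2 / 3 > 0" by (simp add: add_pos_nonneg)
  have "talenti r ^ 5 * (1 + r\<^sup>2 / 3) = talenti r ^ 3 * ((talenti r)\<^sup>2 * (1 + r\<^sup>2 / 3))"
    by (simp add: eval_nat_numeral)
  also have "(talenti r)\<^sup>2 * (1 + r\<^sup>2 / 3) = 1" unfolding talenti_power2 using * by simp
  finally have key: "r * r * talenti r ^ 5 = 3 * (talenti r ^ 3 - talenti r ^ 5)"
    by (simp add: algebra_simps power2_eq_square)
  have "- (r / 3) * (3 * (talenti r)\<^sup>2 * talenti' r) + - (1 / 3) * talenti r ^ 3
    = (r * r * talenti r ^ 5) / 3 - talenti r ^ 3 / 3"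
    by (simp add: talenti'_def eval_nat_numeral)
  also have "\<dots> = - 2 * talenti' r / r - talenti r ^ 5"
    unfolding key using r by (simp add: talenti'_def field_simps)
  finally show ?thesis
    using DERIV_mult'[OF dr d3] unfolding talenti'_def[abs_def] by (simp add: talenti'_def)
qed

lemma talenti_lims:
  "(talenti \<longlongrightarrow> 1) (at_right 0)" "(talenti' \<longlongrightarrow> 0) (at_right 0)"
proof -
  have "isCont talenti 0" using talenti_deriv by (rule DERIV_isCont)
  then show 1: "(talenti \<longlongrightarrow> 1) (at_right 0)"
    by (simp add: isCont_def talenti_def filterlim_at_split)
  have "(talenti' \<longlongrightarrow> - (0 / 3) * 1 ^ 3) (at_right 0)"
    unfolding talenti'_def[abs_def] by (intro tendsto_intros 1) simp
  then show "(talenti' \<longlongrightarrow> 0) (at_right 0)" by simp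
qed

lemma nn_integral_atLeast_le:
  fixes f :: "real \<Rightarrow> ennreal"
  assumes [measurable]: "f \<in> borel_measurable borel"
    and le: "\<And>n::nat. (\<integral>\<^sup>+r. f r * indicator {R..R + real n} r \<partial>lborel) \<le> C"
  shows "(\<integral>\<^sup>+r. f r * indicator {R..} r \<partial>lborel) \<le> C"
proof -
  have "(\<integral>\<^sup>+r. f r * indicator {R..} r \<partial>lborel) = emeasure (density lborel f) {R..}"
    by (simp add: emeasure_density)
  moreover have "{R..} = (\<Union>n. {R..R + real n})"
  proof (intro set_eqI iffI)
    fix x assume "x \<in> {R..}"
    then show "x \<in> (\<Union>n. {R..R + real n})"
      using real_arch_simple[of "x - R"] by (auto simp: algebra_simps)
  qed auto
  moreover have "emeasure (density lborel f) (\<Union>n. {R..R + real n}) = (SUP n. emeasure (density lborel f) {R..R + real n})"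
    by (rule SUP_emeasure_incseq[symmetric]) (auto simp: incseq_def)
  moreover have "(SUP n. emeasure (density lborel f) {R..R + real n}) \<le> C"
    by (rule SUP_least) (use le in \<open>simp add: emeasure_density\<close>)
  ultimately show ?thesis by simp
qed

text \<open>For m = 1 and \<alpha> \<le> 1/4 the slope (1 + \<beta> - \<alpha>)/3 is at least 1/4,
  so \<open>profile_bound\<close> gives 1/w^2 \<ge> r^2/4. This is the origin of the bound 2/r,
  uniform in the parameters.\<close>

locale normalized_radial_ode = radial_ode p \<alpha> \<beta> 1 w w1 for p \<alpha> \<beta> w w1 +
  assumes \<alpha>_le: "\<alpha> \<le> 1/4"
begin

lemma w_le: assumes "r > 0" shows "w r \<le> 1" "w r \<le> 2 / r"
proof -
  show "w r \<le> 1" by (rule w_le_m[OF assms])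
  have "slope \<ge> 1/4" using \<alpha>_le \<beta> by (simp add: slope_def nonlin_def)
  then have "1 / (w r)\<^sup>2 \<ge> r\<^sup>2 / 4"
    using profile_bound[OF assms] mult_right_mono[of "1/4" slope "r\<^sup>2"] by simp
  then have "(w r)\<^sup>2 \<le> (2 / r)\<^sup>2" using w_pos[OF assms] assms by (simp add: field_simps)
  then show "w r \<le> 2 / r" by (rule power2_le_imp_le) (use assms in simp)
qed

lemma lower_order_le: assumes "r > 0" shows "\<bar>\<beta> * w r powr p - \<alpha> * w r\<bar> \<le> (\<alpha> + \<beta>) * w r"
proof -
  have "w r powr p \<le> w r powr 1" using w_pos[OF assms] w_le(1)[OF assms] p by (intro powr_mono') auto
  then have "\<beta> * w r powr p \<le> \<beta> * w r" using \<beta> w_pos[OF assms] by simp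
  moreover have "0 \<le> \<beta> * w r powr p" "0 \<le> \<alpha> * w r" "0 \<le> \<beta> * w r" using \<beta> \<alpha> w_pos[OF assms] by auto
  ultimately show ?thesis by (simp add: distrib_right abs_le_iff)
qed

text \<open>Both profiles take values in [0, 1], where the fifth power has Lipschitz constant 5 and
  the lower-order terms are at most \<alpha> + \<beta>.\<close>

lemma nl_diff_le: assumes "r > 0" shows "\<bar>nl (w r) - talenti r ^ 5\<bar> \<le> 5 * \<bar>w r - talenti r\<bar> + (\<alpha> + \<beta>)"
proof -
  let ?a = "w r" and ?b = "talenti r"
  have ab: "0 \<le> ?a" "?a \<le> 1" "0 \<le> ?b" "?b \<le> 1"
    using w_pos[OF assms] w_le(1)[OF assms] talenti_le(1)[of r] less_imp_le[OF talenti_pos] by auto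
  have "?a ^ 5 - ?b ^ 5 = (?a - ?b) * (?a ^ 4 + ?a ^ 3 * ?b + ?a\<^sup>2 * ?b\<^sup>2 + ?a * ?b ^ 3 + ?b ^ 4)"
    by (simp add: algebra_simps eval_nat_numeral)
  moreover have "?a ^ 4 \<le> 1" "?b ^ 4 \<le> 1" "?a ^ 3 * ?b \<le> 1" "?a\<^sup>2 * ?b\<^sup>2 \<le> 1" "?a * ?b ^ 3 \<le> 1"
    using ab by (auto intro!: mult_le_one power_le_one)
  moreover have "0 \<le> ?a ^ 4" "0 \<le> ?b ^ 4" "0 \<le> ?a ^ 3 * ?b" "0 \<le> ?a\<^sup>2 * ?b\<^sup>2" "0 \<le> ?a * ?b ^ 3"
    using ab by auto
  ultimately have 1: "\<bar>?a ^ 5 - ?b ^ 5\<bar> \<le> \<bar>?a - ?b\<bar> * 5"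
    unfolding abs_mult by (simp only: abs_mult) (intro mult_left_mono; simp)
  have "(\<alpha> + \<beta>) * w r \<le> \<alpha> + \<beta>" using ab \<alpha> \<beta> by (intro mult_left_le) auto
  with lower_order_le[OF assms] have 2: "\<bar>\<beta> * w r powr p - \<alpha> * w r\<bar> \<le> \<alpha> + \<beta>" by linarith
  have "nl ?a - ?b ^ 5 = (?a ^ 5 - ?b ^ 5) + (\<beta> * w r powr p - \<alpha> * w r)" by (simp add: nonlin_def)
  with 1 2 show ?thesis by linarith
qed

text \<open>Gronwall's argument for the pair (w, w1). The singular friction term contributes -4
  e^2/r \<le> 0 and is dropped. Adding \<kappa>^2/7 inside Y makes the differential inequality
  homogeneous with rate 7.\<close>

lemma distance_to_talenti:
  assumes r: "r > 0"
  shows "(w r - talenti r)\<^sup>2 + (w1 r - talenti' r)\<^sup>2 \<le> (\<alpha> + \<beta>)\<^sup>2 * exp (7 * r)"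
proof -
  define \<kappa> where "\<kappa> = \<alpha> + \<beta>"
  define d where "d r = w r - talenti r" for r
  define e where "e r = w1 r - talenti' r" for r
  define Y where "Y r = ((d r)\<^sup>2 + (e r)\<^sup>2 + \<kappa>\<^sup>2 / 7) * exp (- 7 * r)" for r
  have "Y r \<le> \<kappa>\<^sup>2 / 7"
  proof (rule DERIV_nonpos_le_limit[OF _ _ r])
    fix t :: real assume t: "0 < t" "t \<le> r"
    let ?e' = "- 2 * e t / t - (nl (w t) - talenti t ^ 5)"
    have dd: "(d has_real_derivative e t) (at t)"
      unfolding d_def[abs_def] e_def by (intro DERIV_diff w_deriv talenti_deriv t)
    have de: "(e has_real_derivative ?e') (at t)"
      unfolding e_def[abs_def]
      by (rule DERIV_cong[OF DERIV_diff[OF w1_deriv[OF t(1)] talenti'_deriv[OF t(1)]]])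
         (use t in \<open>simp add: e_def field_simps\<close>)
    have d2: "((\<lambda>r. (d r)\<^sup>2 + (e r)\<^sup>2 + \<kappa>\<^sup>2 / 7) has_real_derivative 2 * d t * e t + 2 * e t * ?e') (at t)"
      using dd de by (auto intro!: derivative_eq_intros)
    have dx: "((\<lambda>r. exp (- 7 * r)) has_real_derivative - 7 * exp (- 7 * t)) (at t)"
      by (auto intro!: derivative_eq_intros)
    have le: "2 * d t * e t + 2 * e t * ?e' \<le> 7 * ((d t)\<^sup>2 + (e t)\<^sup>2 + \<kappa>\<^sup>2 / 7)"
    proof -
      have n: "\<bar>nl (w t) - talenti t ^ 5\<bar> \<le> 5 * \<bar>d t\<bar> + \<kappa>"
        using nl_diff_le[OF t(1)] by (simp add: d_def \<kappa>_def)
      have "2 * e t * ?e' = - 4 * (e t)\<^sup>2 / t - 2 * e t * (nl (w t) - talenti t ^ 5)"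
        by (simp add: algebra_simps power2_eq_square)
      also have "\<dots> \<le> 2 * \<bar>e t\<bar> * (5 * \<bar>d t\<bar> + \<kappa>)"
      proof -
        have "- 4 * (e t)\<^sup>2 / t \<le> 0" using t by simp
        moreover have "- 2 * e t * (nl (w t) - talenti t ^ 5) \<le> \<bar>- 2 * e t * (nl (w t) - talenti t ^ 5)\<bar>" by (rule abs_ge_self)
        moreover have "\<bar>- 2 * e t * (nl (w t) - talenti t ^ 5)\<bar> \<le> 2 * \<bar>e t\<bar> * (5 * \<bar>d t\<bar> + \<kappa>)"
          unfolding abs_mult using n by (simp add: mult_left_mono)
        ultimately show ?thesis by linarith
      qed
      finally have 1: "2 * e t * ?e' \<le> 2 * \<bar>e t\<bar> * (5 * \<bar>d t\<bar> + \<kappa>)" .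
      have 2: "2 * d t * e t \<le> 2 * \<bar>d t\<bar> * \<bar>e t\<bar>" using abs_ge_self[of "d t * e t"] by (simp add: abs_mult)
      \<comment> \<open>Young's inequality: 12 |d| |e| splits evenly into 6 d^2 + 6 e^2, and 2 |e|
        \<kappa> adds one more e^2; hence the rate 7.\<close>
      have "0 \<le> 6 * (\<bar>d t\<bar> - \<bar>e t\<bar>)\<^sup>2 + (\<bar>e t\<bar> - \<kappa>)\<^sup>2" by simp
      then have 3: "12 * (\<bar>d t\<bar> * \<bar>e t\<bar>) + 2 * (\<bar>e t\<bar> * \<kappa>) \<le> 6 * (d t)\<^sup>2 + 7 * (e t)\<^sup>2 + \<kappa>\<^sup>2"
        by (simp add: power2_diff algebra_simps)
      have "2 * d t * e t + 2 * e t * ?e' \<le> 12 * (\<bar>d t\<bar> * \<bar>e t\<bar>) + 2 * (\<bar>e t\<bar> * \<kappa>)"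
        using add_mono[OF 2 1] by (simp add: algebra_simps)
      also note 3
      also have "6 * (d t)\<^sup>2 + 7 * (e t)\<^sup>2 + \<kappa>\<^sup>2 \<le> 7 * ((d t)\<^sup>2 + (e t)\<^sup>2 + \<kappa>\<^sup>2 / 7)" by simp
      finally show ?thesis .
    qed
    show "\<exists>y. (Y has_real_derivative y) (at t) \<and> y \<le> 0"
    proof (intro exI conjI)
      show "(Y has_real_derivative (2 * d t * e t + 2 * e t * ?e' - 7 * ((d t)\<^sup>2 + (e t)\<^sup>2 + \<kappa>\<^sup>2 / 7)) * exp (- 7 * t)) (at t)"
        unfolding Y_def[abs_def]
        by (rule DERIV_cong[OF DERIV_mult[OF d2 dx]]) (simp add: algebra_simps)
      show "(2 * d t * e t + 2 * e t * ?e' - 7 * ((d t)\<^sup>2 + (e t)\<^sup>2 + \<kappa>\<^sup>2 / 7)) * exp (- 7 * t) \<le> 0"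
        using le by (intro mult_nonpos_nonneg) auto
    qed
  next
    have "(Y \<longlongrightarrow> ((1 - 1)\<^sup>2 + (0 - 0)\<^sup>2 + \<kappa>\<^sup>2 / 7) * exp (- 7 * 0)) (at_right 0)"
      unfolding Y_def[abs_def] d_def e_def
      by (intro tendsto_intros w_lim w1_tendsto_0 talenti_lims) auto
    then show "(Y \<longlongrightarrow> \<kappa>\<^sup>2 / 7) (at_right 0)" by simp
  qed
  then have "((d r)\<^sup>2 + (e r)\<^sup>2 + \<kappa>\<^sup>2 / 7) * exp (- 7 * r) * exp (7 * r) \<le> \<kappa>\<^sup>2 / 7 * exp (7 * r)"
    unfolding Y_def by (intro mult_right_mono) auto
  then have "(d r)\<^sup>2 + (e r)\<^sup>2 + \<kappa>\<^sup>2 / 7 \<le> \<kappa>\<^sup>2 / 7 * exp (7 * r)"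
    by (simp add: mult.assoc exp_add[symmetric])
  also have "\<dots> \<le> \<kappa>\<^sup>2 * exp (7 * r)" by simp
  finally have "(d r)\<^sup>2 + (e r)\<^sup>2 \<le> \<kappa>\<^sup>2 * exp (7 * r)" using zero_le_power2[of \<kappa>] by linarith
  then show ?thesis by (simp add: d_def e_def \<kappa>_def)
qed

section \<open>The function r w: size and total variation of its derivative\<close>

definition z where "z r = r * w r" for r
definition z1 where "z1 r = w r + r * w1 r" for r

lemma z_deriv: "r > 0 \<Longrightarrow> (z has_real_derivative z1 r) (at r)"
  unfolding z_def[abs_def] z1_def
  by (rule DERIV_cong[OF DERIV_mult'[OF DERIV_ident w_deriv]]) auto

lemma z1_deriv: "r > 0 \<Longrightarrow> (z1 has_real_derivative - r * nl (w r)) (at r)"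
  unfolding z1_def[abs_def]
  by (rule DERIV_cong[OF DERIV_add[OF w_deriv DERIV_mult'[OF DERIV_ident w1_deriv]]])
     (auto simp: field_simps)

lemma z_bounds: assumes "r > 0" shows "0 < z r" "z r \<le> 2"
  using w_pos[OF assms] w_le(2)[OF assms] assms by (auto simp: z_def field_simps)

text \<open>Everything is expressed through r w \<le> 2: r w^5 = (r w) w^4 \<le> 2 (2/R)^4, and the
  lower-order terms, at most (\<alpha> + \<beta>) w, give 2 (\<alpha> + \<beta>) after
  multiplication by r.\<close>

lemma z1_deriv_le:
  assumes "R \<ge> 1" "r \<ge> R"
  shows "\<bar>- r * nl (w r)\<bar> \<le> 32 / R ^ 4 + 2 * (\<alpha> + \<beta>)"
proof -
  have r: "r > 0" using assms by simp
  have z: "r * w r \<le> 2" "0 \<le> r * w r" using z_bounds[OF r] by (auto simp: z_def)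
  have "w r \<le> 2 / R" using w_le(2)[OF r] divide_left_mono[of R r 2] assms by force
  then have "w r ^ 4 \<le> (2 / R) ^ 4" using w_pos[OF r] by (intro power_mono) auto
  then have "(r * w r) * w r ^ 4 \<le> 2 * (2 / R) ^ 4" using z w_pos[OF r] by (intro mult_mono) auto
  then have 1: "r * w r ^ 5 \<le> 32 / R ^ 4" by (simp add: power_divide eval_nat_numeral mult_ac)
  have "r * \<bar>\<beta> * w r powr p - \<alpha> * w r\<bar> \<le> r * ((\<alpha> + \<beta>) * w r)"
    using lower_order_le[OF r] r by (intro mult_left_mono) auto
  also have "\<dots> = (\<alpha> + \<beta>) * (r * w r)" by simp
  also have "\<dots> \<le> (\<alpha> + \<beta>) * 2" using z \<alpha> \<beta> by (intro mult_left_mono) auto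
  finally have 2: "r * \<bar>\<beta> * w r powr p - \<alpha> * w r\<bar> \<le> 2 * (\<alpha> + \<beta>)" by simp
  have "\<bar>nl (w r)\<bar> \<le> w r ^ 5 + \<bar>\<beta> * w r powr p - \<alpha> * w r\<bar>"
    unfolding nonlin_def using w_pos[OF r] zero_le_power[of "w r" 5] by linarith
  then have "r * \<bar>nl (w r)\<bar> \<le> r * (w r ^ 5 + \<bar>\<beta> * w r powr p - \<alpha> * w r\<bar>)" using r by (intro mult_left_mono) auto
  with 1 2 show ?thesis using r by (simp add: abs_mult distrib_left)
qed

text \<open>Landau's inequality: \<open>z\<close> is bounded and \<open>z''\<close> is small, hence \<open>z'\<close> is small.\<close>

lemma z1_le:
  assumes R: "R \<ge> 1" and r: "r \<ge> R"
  shows "\<bar>z1 r\<bar> \<le> 2 / R + 32 / R ^ 3 + 2 * (\<alpha> + \<beta>) * R"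
proof -
  \<comment> \<open>Window of length R: an increment of z of at most 2 provides a point s with |z'|
    \<le> 2/R, and between r and s the derivative drifts by at most R times the bound on
    z''.\<close>
  obtain s where s: "r < s" "s < r + R" "z (r + R) - z r = (r + R - r) * z1 s"
    using MVT2[of r "r + R" z z1] z_deriv R r by (metis less_add_same_cancel1 less_le_trans zero_less_one)
  have "\<bar>z (r + R) - z r\<bar> \<le> 2" using z_bounds[of r] z_bounds[of "r + R"] R r by simp
  then have "R * \<bar>z1 s\<bar> \<le> 2" using s(3) R by (simp add: abs_mult)
  then have 1: "\<bar>z1 s\<bar> \<le> 2 / R" using R by (simp add: field_simps)
  obtain t where t: "r < t" "t < s" "z1 s - z1 r = (s - r) * (- t * nl (w t))"
    using MVT2[of r s z1 "\<lambda>t. - t * nl (w t)"] z1_deriv R r s by (metis less_le_trans zero_less_one)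
  have "\<bar>z1 s - z1 r\<bar> = (s - r) * \<bar>- t * nl (w t)\<bar>" unfolding t(3) abs_mult using s by simp
  also have "\<dots> \<le> R * (32 / R ^ 4 + 2 * (\<alpha> + \<beta>))"
    using s t R r z1_deriv_le[OF R, of t] by (intro mult_mono) auto
  also have "\<dots> = 32 / R ^ 3 + 2 * (\<alpha> + \<beta>) * R" using R by (simp add: field_simps eval_nat_numeral)
  finally show ?thesis using 1 by linarith
qed

text \<open>f(s)/s is increasing in s and w is decreasing, so f(w) stays negative once it is
  negative. As z'' = -r f(w), the function z is first concave and then convex.\<close>

lemma nl_neg_after:
  assumes "r > 0" "s \<ge> r" "nl (w r) < 0" shows "nl (w s) < 0"
proof -
  have pos: "0 < w s" "w s \<le> w r" "0 < w r" using w_pos w_antimono assms by auto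
  have "w s ^ 4 \<le> w r ^ 4" using pos by (intro power_mono) auto
  moreover have "\<beta> * w s powr (p - 1) \<le> \<beta> * w r powr (p - 1)"
    using pos \<beta> p by (intro mult_left_mono powr_mono2) auto
  moreover have "w r ^ 4 + \<beta> * w r powr (p - 1) - \<alpha> < 0"
    using assms(3) pos by (simp add: nonlin_eq mult_less_0_iff)
  ultimately have "w s ^ 4 + \<beta> * w s powr (p - 1) - \<alpha> < 0" by linarith
  then show ?thesis using pos by (simp only: nonlin_eq mult_pos_neg)
qed

lemma z1_MVT:
  assumes "0 < s" "s < t" obtains x where "s < x" "x < t" "z1 t - z1 s = (t - s) * (- x * nl (w x))"
  using MVT2[of s t z1 "\<lambda>t. - t * nl (w t)"] z1_deriv assms by (metis less_le_trans)

lemma z_MVT: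
  assumes "0 < s" "s < t" obtains x where "s < x" "x < t" "z t - z s = (t - s) * z1 x"
  using MVT2[of s t z z1] z_deriv assms by (metis less_le_trans)

lemma z1_increasing_after:
  assumes "0 < s" "s < t" "nl (w s) < 0" shows "z1 s < z1 t"
proof -
  obtain x where x: "s < x" "x < t" "z1 t - z1 s = (t - s) * (- x * nl (w x))"
    using z1_MVT[OF assms(1,2)] by blast
  have "nl (w x) < 0" using nl_neg_after[OF assms(1) _ assms(3)] x by simp
  then have "0 < (t - s) * (- x * nl (w x))" using x assms by (intro mult_pos_pos mult_neg_neg) auto
  with x show ?thesis by simp
qed

lemma nl_neg_if_z1_increases:
  assumes "0 < s" "s < t" "z1 s < z1 t" shows "nl (w t) < 0"
proof -
  obtain x where x: "s < x" "x < t" "z1 t - z1 s = (t - s) * (- x * nl (w x))"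
    using z1_MVT[OF assms(1,2)] by blast
  with assms have "0 < (t - s) * (- x * nl (w x))" by simp
  then have "nl (w x) < 0" using x assms by (simp add: zero_less_mult_iff mult_less_0_iff)
  then show ?thesis using nl_neg_after[of x t] x assms by simp
qed

text \<open>A return of z' to a positive value would have to happen in the convex regime, after
  which z grows at least linearly and leaves (0, 2]. The distance 3/z' is chosen to produce a growth
  of 3 > 2.\<close>

lemma z1_nonpos_after:
  assumes "0 < s" "s < t" "z1 s \<le> 0" shows "z1 t \<le> 0"
proof (rule ccontr)
  assume "\<not> z1 t \<le> 0"
  then have t: "z1 t > 0" by simp
  have neg: "nl (w t) < 0" using nl_neg_if_z1_increases[OF assms(1,2)] t assms by simp
  have "t > 0" using assms by simp
  define T where "T = t + 3 / z1 t"
  have "t < T" using t by (simp add: T_def)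
  obtain x where x: "t < x" "x < T" "z T - z t = (T - t) * z1 x" using z_MVT[OF \<open>t > 0\<close> \<open>t < T\<close>] by blast
  have "z1 t < z1 x" using z1_increasing_after[OF \<open>t > 0\<close> x(1) neg] .
  then have "(T - t) * z1 t \<le> (T - t) * z1 x" using x by (intro mult_left_mono) auto
  moreover have "(T - t) * z1 t = 3" using t by (simp add: T_def)
  ultimately have "z T - z t \<ge> 3" using x by simp
  moreover have "z T \<le> 2" "z t > 0" using z_bounds[of T] z_bounds[of t] \<open>t > 0\<close> \<open>t < T\<close> by auto
  ultimately show False by simp
qed

lemma z1_neg_after:
  assumes "0 < s" "s < t" "z1 s < 0" shows "z1 t < 0"
proof (rule ccontr)
  assume "\<not> z1 t < 0"
  then have t: "z1 t \<ge> 0" by simp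
  have "nl (w t) < 0" using nl_neg_if_z1_increases[OF assms(1,2)] t assms by simp
  then have "z1 t < z1 (t + 1)" using z1_increasing_after[of t "t + 1"] assms by simp
  moreover have "z1 (t + 1) \<le> 0" using z1_nonpos_after[of s "t + 1"] assms by simp
  ultimately show False using t by simp
qed

lemma z1_isCont: "r > 0 \<Longrightarrow> isCont z1 r"
  by (rule DERIV_isCont[OF z1_deriv])

lemma z1_variation_piece:
  assumes R: "0 < R" "R \<le> T" and \<sigma>: "\<bar>\<sigma>\<bar> = 1" "\<And>r. R \<le> r \<Longrightarrow> r \<le> T \<Longrightarrow> 0 \<le> \<sigma> * z1 r"
  shows "(\<integral>\<^sup>+r. ennreal (\<bar>z1 r\<bar> * indicator {R..T} r) \<partial>lborel) \<le> 2"
proof -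
  have eq: "\<bar>z1 r\<bar> * indicator {R..T} r = \<sigma> * z1 r * indicator {R..T} r" for r
  proof (cases "r \<in> {R..T}")
    case True
    then have "\<bar>\<sigma> * z1 r\<bar> = \<sigma> * z1 r" using \<sigma>(2) by simp
    then show ?thesis using \<sigma>(1) by (simp add: abs_mult)
  qed simp
  have F: "has_bochner_integral lborel (\<lambda>r. \<sigma> * z1 r * indicator {R..T} r) (\<sigma> * z T - \<sigma> * z R)"
  proof (rule has_bochner_integral_FTC_Icc_real[OF R(2)])
    show "((\<lambda>r. \<sigma> * z r) has_real_derivative \<sigma> * z1 r) (at r)" if "R \<le> r" for r
      using that R by (intro DERIV_cmult z_deriv) auto
    show "isCont (\<lambda>r. \<sigma> * z1 r) r" if "R \<le> r" for r
      using that R by (intro isCont_mult continuous_const z1_isCont) auto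
  qed
  have "(\<integral>\<^sup>+r. ennreal (\<bar>z1 r\<bar> * indicator {R..T} r) \<partial>lborel) = ennreal (\<sigma> * z T - \<sigma> * z R)"
    unfolding eq
    by (subst nn_integral_eq_integral[OF integrable.intros[OF F]])
       (use \<sigma> has_bochner_integral_integral_eq[OF F] in \<open>auto split: split_indicator\<close>)
  also have "\<sigma> * z T - \<sigma> * z R \<le> 2"
    using z_bounds[of R] z_bounds[of T] R \<sigma>(1) by (auto simp: abs_if split: if_splits)
  then have "ennreal (\<sigma> * z T - \<sigma> * z R) \<le> ennreal 2" by (rule ennreal_leI)
  finally show ?thesis by simp
qed

text \<open>By \<open>z1_nonpos_after\<close> and \<open>z1_neg_after\<close> the derivative changes
  sign at most once, from plus to minus; each of the two monotone pieces contributes at most 2, the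
  range of z.\<close>

lemma z1_variation:
  assumes R: "0 < R" "R \<le> T"
  shows "(\<integral>\<^sup>+r. ennreal (\<bar>z1 r\<bar> * indicator {R..T} r) \<partial>lborel) \<le> 4"
proof -
  have "2 \<le> (4::ennreal)" by simp
  consider "\<forall>r. R \<le> r \<longrightarrow> r \<le> T \<longrightarrow> 0 \<le> z1 r" | "\<forall>r. R \<le> r \<longrightarrow> r \<le> T \<longrightarrow> z1 r \<le> 0"
    | s t where "R \<le> s" "s \<le> T" "z1 s < 0" "R \<le> t" "t \<le> T" "z1 t > 0" by force
  then show ?thesis
  proof cases
    case 1
    then show ?thesis using z1_variation_piece[OF R, of 1] \<open>2 \<le> 4\<close> by (auto intro: order_trans)
  next
    case 2
    then show ?thesis using z1_variation_piece[OF R, of "-1"] \<open>2 \<le> 4\<close> by (auto intro: order_trans)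
  next
    case 3
    have "t < s" using z1_nonpos_after[of s t] 3 R by (cases "s = t") force+
    have "continuous_on {t..s} z1"
      using 3 R by (intro continuous_at_imp_continuous_on ballI z1_isCont) auto
    then obtain c where c: "t \<le> c" "c \<le> s" "z1 c = 0"
      using IVT2'[of z1 s 0 t] 3 \<open>t < s\<close> by auto
    have c0: "0 < c" "R \<le> c" "c \<le> T" using c 3 R by auto
    have L: "0 \<le> 1 * z1 r" if "R \<le> r" "r \<le> c" for r
      using z1_neg_after[of r c] that c R by (cases "r = c") force+
    have U: "0 \<le> - 1 * z1 r" if "c \<le> r" "r \<le> T" for r
      using z1_nonpos_after[of c r] that c c0 by (cases "r = c") auto
    have m: "(\<lambda>r. \<bar>z1 r\<bar> * indicator {x..y} r) \<in> borel_measurable borel" if "0 < x" for x y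
    proof -
      have "(\<lambda>r. indicator {x..y} r *\<^sub>R \<bar>z1 r\<bar>) \<in> borel_measurable borel"
        by (rule borel_measurable_continuous_on_indicator)
           (use that in \<open>auto intro!: continuous_at_imp_continuous_on isCont_rabs z1_isCont\<close>)
      then show ?thesis by (simp add: mult.commute)
    qed
    have "(\<integral>\<^sup>+r. ennreal (\<bar>z1 r\<bar> * indicator {R..T} r) \<partial>lborel)
      \<le> (\<integral>\<^sup>+r. ennreal (\<bar>z1 r\<bar> * indicator {R..c} r) + ennreal (\<bar>z1 r\<bar> * indicator {c..T} r) \<partial>lborel)"
      by (intro nn_integral_mono) (auto split: split_indicator)
    also have "\<dots> = (\<integral>\<^sup>+r. ennreal (\<bar>z1 r\<bar> * indicator {R..c} r) \<partial>lborel) + (\<integral>\<^sup>+r. ennreal (\<bar>z1 r\<bar> * indicator {c..T} r) \<partial>lborel)"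
      by (intro nn_integral_add measurable_compose[OF m measurable_ennreal, simplified]) (use R c0 m in auto)
    also have "\<dots> \<le> 2 + 2"
      using L U by (intro add_mono z1_variation_piece[of _ _ 1] z1_variation_piece[of _ _ "-1"] R c0) auto
    finally show ?thesis by simp
  qed
qed

lemma z1_square_integral:
  assumes R: "R \<ge> 1"
  shows "(\<integral>\<^sup>+r. ennreal ((z1 r)\<^sup>2 * indicator {R..} r) \<partial>lborel) \<le> ennreal (4 * (2 / R + 32 / R ^ 3 + 2 * (\<alpha> + \<beta>) * R))"
proof -
  define \<eta> where "\<eta> = 2 / R + 32 / R ^ 3 + 2 * (\<alpha> + \<beta>) * R"
  have \<eta>: "\<eta> \<ge> 0" using R \<alpha> \<beta> by (simp add: \<eta>_def)
  have m: "(\<lambda>r. (z1 r)\<^sup>2 * indicator {R..} r) \<in> borel_measurable borel"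
  proof -
    have "(\<lambda>r. indicator {R..} r *\<^sub>R (z1 r)\<^sup>2) \<in> borel_measurable borel"
      by (rule borel_measurable_continuous_on_indicator)
         (use R in \<open>auto intro!: continuous_at_imp_continuous_on isCont_power z1_isCont\<close>)
    then show ?thesis by (simp add: mult.commute)
  qed
  have ma: "(\<lambda>r. \<bar>z1 r\<bar> * indicator {R..T} r) \<in> borel_measurable borel" for T
  proof -
    have "(\<lambda>r. indicator {R..T} r *\<^sub>R \<bar>z1 r\<bar>) \<in> borel_measurable borel"
      by (rule borel_measurable_continuous_on_indicator)
         (use R in \<open>auto intro!: continuous_at_imp_continuous_on isCont_rabs z1_isCont\<close>)
    then show ?thesis by (simp add: mult.commute)
  qed
  have piece: "(\<integral>\<^sup>+r. ennreal ((z1 r)\<^sup>2 * indicator {R..} r) * indicator {R..R + real n} r \<partial>lborel) \<le> ennreal (4 * \<eta>)" for n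
  proof -
    have "(\<integral>\<^sup>+r. ennreal ((z1 r)\<^sup>2 * indicator {R..} r) * indicator {R..R + real n} r \<partial>lborel)
      \<le> (\<integral>\<^sup>+r. ennreal \<eta> * ennreal (\<bar>z1 r\<bar> * indicator {R..R + real n} r) \<partial>lborel)"
    proof (intro nn_integral_mono)
      fix r
      have "(z1 r)\<^sup>2 \<le> \<eta> * \<bar>z1 r\<bar>" if "R \<le> r"
        using mult_right_mono[OF z1_le[OF R that], of "\<bar>z1 r\<bar>"] by (simp add: \<eta>_def power2_eq_square abs_mult_self_eq)
      then show "ennreal ((z1 r)\<^sup>2 * indicator {R..} r) * indicator {R..R + real n} r
          \<le> ennreal \<eta> * ennreal (\<bar>z1 r\<bar> * indicator {R..R + real n} r)"
        using \<eta> by (auto simp: ennreal_mult[symmetric] split: split_indicator intro: ennreal_leI)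
    qed
    also have "\<dots> = ennreal \<eta> * (\<integral>\<^sup>+r. ennreal (\<bar>z1 r\<bar> * indicator {R..R + real n} r) \<partial>lborel)"
      by (rule nn_integral_cmult) (use ma in simp)
    also have "\<dots> \<le> ennreal \<eta> * ennreal 4"
      using z1_variation[of R "R + real n"] R by (intro mult_left_mono) auto
    also have "\<dots> = ennreal (4 * \<eta>)" using \<eta> by (subst ennreal_mult[symmetric]) (auto simp: mult.commute)
    finally show ?thesis .
  qed
  have "(\<integral>\<^sup>+r. ennreal ((z1 r)\<^sup>2 * indicator {R..} r) * indicator {R..} r \<partial>lborel) \<le> ennreal (4 * \<eta>)"
    by (rule nn_integral_atLeast_le) (use m piece in auto)
  moreover have "ennreal ((z1 r)\<^sup>2 * indicator {R..} r) * indicator {R..} r = ennreal ((z1 r)\<^sup>2 * indicator {R..} r)" for r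
    by (auto split: split_indicator)
  ultimately show ?thesis by (simp add: \<eta>_def)
qed

end

lemma nn_integral_inverse_square:
  assumes "R > 0" "c \<ge> 0"
  shows "(\<integral>\<^sup>+r. ennreal (c / r\<^sup>2 * indicator {R..} r) \<partial>lborel) = ennreal (c / R)"
proof -
  have "(\<integral>\<^sup>+r. ennreal (c / r\<^sup>2) * indicator {R..} r \<partial>lborel) = ennreal (0 - - c / R)"
  proof (rule nn_integral_FTC_atLeast)
    show "((\<lambda>r. - c / r) has_real_derivative c / r\<^sup>2) (at r)" if "R \<le> r" for r
      using that assms by (auto intro!: derivative_eq_intros simp: power2_eq_square)
    show "((\<lambda>r. - c / r) \<longlongrightarrow> 0) at_top"
      by (rule tendsto_divide_0[OF tendsto_const]) (simp add: filterlim_at_top_imp_at_infinity filterlim_ident)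
  qed (use assms in auto)
  moreover have "ennreal (c / r\<^sup>2) * indicator {R..} r = ennreal (c / r\<^sup>2 * indicator {R..} r)" for r
    by (auto split: split_indicator)
  ultimately show ?thesis by simp
qed

lemma nn_integral_power_tail:
  assumes "R > 0" "c \<ge> 0" "q > 3"
  shows "(\<integral>\<^sup>+r. ennreal (c * r powr (2 - q) * indicator {R..} r) \<partial>lborel) = ennreal (c * R powr (3 - q) / (q - 3))"
proof -
  have "(\<integral>\<^sup>+r. ennreal (c * r powr (2 - q)) * indicator {R..} r \<partial>lborel) = ennreal (0 - - (c * R powr (3 - q) / (q - 3)))"
  proof (rule nn_integral_FTC_atLeast)
    show "((\<lambda>r. - (c * r powr (3 - q) / (q - 3))) has_real_derivative c * r powr (2 - q)) (at r)" if "R \<le> r" for r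
    proof -
      have "((\<lambda>r. r powr (3 - q)) has_real_derivative (3 - q) * r powr (3 - q - 1)) (at r)"
        using that assms by (intro has_real_derivative_powr) auto
      from DERIV_minus[OF DERIV_cdivide[OF DERIV_cmult[OF this, of c], of "q - 3"]]
      show ?thesis by (rule DERIV_cong) (use assms in \<open>simp add: field_simps\<close>)
    qed
    have "((\<lambda>r. - (c * r powr (3 - q) / (q - 3))) \<longlongrightarrow> - (c * 0 / (q - 3))) at_top"
      using assms by (intro tendsto_intros tendsto_neg_powr filterlim_ident) auto
    then show "((\<lambda>r. - (c * r powr (3 - q) / (q - 3))) \<longlongrightarrow> 0) at_top" by simp
  qed (use assms in auto)
  moreover have "ennreal (c * r powr (2 - q)) * indicator {R..} r = ennreal (c * r powr (2 - q) * indicator {R..} r)" for r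
    by (auto split: split_indicator)
  ultimately show ?thesis by simp
qed

section \<open>Explicit error bounds, inside and outside the ball of radius R\<close>

context normalized_radial_ode
begin

lemma distance_on_ball:
  assumes "0 < r" "r \<le> R"
  shows "\<bar>w r - talenti r\<bar> \<le> (\<alpha> + \<beta>) * exp (4 * R)" "\<bar>w1 r - talenti' r\<bar> \<le> (\<alpha> + \<beta>) * exp (4 * R)"
proof -
  have "(w r - talenti r)\<^sup>2 + (w1 r - talenti' r)\<^sup>2 \<le> (\<alpha> + \<beta>)\<^sup>2 * exp (7 * r)" by (rule distance_to_talenti[OF assms(1)])
  also have "\<dots> \<le> (\<alpha> + \<beta>)\<^sup>2 * exp (4 * R + 4 * R)" using assms by (intro mult_left_mono) auto
  also have "\<dots> = ((\<alpha> + \<beta>) * exp (4 * R))\<^sup>2" by (simp only: exp_add power2_eq_square mult_ac)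
  finally have *: "(w r - talenti r)\<^sup>2 + (w1 r - talenti' r)\<^sup>2 \<le> ((\<alpha> + \<beta>) * exp (4 * R))\<^sup>2" .
  have nn: "0 \<le> (\<alpha> + \<beta>) * exp (4 * R)" using \<alpha> \<beta> by simp
  have "(w r - talenti r)\<^sup>2 \<le> ((\<alpha> + \<beta>) * exp (4 * R))\<^sup>2" "(w1 r - talenti' r)\<^sup>2 \<le> ((\<alpha> + \<beta>) * exp (4 * R))\<^sup>2"
    using * zero_le_power2[of "w r - talenti r"] zero_le_power2[of "w1 r - talenti' r"] by linarith+
  then show "\<bar>w r - talenti r\<bar> \<le> (\<alpha> + \<beta>) * exp (4 * R)" "\<bar>w1 r - talenti' r\<bar> \<le> (\<alpha> + \<beta>) * exp (4 * R)"
    using nn by (auto intro: abs_le_square_iff[THEN iffD2, of _ "(\<alpha> + \<beta>) * exp (4 * R)", simplified abs_of_nonneg[OF nn]])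
qed

text \<open>The squared gradient error up to the factor 4 pi. The first term covers the ball of
  radius R. The factor 16 is 4, from splitting r w1 = z1 - w, times 4, the total variation of z; it
  multiplies the Landau bound on z1. The last term is the integral of the remainder 32/r^2.\<close>

definition gradient_error :: "real \<Rightarrow> real" where
  "gradient_error R = R ^ 3 * ((\<alpha> + \<beta>) * exp (4 * R))\<^sup>2 + (16 * (2 / R + 32 / R ^ 3 + 2 * (\<alpha> + \<beta>) * R) + 32 / R)"

lemma gradient_distance:
  assumes R: "R \<ge> 1"
  shows "(\<integral>\<^sup>+r. ennreal (polar_density r * (w1 r - talenti' r)\<^sup>2) \<partial>lborel) \<le> ennreal (4 * pi * gradient_error R)"
proof -
  define \<kappa> where "\<kappa> = (\<alpha> + \<beta>) * exp (4 * R)"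
  define \<eta> where "\<eta> = 2 / R + 32 / R ^ 3 + 2 * (\<alpha> + \<beta>) * R"
  have \<eta>: "\<eta> \<ge> 0" using R \<alpha> \<beta> by (simp add: \<eta>_def)
  let ?f1 = "\<lambda>r. R\<^sup>2 * \<kappa>\<^sup>2 * indicator {0..R} r" and ?f2 = "\<lambda>r. 4 * ((z1 r)\<^sup>2 * indicator {R..} r)"
    and ?f3 = "\<lambda>r. 32 / r\<^sup>2 * indicator {R..} r"
  have m2: "(\<lambda>r. (z1 r)\<^sup>2 * indicator {R..} r) \<in> borel_measurable borel"
  proof -
    have "(\<lambda>r. indicator {R..} r *\<^sub>R (z1 r)\<^sup>2) \<in> borel_measurable borel"
      by (rule borel_measurable_continuous_on_indicator)
         (use R in \<open>auto intro!: continuous_at_imp_continuous_on isCont_power z1_isCont\<close>)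
    then show ?thesis by (simp add: mult.commute)
  qed
  \<comment> \<open>Here r w1 = z1 - w with w \<le> 2/r; for the limit profile the explicit
    derivative together with talenti \<le> 2/r gives the same bound 8/r^2.\<close>
  have tail: "r\<^sup>2 * (w1 r - talenti' r)\<^sup>2 \<le> 4 * (z1 r)\<^sup>2 + 32 / r\<^sup>2" if "r \<ge> R" for r
  proof -
    have r: "r > 0" using that R by simp
    have sq: "(x - y)\<^sup>2 \<le> 2 * x\<^sup>2 + 2 * y\<^sup>2" for x y :: real
      using zero_le_power2[of "x + y"] by (simp add: power2_eq_square algebra_simps)
    have ww: "(w r)\<^sup>2 \<le> 4 / r\<^sup>2"
      using power_mono[OF w_le(2)[OF r], of 2] w_pos[OF r] by (simp add: power_divide)
    have "(r * w1 r)\<^sup>2 = (z1 r - w r)\<^sup>2" by (simp add: z1_def)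
    also have "\<dots> \<le> 2 * (z1 r)\<^sup>2 + 2 * (w r)\<^sup>2" by (rule sq)
    finally have 1: "(r * w1 r)\<^sup>2 \<le> 2 * (z1 r)\<^sup>2 + 8 / r\<^sup>2" using ww by simp
    have "(r * talenti' r)\<^sup>2 = (r ^ 4 / 9) * talenti r ^ 6" by (simp add: talenti'_def power2_eq_square eval_nat_numeral)
    also have "\<dots> \<le> (r ^ 4 / 9) * (2 / r) ^ 6"
      using talenti_le(2)[OF r] r less_imp_le[OF talenti_pos] by (intro mult_left_mono power_mono) auto
    also have "\<dots> \<le> 8 / r\<^sup>2" using r by (simp add: field_simps eval_nat_numeral)
    finally have 2: "(r * talenti' r)\<^sup>2 \<le> 8 / r\<^sup>2" .
    have "r\<^sup>2 * (w1 r - talenti' r)\<^sup>2 = (r * w1 r - r * talenti' r)\<^sup>2" by (simp add: power_mult_distrib[symmetric] algebra_simps)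
    also have "\<dots> \<le> 2 * (r * w1 r)\<^sup>2 + 2 * (r * talenti' r)\<^sup>2" by (rule sq)
    finally show ?thesis using 1 2 by simp
  qed
  have pw: "polar_density r * (w1 r - talenti' r)\<^sup>2 \<le> 4 * pi * (?f1 r + ?f2 r + ?f3 r)" for r
  proof -
    have n: "0 \<le> ?f1 r" "0 \<le> ?f2 r" "0 \<le> ?f3 r" by auto
    consider "r \<le> 0" | "0 < r" "r < R" | "r \<ge> R" by linarith
    then have "indicator {0..} r * (r\<^sup>2 * (w1 r - talenti' r)\<^sup>2) \<le> ?f1 r + ?f2 r + ?f3 r"
    proof cases
      case 1
      then have "indicator {0..} r * (r\<^sup>2 * (w1 r - talenti' r)\<^sup>2) = 0" by (auto split: split_indicator)
      then show ?thesis using n by linarith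
    next
      case 2
      have "\<bar>w1 r - talenti' r\<bar>\<^sup>2 \<le> \<kappa>\<^sup>2" using distance_on_ball(2)[of r R] 2 unfolding \<kappa>_def by (intro power_mono) auto
      then have "(w1 r - talenti' r)\<^sup>2 \<le> \<kappa>\<^sup>2" by simp
      moreover have "r\<^sup>2 \<le> R\<^sup>2" using 2 by (intro power_mono) auto
      ultimately have "r\<^sup>2 * (w1 r - talenti' r)\<^sup>2 \<le> R\<^sup>2 * \<kappa>\<^sup>2" by (intro mult_mono) auto
      then show ?thesis using 2 by simp
    next
      case 3
      then have "indicator {0..} r * (r\<^sup>2 * (w1 r - talenti' r)\<^sup>2) \<le> ?f2 r + ?f3 r" using tail[OF 3] R by simp
      then show ?thesis using n(1) by linarith
    qed
    from mult_left_mono[OF this, of "4 * pi"] show ?thesis by (simp add: polar_density_def mult_ac)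
  qed
  have "(\<integral>\<^sup>+r. ennreal (polar_density r * (w1 r - talenti' r)\<^sup>2) \<partial>lborel)
      \<le> (\<integral>\<^sup>+r. ennreal (4 * pi) * (ennreal (?f1 r) + (ennreal 4 * ennreal ((z1 r)\<^sup>2 * indicator {R..} r) + ennreal (?f3 r))) \<partial>lborel)"
  proof (intro nn_integral_mono)
    fix r
    have "ennreal (4 * pi) * (ennreal (?f1 r) + (ennreal 4 * ennreal ((z1 r)\<^sup>2 * indicator {R..} r) + ennreal (?f3 r))) = ennreal (4 * pi * (?f1 r + ?f2 r + ?f3 r))"
      by (subst ennreal_mult[symmetric], simp, simp, subst ennreal_plus[symmetric], simp, simp,
          subst ennreal_plus[symmetric], simp, simp, subst ennreal_mult[symmetric]) (auto simp: add.assoc)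
    then show "ennreal (polar_density r * (w1 r - talenti' r)\<^sup>2) \<le> ennreal (4 * pi) * (ennreal (?f1 r) + (ennreal 4 * ennreal ((z1 r)\<^sup>2 * indicator {R..} r) + ennreal (?f3 r)))"
      using ennreal_leI[OF pw[of r]] by simp
  qed
  also have "\<dots> = ennreal (4 * pi) * ((\<integral>\<^sup>+r. ennreal (?f1 r) \<partial>lborel) + (ennreal 4 * (\<integral>\<^sup>+r. ennreal ((z1 r)\<^sup>2 * indicator {R..} r) \<partial>lborel) + (\<integral>\<^sup>+r. ennreal (?f3 r) \<partial>lborel)))"
    using m2 by (subst nn_integral_cmult, simp, subst nn_integral_add, simp, simp, subst nn_integral_add, simp, simp, subst nn_integral_cmult) auto
  also have "\<dots> \<le> ennreal (4 * pi) * (ennreal (R\<^sup>2 * \<kappa>\<^sup>2 * R) + (ennreal 4 * ennreal (4 * \<eta>) + ennreal (32 / R)))"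
  proof (intro mult_left_mono add_mono)
    have "(\<integral>\<^sup>+r. ennreal (?f1 r) \<partial>lborel) = (\<integral>\<^sup>+r. ennreal (R\<^sup>2 * \<kappa>\<^sup>2) * indicator {0..R} r \<partial>lborel)"
      by (intro nn_integral_cong) (auto split: split_indicator)
    also have "\<dots> = ennreal (R\<^sup>2 * \<kappa>\<^sup>2) * ennreal R" using R by (subst nn_integral_cmult_indicator) auto
    also have "\<dots> = ennreal (R\<^sup>2 * \<kappa>\<^sup>2 * R)" using R by (subst ennreal_mult[symmetric]) auto
    finally show "(\<integral>\<^sup>+r. ennreal (?f1 r) \<partial>lborel) \<le> ennreal (R\<^sup>2 * \<kappa>\<^sup>2 * R)" by simp
    show "(\<integral>\<^sup>+r. ennreal ((z1 r)\<^sup>2 * indicator {R..} r) \<partial>lborel) \<le> ennreal (4 * \<eta>)"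
      unfolding \<eta>_def by (rule z1_square_integral[OF R])
    show "(\<integral>\<^sup>+r. ennreal (?f3 r) \<partial>lborel) \<le> ennreal (32 / R)"
      using nn_integral_inverse_square[of R 32] R by simp
  qed auto
  also have "\<dots> = ennreal (4 * pi * (R\<^sup>2 * \<kappa>\<^sup>2 * R + (4 * (4 * \<eta>) + 32 / R)))"
    using R \<eta> by (subst ennreal_mult[symmetric], simp, simp, subst ennreal_plus[symmetric], simp, simp,
          subst ennreal_plus[symmetric], simp, simp, subst ennreal_mult[symmetric]) auto
  also have "R\<^sup>2 * \<kappa>\<^sup>2 * R + (4 * (4 * \<eta>) + 32 / R) = gradient_error R"
    unfolding gradient_error_def \<kappa>_def[symmetric] \<eta>_def[symmetric] by (simp add: eval_nat_numeral)
  finally show ?thesis .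
qed

text \<open>Outside the ball both functions lie in (0, 2/r], so their difference is at most 2/r, and
  r^2 (2/r)^q has a finite integral there because q > 3.\<close>

lemma power_distance:
  assumes R: "R \<ge> 1" and q: "q > 3"
  shows "(\<integral>\<^sup>+r. ennreal (polar_density r * \<bar>w r - talenti r\<bar> powr q) \<partial>lborel)
     \<le> ennreal (4 * pi * (R ^ 3 * ((\<alpha> + \<beta>) * exp (4 * R)) powr q + 2 powr q * R powr (3 - q) / (q - 3)))"
proof -
  define \<kappa> where "\<kappa> = (\<alpha> + \<beta>) * exp (4 * R)"
  let ?f1 = "\<lambda>r. R\<^sup>2 * \<kappa> powr q * indicator {0..R} r" and ?f2 = "\<lambda>r. 2 powr q * r powr (2 - q) * indicator {R..} r"
  have pw: "polar_density r * \<bar>w r - talenti r\<bar> powr q \<le> 4 * pi * (?f1 r + ?f2 r)" for r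
  proof -
    have n: "0 \<le> ?f1 r" "0 \<le> ?f2 r" by auto
    consider "r \<le> 0" | "0 < r" "r < R" | "r \<ge> R" by linarith
    then have "indicator {0..} r * (r\<^sup>2 * \<bar>w r - talenti r\<bar> powr q) \<le> ?f1 r + ?f2 r"
    proof cases
      case 1
      then have "indicator {0..} r * (r\<^sup>2 * \<bar>w r - talenti r\<bar> powr q) = 0" by (auto split: split_indicator)
      then show ?thesis using n by linarith
    next
      case 2
      have "\<bar>w r - talenti r\<bar> powr q \<le> \<kappa> powr q"
        using distance_on_ball(1)[of r R] 2 q unfolding \<kappa>_def by (intro powr_mono2) auto
      then have "r\<^sup>2 * \<bar>w r - talenti r\<bar> powr q \<le> R\<^sup>2 * \<kappa> powr q" using 2 by (intro mult_mono power_mono) auto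
      then show ?thesis using 2 by simp
    next
      case 3
      then have r: "r > 0" using R by simp
      have "\<bar>w r - talenti r\<bar> \<le> 2 / r"
        using w_le(2)[OF r] talenti_le(2)[OF r] w_pos[OF r] talenti_pos[of r] by linarith
      then have "\<bar>w r - talenti r\<bar> powr q \<le> (2 / r) powr q" using q by (intro powr_mono2) auto
      also have "\<dots> = 2 powr q / r powr q" using r by (simp add: powr_divide)
      finally have "r\<^sup>2 * \<bar>w r - talenti r\<bar> powr q \<le> r\<^sup>2 * (2 powr q / r powr q)" by (intro mult_left_mono) auto
      also have "\<dots> = 2 powr q * r powr (2 - q)" using r by (simp add: powr_diff)
      finally have "indicator {0..} r * (r\<^sup>2 * \<bar>w r - talenti r\<bar> powr q) \<le> ?f2 r" using 3 r by simp
      then show ?thesis using n(1) by linarith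
    qed
    from mult_left_mono[OF this, of "4 * pi"] show ?thesis by (simp add: polar_density_def mult_ac)
  qed
  have "(\<integral>\<^sup>+r. ennreal (polar_density r * \<bar>w r - talenti r\<bar> powr q) \<partial>lborel)
      \<le> (\<integral>\<^sup>+r. ennreal (4 * pi) * (ennreal (?f1 r) + ennreal (?f2 r)) \<partial>lborel)"
  proof (intro nn_integral_mono)
    fix r
    have "ennreal (4 * pi) * (ennreal (?f1 r) + ennreal (?f2 r)) = ennreal (4 * pi * (?f1 r + ?f2 r))"
      by (subst ennreal_plus[symmetric], simp, simp, subst ennreal_mult[symmetric]) auto
    then show "ennreal (polar_density r * \<bar>w r - talenti r\<bar> powr q) \<le> ennreal (4 * pi) * (ennreal (?f1 r) + ennreal (?f2 r))"
      using ennreal_leI[OF pw[of r]] by simp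
  qed
  also have "\<dots> = ennreal (4 * pi) * ((\<integral>\<^sup>+r. ennreal (?f1 r) \<partial>lborel) + (\<integral>\<^sup>+r. ennreal (?f2 r) \<partial>lborel))"
    by (subst nn_integral_cmult, simp, subst nn_integral_add) auto
  also have "(\<integral>\<^sup>+r. ennreal (?f1 r) \<partial>lborel) = (\<integral>\<^sup>+r. ennreal (R\<^sup>2 * \<kappa> powr q) * indicator {0..R} r \<partial>lborel)"
    by (intro nn_integral_cong) (auto split: split_indicator)
  also have "\<dots> = ennreal (R\<^sup>2 * \<kappa> powr q) * ennreal R" using R by (subst nn_integral_cmult_indicator) auto
  also have "\<dots> = ennreal (R\<^sup>2 * \<kappa> powr q * R)" using R by (subst ennreal_mult[symmetric]) auto
  also have "(\<integral>\<^sup>+r. ennreal (?f2 r) \<partial>lborel) = ennreal (2 powr q * R powr (3 - q) / (q - 3))"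
    using R q by (intro nn_integral_power_tail) auto
  also have "ennreal (4 * pi) * (ennreal (R\<^sup>2 * \<kappa> powr q * R) + ennreal (2 powr q * R powr (3 - q) / (q - 3)))
      = ennreal (4 * pi * (R\<^sup>2 * \<kappa> powr q * R + 2 powr q * R powr (3 - q) / (q - 3)))"
    using R q by (subst ennreal_plus[symmetric], simp, simp, subst ennreal_mult[symmetric]) auto
  also have "R\<^sup>2 * \<kappa> powr q * R = R ^ 3 * \<kappa> powr q" by (simp add: eval_nat_numeral)
  finally show ?thesis by (simp only: \<kappa>_def)
qed

end

section \<open>Rescaling and weak gradients of radial functions\<close>

text \<open>The length scale m^(-2) preserves the critical power: second derivatives of V(r/m^2)/m
  carry m^(-5), the same factor as the fifth power. The linear term keeps \<alpha>/m^4 and the power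
  p keeps m^(p-5).\<close>

lemma radial_ode_rescale:
  assumes "radial_ode p \<alpha> 1 m V V1"
  shows "radial_ode p (\<alpha> / m ^ 4) (m powr (p - 5)) 1 (\<lambda>r. V (r / m\<^sup>2) / m) (\<lambda>r. V1 (r / m\<^sup>2) / m ^ 3)"
proof -
  interpret V: radial_ode p \<alpha> 1 m V V1 by fact
  note m = V.m_pos
  have sc: "((\<lambda>r. r / m\<^sup>2) has_real_derivative 1 / m\<^sup>2) (at r)" for r
    by (rule DERIV_cdivide[OF DERIV_ident])
  have nl: "nonlin p (\<alpha> / m ^ 4) (m powr (p - 5)) (s / m) = nonlin p \<alpha> 1 s / m ^ 5" if "s \<ge> 0" for s
  proof -
    have "m powr (p - 5) * (s / m) powr p = s powr p / m powr 5"
      using m that by (simp add: powr_divide powr_diff)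
    also have "m powr 5 = m ^ 5" using m by simp
    finally show ?thesis using m unfolding nonlin_def by (simp add: field_simps eval_nat_numeral)
  qed
  have lim: "filterlim (\<lambda>r. r / m\<^sup>2) (at_right 0) (at_right 0)"
    unfolding filterlim_at
  proof
    show "\<forall>\<^sub>F r in at_right 0. r / m\<^sup>2 \<in> {0<..} \<and> r / m\<^sup>2 \<noteq> 0"
      by (rule eventually_mono[OF eventually_at_right_less[of 0]]) (use m in auto)
    have "((\<lambda>r. r / m\<^sup>2) \<longlongrightarrow> 0 / m\<^sup>2) (at_right 0)" by (intro tendsto_intros) (use m in auto)
    then show "((\<lambda>r. r / m\<^sup>2) \<longlongrightarrow> 0) (at_right 0)" by simp
  qed
  show ?thesis
  proof
    show "1 < p" "p < 5" by (rule V.p)+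
    show "0 < \<alpha> / m ^ 4" "0 < m powr (p - 5)" using V.\<alpha> m by auto
    fix r :: real assume r: "r > 0"
    then have rm: "r / m\<^sup>2 > 0" using m by simp
    show "((\<lambda>r. V (r / m\<^sup>2) / m) has_real_derivative V1 (r / m\<^sup>2) / m ^ 3) (at r)"
      by (rule DERIV_cong[OF DERIV_cdivide[OF DERIV_chain2[OF V.w_deriv[OF rm] sc]]])
         (use m in \<open>simp add: field_simps eval_nat_numeral\<close>)
    show "((\<lambda>r. V1 (r / m\<^sup>2) / m ^ 3) has_real_derivative - 2 * (V1 (r / m\<^sup>2) / m ^ 3) / r
        - nonlin p (\<alpha> / m ^ 4) (m powr (p - 5)) (V (r / m\<^sup>2) / m)) (at r)"
      by (rule DERIV_cong[OF DERIV_cdivide[OF DERIV_chain2[OF V.w1_deriv[OF rm] sc]]])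
         (unfold nl[OF V.w_nonneg[OF rm]], use m r in \<open>simp add: field_simps eval_nat_numeral\<close>)
    show "V (r / m\<^sup>2) / m \<ge> 0" using V.w_nonneg[OF rm] m by simp
  next
    fix R :: real
    obtain s where s: "s > R / m\<^sup>2" "V s \<noteq> 0" using V.w_nontrivial by blast
    then show "\<exists>r>R. V (r / m\<^sup>2) / m \<noteq> 0"
      using m by (intro exI[of _ "s * m\<^sup>2"]) (auto simp: field_simps)
  next
    have "((\<lambda>r. V (r / m\<^sup>2) / m) \<longlongrightarrow> m / m) (at_right 0)"
      using m by (intro tendsto_intros filterlim_compose[OF V.w_lim lim]) auto
    then show "((\<lambda>r. V (r / m\<^sup>2) / m) \<longlongrightarrow> 1) (at_right 0)" using m by simp
  next
    have t: "((\<lambda>r. V1 (r / m\<^sup>2) / (r / m\<^sup>2) / m ^ 5) \<longlongrightarrow> - nonlin p \<alpha> 1 m / 3 / m ^ 5) (at_right 0)"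
      using m by (intro tendsto_intros filterlim_compose[OF V.w1_lim lim]) auto
    have e1: "V1 (r / m\<^sup>2) / (r / m\<^sup>2) / m ^ 5 = V1 (r / m\<^sup>2) / m ^ 3 / r" for r
      using m by (cases "r = 0") (simp_all add: field_simps eval_nat_numeral)
    have e2: "- nonlin p \<alpha> 1 m / 3 / m ^ 5 = - nonlin p (\<alpha> / m ^ 4) (m powr (p - 5)) 1 / 3"
      using nl[of m] m by simp
    show "((\<lambda>r. V1 (r / m\<^sup>2) / m ^ 3 / r) \<longlongrightarrow> - nonlin p (\<alpha> / m ^ 4) (m powr (p - 5)) 1 / 3) (at_right 0)"
      using t unfolding e1 e2 .
  next
    fix \<epsilon> R :: real assume "\<epsilon> > 0"
    then have "\<epsilon> / m ^ 4 > 0" using m by simp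
    then obtain s where s: "s > R / m\<^sup>2" "s ^ 3 * (V s)\<^sup>2 < \<epsilon> / m ^ 4" using V.decay by blast
    show "\<exists>r>R. r ^ 3 * (V (r / m\<^sup>2) / m)\<^sup>2 < \<epsilon>"
    proof (intro exI conjI)
      show "R < s * m\<^sup>2" using s m by (simp add: field_simps)
      have "(s * m\<^sup>2) ^ 3 * (V (s * m\<^sup>2 / m\<^sup>2) / m)\<^sup>2 = m ^ 4 * (s ^ 3 * (V s)\<^sup>2)"
        using m by (simp add: field_simps eval_nat_numeral)
      also have "\<dots> < \<epsilon>" using s m by (simp add: field_simps)
      finally show "(s * m\<^sup>2) ^ 3 * (V (s * m\<^sup>2 / m\<^sup>2) / m)\<^sup>2 < \<epsilon>" .
    qed
  qed
qed

text \<open>Follows from E \<le> F(m) and F(w) \<ge> -(\<alpha>/2) m^2; it supplies the Lipschitz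
  bound on the profile for \<open>weak_grad_radial_C1\<close>.\<close>

lemma (in radial_ode) w1_bounded: "\<exists>L. \<forall>r>0. \<bar>w1 r\<bar> \<le> L"
proof (intro exI allI impI)
  fix r :: real assume r: "r > 0"
  have "E r \<le> pot m" by (rule DERIV_nonpos_le_limit[OF E_decreasing E_lim r])
  moreover have "(w r)\<^sup>2 \<le> m\<^sup>2" using w_le_m[OF r] w_nonneg[OF r] by (intro power_mono) auto
  then have "\<alpha> / 2 * (w r)\<^sup>2 \<le> \<alpha> / 2 * m\<^sup>2" using \<alpha> by (intro mult_left_mono) auto
  ultimately have "(w1 r)\<^sup>2 \<le> 2 * (pot m + \<alpha> / 2 * m\<^sup>2)"
    using pot_ge[OF w_nonneg[OF r]] by (simp add: E_def)
  then show "\<bar>w1 r\<bar> \<le> sqrt (2 * (pot m + \<alpha> / 2 * m\<^sup>2))" by (simp add: real_le_rsqrt)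
qed

text \<open>The one-sided companion of \<open>AE_radial\<close> for arbitrary \<open>P\<close>: it
  is applied to equality with a profile V that is constrained only for r > 0, so measurability on
  the whole line is not at hand.\<close>

lemma AE_radialI:
  assumes "AE r in lborel. r > 0 \<longrightarrow> P r"
  shows "AE x in lborel. P (norm (x::real^3))"
proof (rule AE_distrD[where f=norm and M'=borel])
  show "(norm :: real^3 \<Rightarrow> real) \<in> lborel \<rightarrow>\<^sub>M borel" by simp
  have "AE r in density lborel (\<lambda>r. ennreal (polar_density r)). P r"
    by (subst AE_density, simp, rule AE_mp[OF assms AE_I2]) (auto simp: polar_density_def indicator_def split: if_splits)
  then show "AE r in distr lborel borel (norm :: real^3 \<Rightarrow> real). P r" by (simp only: distr_norm_lborel)
qed

lemma AE_lborel_scale: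
  assumes "AE r in lborel. P r" "c \<noteq> 0"
  shows "AE r in lborel. P (c * r :: real)"
proof (rule AE_distrD[where f="\<lambda>r. c * r" and M'=borel])
  show "(\<lambda>r. c * r) \<in> lborel \<rightarrow>\<^sub>M borel" by simp
  have "AE r in density (distr lborel borel (\<lambda>x. 0 + c * x)) (\<lambda>_. ennreal \<bar>c\<bar>). P r"
    using assms(1) by (subst (asm) lborel_real_affine[OF assms(2), of 0])
  then show "AE r in distr lborel borel (\<lambda>r. c * r). P r"
    using assms(2) unfolding add_0_left by (subst (asm) AE_density) auto
qed

definition radial_field :: "(real \<Rightarrow> real) \<Rightarrow> real^3 \<Rightarrow> real^3" where
  "radial_field w1 x = (indicator {0<..} (norm x) * w1 (norm x) / norm x) *\<^sub>R x"

text \<open>Integration by parts from translation invariance: the difference quotients of \<open>v \<phi>\<close> have integral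
  zero and converge boundedly almost everywhere.\<close>

lemma weak_grad_radial_C1:
  fixes v :: "real^3 \<Rightarrow> real"
  assumes w: "\<And>r. r > 0 \<Longrightarrow> (w has_real_derivative w1 r) (at r)"
    and w1_cont: "\<And>r. r > 0 \<Longrightarrow> isCont w1 r"
    and B: "\<And>r. r > 0 \<Longrightarrow> \<bar>w r\<bar> \<le> B" and L: "\<And>r. r > 0 \<Longrightarrow> \<bar>w1 r\<bar> \<le> L"
    and v_meas [measurable]: "v \<in> borel_measurable lborel" and v: "AE x in lborel. v x = w (norm x)"
  shows "weak_grad v (radial_field w1)"
proof -
  \<comment> \<open>The profiles are controlled for r > 0 only; cutting them off at 0 makes them
    measurable on the whole line and affects only the null set {0}.\<close>
  define w' where "w' r = indicator {0<..} r *\<^sub>R w r" for r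
  define k where "k r = indicator {0<..} r *\<^sub>R (w1 r / r)" for r
  have w_cont: "isCont w r" if "r > 0" for r using w[OF that] by (rule DERIV_isCont)
  have [measurable]: "w' \<in> borel_measurable borel" unfolding w'_def
    by (rule borel_measurable_continuous_on_indicator) (auto intro!: continuous_at_imp_continuous_on w_cont)
  have [measurable]: "k \<in> borel_measurable borel" unfolding k_def
    by (rule borel_measurable_continuous_on_indicator)
       (auto intro!: continuous_at_imp_continuous_on isCont_divide w1_cont)
  have g_eq: "radial_field w1 x = k (norm x) *\<^sub>R x" for x
    by (simp add: radial_field_def k_def)
  have [measurable]: "radial_field w1 \<in> borel_measurable borel"
    unfolding g_eq[abs_def] by measurable
  have B0: "B \<ge> 0" "L \<ge> 0" using B[of 1] L[of 1] by auto
  have w'B: "\<bar>w' r\<bar> \<le> B" for r using B[of r] B0 by (auto simp: w'_def split: split_indicator)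
  have v': "AE x in lborel. v x = w' (norm x)"
  proof -
    have "AE x in lborel. x \<noteq> (0::real^3)" by (rule AE_lborel_singleton)
    with v show ?thesis by eventually_elim (auto simp: w'_def)
  qed
  have gL: "norm (radial_field w1 x) \<le> L" for x
    using L[of "norm x"] B0 by (cases "x = 0") (auto simp: radial_field_def)
  have main: "integrable lborel (\<lambda>x. v x * D x b) \<and> integrable lborel (\<lambda>x. (radial_field w1 x \<bullet> b) * \<phi> x) \<and>
      (\<integral>x. v x * D x b \<partial>lborel) = - (\<integral>x. (radial_field w1 x \<bullet> b) * \<phi> x \<partial>lborel)"
    if \<phi>: "test_fun \<phi>" "\<And>x. (\<phi> has_derivative D x) (at x)" and b: "b \<in> Basis" for \<phi> D b
  proof -
    have s\<phi>: "smooth_fun \<phi>" and cpt: "compact (closure {x. \<phi> x \<noteq> 0})"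
      using \<phi>(1) by (auto simp: test_fun_def)
    have sD: "smooth_fun (\<lambda>x. D x b)" by (rule smooth_fun_partial[OF s\<phi> \<phi>(2) b])
    have c\<phi>: "continuous_on S \<phi>" and cD: "continuous_on S (\<lambda>x. D x b)" for S
      by (auto intro: smooth_fun_continuous s\<phi> sD)
    have [measurable]: "\<phi> \<in> borel_measurable borel" "(\<lambda>x. D x b) \<in> borel_measurable borel"
      by (auto intro: borel_measurable_continuous_onI c\<phi> cD)
    obtain \<rho> where \<rho>: "\<rho> > 0" "\<forall>x\<in>closure {x. \<phi> x \<noteq> 0}. norm x \<le> \<rho>"
      using compact_imp_bounded[OF cpt] unfolding bounded_pos by blast
    have \<phi>0: "\<phi> x = 0" if "norm x > \<rho>" for x
    proof (rule ccontr)
      assume "\<phi> x \<noteq> 0"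
      then have "x \<in> closure {x. \<phi> x \<noteq> 0}" by (intro subsetD[OF closure_subset]) simp
      with \<rho>(2) that show False by auto
    qed
    have D0: "D x b = 0" if "norm x > \<rho>" for x
    proof -
      have "(\<phi> has_derivative (\<lambda>v. 0)) (at x)"
        by (rule has_derivative_transform_within_open[OF has_derivative_const[of 0], where s="- cball 0 \<rho>"])
           (use that \<phi>0 in auto)
      then have "D x = (\<lambda>v. 0)" using \<phi>(2) has_derivative_unique by blast
      then show ?thesis by simp
    qed
    obtain C where C: "\<And>x. \<bar>\<phi> x\<bar> \<le> C" "\<And>x. \<bar>D x b\<bar> \<le> C" "C \<ge> 0"
    proof -
      have "bounded (\<phi> ` cball 0 \<rho>)" "bounded ((\<lambda>x. D x b) ` cball 0 \<rho>)"
        by (auto intro!: compact_imp_bounded compact_continuous_image c\<phi> cD)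
      then obtain C1 C2 where "\<forall>x\<in>cball 0 \<rho>. \<bar>\<phi> x\<bar> \<le> C1" "\<forall>x\<in>cball 0 \<rho>. \<bar>D x b\<bar> \<le> C2"
        unfolding bounded_iff by auto
      then have C1: "\<bar>\<phi> x\<bar> \<le> C1" and C2: "\<bar>D x b\<bar> \<le> C2" if "norm x \<le> \<rho>" for x
        using that by auto
      have "C1 \<ge> 0" "C2 \<ge> 0" using C1[of 0] C2[of 0] \<rho> by auto
      have "\<bar>\<phi> x\<bar> \<le> max C1 C2" for x
        using C1[of x] \<phi>0[of x] \<open>C1 \<ge> 0\<close> by (cases "norm x \<le> \<rho>") auto
      moreover have "\<bar>D x b\<bar> \<le> max C1 C2" for x
        using C2[of x] D0[of x] \<open>C2 \<ge> 0\<close> by (cases "norm x \<le> \<rho>") auto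
      ultimately show ?thesis using that[of "max C1 C2"] \<open>C1 \<ge> 0\<close> by auto
    qed
    have ind: "integrable lborel (\<lambda>x. K * indicator (cball 0 \<sigma>) (x::real^3))" for K :: real and \<sigma>
      by (intro integrable_mult_right integrable_real_indicator)
         (use emeasure_lborel_cball_finite in \<open>auto simp: infinity_ennreal_def\<close>)
    have i1: "integrable lborel (\<lambda>x. v x * D x b)"
    proof (rule Bochner_Integration.integrable_bound[OF ind[of "B * C" \<rho>]])
      show "AE x in lborel. norm (v x * D x b) \<le> norm (B * C * indicator (cball 0 \<rho>) x)"
        using v'
      proof eventually_elim
        case (elim x)
        have "\<bar>w' (norm x)\<bar> * \<bar>D x b\<bar> \<le> B * C" using w'B C B0 by (intro mult_mono) auto
        then show ?case using elim D0[of x] B0 C(3) by (cases "norm x \<le> \<rho>") (auto simp: abs_mult)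
      qed
    qed auto
    have i2: "integrable lborel (\<lambda>x. (radial_field w1 x \<bullet> b) * \<phi> x)"
    proof (rule Bochner_Integration.integrable_bound[OF ind[of "L * C" \<rho>]])
      show "AE x in lborel. norm ((radial_field w1 x \<bullet> b) * \<phi> x) \<le> norm (L * C * indicator (cball 0 \<rho>) x)"
      proof (rule AE_I2)
        fix x
        have "\<bar>radial_field w1 x \<bullet> b\<bar> \<le> L" using Basis_le_norm[OF b] gL order_trans by blast
        then have "\<bar>radial_field w1 x \<bullet> b\<bar> * \<bar>\<phi> x\<bar> \<le> L * C" using C B0 by (intro mult_mono) auto
        then show "norm ((radial_field w1 x \<bullet> b) * \<phi> x) \<le> norm (L * C * indicator (cball 0 \<rho>) x)"
          using \<phi>0[of x] B0 C(3) by (cases "norm x \<le> \<rho>") (auto simp: abs_mult)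
      qed
    qed auto
    define F where "F x = w' (norm x) * \<phi> x" for x
    have [measurable]: "F \<in> borel_measurable borel" unfolding F_def by measurable
    have iF: "integrable lborel F"
    proof (rule Bochner_Integration.integrable_bound[OF ind[of "B * C" \<rho>]])
      show "AE x in lborel. norm (F x) \<le> norm (B * C * indicator (cball 0 \<rho>) x)"
      proof (rule AE_I2)
        fix x
        have "\<bar>w' (norm x)\<bar> * \<bar>\<phi> x\<bar> \<le> B * C" using w'B C B0 by (intro mult_mono) auto
        then show "norm (F x) \<le> norm (B * C * indicator (cball 0 \<rho>) x)"
          using \<phi>0[of x] B0 C(3) by (cases "norm x \<le> \<rho>") (auto simp: abs_mult F_def)
      qed
    qed auto
    define t where "t n = 1 / real (Suc n)" for n
    have t: "0 < t n" "t n \<le> 1" for n by (auto simp: t_def)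
    have tlim: "filterlim t (at 0) sequentially"
      unfolding filterlim_at using t(1) LIMSEQ_inverse_real_of_nat
      by (auto simp: t_def[abs_def] inverse_eq_divide intro!: always_eventually)
    define q where "q n x = (F (x + t n *\<^sub>R b) - F x) / t n" for n x
    have trans: "integrable lborel (\<lambda>x. F (x + a))" "(\<integral>x. F (x + a) \<partial>lborel) = (\<integral>x. F x \<partial>lborel)" for a
    proof -
      have d: "lborel = distr lborel borel (\<lambda>x. x + a)"
        using lborel_distr_plus[of a] by (simp add: add.commute[of _ a])
      have "integrable (distr lborel borel (\<lambda>x. x + a)) F" using iF d by simp
      then show "integrable lborel (\<lambda>x. F (x + a))" by (subst (asm) integrable_distr_eq) auto
      have "(\<integral>x. F x \<partial>lborel) = (\<integral>x. F x \<partial>distr lborel borel (\<lambda>x. x + a))" using d by simp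
      also have "\<dots> = (\<integral>x. F (x + a) \<partial>lborel)" by (rule integral_distr) auto
      finally show "(\<integral>x. F (x + a) \<partial>lborel) = (\<integral>x. F x \<partial>lborel)" by simp
    qed
    have q0: "(\<integral>x. q n x \<partial>lborel) = 0" for n
      unfolding q_def using trans[of "t n *\<^sub>R b"] iF by simp
    have qlim: "(\<lambda>n. q n x) \<longlonglongrightarrow> w' (norm x) * D x b + (radial_field w1 x \<bullet> b) * \<phi> x" if x: "x \<noteq> 0" for x
    proof -
      have dn: "((\<lambda>s. norm (x + s *\<^sub>R b)) has_real_derivative (b \<bullet> sgn x)) (at 0)"
      proof -
        have "((\<lambda>s. x + s *\<^sub>R b) has_derivative (\<lambda>s. s *\<^sub>R b)) (at 0)"
          by (auto intro!: derivative_eq_intros)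
        moreover have "(norm has_derivative (\<lambda>h. h \<bullet> sgn x)) (at (x + 0 *\<^sub>R b))"
          using has_derivative_norm[OF x] by simp
        ultimately have "((\<lambda>s. norm (x + s *\<^sub>R b)) has_derivative (\<lambda>s. (s *\<^sub>R b) \<bullet> sgn x)) (at 0)"
          by (rule has_derivative_compose)
        then show ?thesis by (simp add: has_field_derivative_def mult.commute[of _ "b \<bullet> sgn x"])
      qed
      have dw: "((\<lambda>s. w (norm (x + s *\<^sub>R b))) has_real_derivative w1 (norm x) * (b \<bullet> sgn x)) (at 0)"
        by (rule DERIV_chain2[OF _ dn]) (use w[of "norm x"] x in simp)
      have "eventually (\<lambda>s. norm (x + s *\<^sub>R b) > 0) (at 0)"
        by (rule order_tendstoD(1)[OF DERIV_isCont[OF dn, unfolded isCont_def]]) (use x in simp)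
      then have "eventually (\<lambda>s. norm (x + s *\<^sub>R b) > 0) (nhds 0)"
        using x by (simp add: eventually_nhds_conv_at)
      then have ev: "eventually (\<lambda>s. w' (norm (x + s *\<^sub>R b)) = w (norm (x + s *\<^sub>R b))) (nhds 0)"
        by eventually_elim (simp add: w'_def)
      have dw': "((\<lambda>s. w' (norm (x + s *\<^sub>R b))) has_real_derivative w1 (norm x) * (b \<bullet> sgn x)) (at 0)"
        using DERIV_cong_ev[OF refl ev refl] dw by simp
      have d\<phi>: "((\<lambda>s. \<phi> (x + s *\<^sub>R b)) has_real_derivative D x b) (at 0)"
      proof -
        have "((\<lambda>s. x + s *\<^sub>R b) has_derivative (\<lambda>s. s *\<^sub>R b)) (at 0)"
          by (auto intro!: derivative_eq_intros)
        moreover have "(\<phi> has_derivative D x) (at (x + 0 *\<^sub>R b))" using \<phi>(2) by simp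
        ultimately have "((\<lambda>s. \<phi> (x + s *\<^sub>R b)) has_derivative (\<lambda>s. D x (s *\<^sub>R b))) (at 0)"
          by (rule has_derivative_compose)
        moreover have "D x (s *\<^sub>R b) = D x b * s" for s
          using linear_cmul[OF has_derivative_linear[OF \<phi>(2)[of x]], of s b] by simp
        ultimately show ?thesis by (simp add: has_field_derivative_def)
      qed
      have "((\<lambda>s. F (x + s *\<^sub>R b)) has_real_derivative w' (norm x) * D x b + w1 (norm x) * (b \<bullet> sgn x) * \<phi> x) (at 0)"
        unfolding F_def using DERIV_mult'[OF dw' d\<phi>] by simp
      then have "((\<lambda>s. (F (x + s *\<^sub>R b) - F x) / s) \<longlongrightarrow> w' (norm x) * D x b + w1 (norm x) * (b \<bullet> sgn x) * \<phi> x) (at 0)"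
        by (simp add: DERIV_def)
      from filterlim_compose[OF this tlim]
      have "(\<lambda>n. q n x) \<longlonglongrightarrow> w' (norm x) * D x b + w1 (norm x) * (b \<bullet> sgn x) * \<phi> x"
        by (simp add: q_def)
      moreover have "w1 (norm x) * (b \<bullet> sgn x) = radial_field w1 x \<bullet> b"
        using x by (simp add: radial_field_def sgn_div_norm inner_commute divide_inverse)
      ultimately show ?thesis by simp
    qed
    \<comment> \<open>Domination of the difference quotients: the two excluded points form a null
      set for each n, and t n \<le> 1 keeps the supports inside the ball of radius \<rho> +
      1.\<close>
    have lip: "\<bar>q n x\<bar> \<le> (B * C + L * C) * indicator (cball 0 (\<rho> + 1)) x" if x: "x \<noteq> 0" "x + t n *\<^sub>R b \<noteq> 0" for n x
    proof (cases "norm x \<le> \<rho> + 1")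
      case False
      have "norm x \<le> norm (x + t n *\<^sub>R b) + norm (t n *\<^sub>R b)" by (metis add_diff_cancel norm_triangle_ineq4)
      then have "norm (x + t n *\<^sub>R b) > \<rho>" using False t[of n] b by simp
      then have "q n x = 0" using \<phi>0 False by (simp add: q_def F_def)
      then show ?thesis using B0 C(3) by simp
    next
      case True
      let ?y = "x + t n *\<^sub>R b"
      have ny: "\<bar>norm ?y - norm x\<bar> \<le> t n" using norm_triangle_ineq3[of ?y x] t[of n] b by simp
      \<comment> \<open>The segment from x to ?y may pass through the origin, where w(|x|) need not
        be differentiable. So w is estimated through the norms of the endpoints, on the half-line r
        > 0, and only \<phi> along the segment.\<close>
      have wl: "\<bar>w r - w s\<bar> \<le> L * \<bar>r - s\<bar>" if rs: "0 < r" "0 < s" for r s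
      proof -
        have *: "\<bar>w s - w r\<bar> \<le> L * (s - r)" if r: "0 < r" and s: "r < s" for r s
        proof -
          obtain \<xi> where "r < \<xi>" "\<xi> < s" "w s - w r = (s - r) * w1 \<xi>"
            using MVT2[OF s, of w w1] w r by (metis less_le_trans)
          then show ?thesis using L[of \<xi>] r s by (simp add: abs_mult mult.commute mult_right_mono)
        qed
        show ?thesis using *[of r s] *[of s r] rs by (cases r s rule: linorder_cases) (auto simp: abs_minus_commute)
      qed
      have w'l: "\<bar>w' (norm ?y) - w' (norm x)\<bar> \<le> L * t n"
        using order_trans[OF wl[of "norm ?y" "norm x"] mult_left_mono[OF ny B0(2)]] x by (simp add: w'_def)
      obtain \<xi> where \<xi>: "0 < \<xi>" "\<xi> < t n" "\<phi> (x + t n *\<^sub>R b) - \<phi> (x + 0 *\<^sub>R b) = (t n - 0) * D (x + \<xi> *\<^sub>R b) b"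
      proof -
        have "((\<lambda>s. \<phi> (x + s *\<^sub>R b)) has_real_derivative D (x + s *\<^sub>R b) b) (at s)" for s
        proof -
          have "((\<lambda>s. x + s *\<^sub>R b) has_derivative (\<lambda>s. s *\<^sub>R b)) (at s)"
            by (auto intro!: derivative_eq_intros)
          from has_derivative_compose[OF this \<phi>(2)]
          have "((\<lambda>s. \<phi> (x + s *\<^sub>R b)) has_derivative (\<lambda>h. D (x + s *\<^sub>R b) (h *\<^sub>R b))) (at s)" .
          moreover have "D (x + s *\<^sub>R b) (h *\<^sub>R b) = D (x + s *\<^sub>R b) b * h" for h
            using linear_cmul[OF has_derivative_linear[OF \<phi>(2)[of "x + s *\<^sub>R b"]], of h b] by simp
          ultimately show ?thesis by (simp add: has_field_derivative_def)
        qed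
        then show ?thesis using MVT2[of 0 "t n" "\<lambda>s. \<phi> (x + s *\<^sub>R b)" "\<lambda>s. D (x + s *\<^sub>R b) b"] t[of n] that by blast
      qed
      have \<phi>l: "\<bar>\<phi> ?y - \<phi> x\<bar> \<le> C * t n"
        using \<xi>(3) C(2)[of "x + \<xi> *\<^sub>R b"] t[of n] by (simp add: abs_mult mult.commute mult_right_mono)
      have "F ?y - F x = w' (norm ?y) * (\<phi> ?y - \<phi> x) + (w' (norm ?y) - w' (norm x)) * \<phi> x"
        by (simp add: F_def algebra_simps)
      then have "\<bar>F ?y - F x\<bar> \<le> \<bar>w' (norm ?y)\<bar> * \<bar>\<phi> ?y - \<phi> x\<bar> + \<bar>w' (norm ?y) - w' (norm x)\<bar> * \<bar>\<phi> x\<bar>"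
        by (metis abs_mult abs_triangle_ineq)
      also have "\<dots> \<le> B * (C * t n) + (L * t n) * C"
        using w'B \<phi>l w'l C B0 t[of n] by (intro add_mono mult_mono) auto
      also have "\<dots> = (B * C + L * C) * t n" by (simp add: algebra_simps)
      finally have "\<bar>q n x\<bar> \<le> B * C + L * C" using t[of n] by (simp add: q_def divide_le_eq)
      then show ?thesis using True by simp
    qed
    have "(\<lambda>n. \<integral>x. q n x \<partial>lborel) \<longlonglongrightarrow> (\<integral>x. w' (norm x) * D x b + (radial_field w1 x \<bullet> b) * \<phi> x \<partial>lborel)"
    proof (rule integral_dominated_convergence[OF _ _ ind[of "B * C + L * C" "\<rho> + 1"]])
      have ne: "AE x in lborel. x \<noteq> (0::real^3)" by (rule AE_lborel_singleton)
      show "AE x in lborel. (\<lambda>n. q n x) \<longlonglongrightarrow> w' (norm x) * D x b + (radial_field w1 x \<bullet> b) * \<phi> x"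
        using ne by eventually_elim (rule qlim)
      show "AE x in lborel. norm (q n x) \<le> (B * C + L * C) * indicator (cball 0 (\<rho> + 1)) x" for n
        using ne AE_lborel_singleton[of "- (t n *\<^sub>R b)"]
      proof eventually_elim
        case (elim x)
        then have "x + t n *\<^sub>R b \<noteq> 0" by (simp add: eq_neg_iff_add_eq_0)
        from lip[OF elim(1) this] show ?case by simp
      qed
      show "q n \<in> borel_measurable lborel" for n unfolding q_def by measurable
    qed measurable
    then have "(\<integral>x. w' (norm x) * D x b + (radial_field w1 x \<bullet> b) * \<phi> x \<partial>lborel) = 0"
      using LIMSEQ_unique[OF tendsto_const[of 0]] by (simp add: q0)
    moreover have "(\<integral>x. w' (norm x) * D x b + (radial_field w1 x \<bullet> b) * \<phi> x \<partial>lborel) = (\<integral>x. v x * D x b + (radial_field w1 x \<bullet> b) * \<phi> x \<partial>lborel)"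
      by (rule integral_cong_AE, measurable) (use v' in \<open>eventually_elim, simp\<close>)
    ultimately have "(\<integral>x. v x * D x b \<partial>lborel) + (\<integral>x. (radial_field w1 x \<bullet> b) * \<phi> x \<partial>lborel) = 0"
      using Bochner_Integration.integral_add[OF i1 i2] by simp
    with i1 i2 show ?thesis by (simp add: eq_neg_iff_add_eq_0)
  qed
  then show ?thesis unfolding weak_grad_def by auto
qed

section \<open>Convergence\<close>

text \<open>Iterated limit: R is fixed first with L R < e, and then B R x < e eventually. Uniformity
  in R would be out of reach, as the bounds on the ball grow like exp(4 R).\<close>

lemma tendsto_0_two_parameters:
  fixes f :: "'a \<Rightarrow> ennreal" and B :: "real \<Rightarrow> 'a \<Rightarrow> real"
  assumes le: "\<And>R. R \<ge> 1 \<Longrightarrow> eventually (\<lambda>x. f x \<le> ennreal (B R x)) F"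
    and B: "\<And>R. R \<ge> 1 \<Longrightarrow> (B R \<longlongrightarrow> L R) F" and L: "(L \<longlongrightarrow> 0) at_top"
  shows "(f \<longlongrightarrow> 0) F"
proof (rule order_tendstoI)
  fix a :: ennreal assume "0 < a"
  obtain e where e: "0 < e" "ennreal e \<le> a"
  proof (cases a)
    case (real r)
    then show ?thesis using that[of r] \<open>0 < a\<close> by auto
  next
    case top
    then show ?thesis using that[of 1] by auto
  qed
  have "eventually (\<lambda>R. L R < e) at_top" by (rule order_tendstoD(2)[OF L e(1)])
  then have "eventually (\<lambda>R. L R < e \<and> R \<ge> 1) at_top"
    using eventually_ge_at_top[of 1] by eventually_elim simp
  then obtain R where R: "R \<ge> 1" "L R < e" by (auto simp: eventually_at_top_linorder)
  have "eventually (\<lambda>x. B R x < e) F" by (rule order_tendstoD(2)[OF B[OF R(1)] R(2)])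
  with le[OF R(1)] show "eventually (\<lambda>x. f x < a) F"
  proof eventually_elim
    case (elim x)
    have "ennreal (B R x) < ennreal e" using elim e by (simp add: ennreal_lessI)
    with elim e show ?case by (meson le_less_trans less_le_trans)
  qed
qed simp

text \<open>V decreases from its limit m at 0, so m is an upper bound; and for c < m the inequality
  V > c holds on a whole interval (0, d), a set of positive measure. This identifies the scaling
  factor with the m of the profile.\<close>

lemma Linf_norm_eq:
  assumes [measurable]: "u \<in> borel_measurable lborel" "U \<in> borel_measurable borel"
    and u: "\<And>x::real^3. u x = U (norm x)" and U: "\<And>r. U r > 0"
    and UV: "AE r in lborel. r > 0 \<longrightarrow> U r = V r" and V: "radial_ode p \<alpha> \<beta> m V V1"
  shows "Linf_norm u = ereal m"
proof (rule antisym)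
  interpret V: radial_ode p \<alpha> \<beta> m V V1 by fact
  have "AE r in lborel. r > 0 \<longrightarrow> U r \<le> m"
    using UV by eventually_elim (auto dest: V.w_le_m)
  then have "AE x in lborel. U (norm (x::real^3)) \<le> m" by (rule AE_radialI)
  then have "AE x in lborel. ereal \<bar>u x\<bar> \<le> ereal m"
    by eventually_elim (simp add: u less_imp_le[OF U])
  then show "Linf_norm u \<le> ereal m"
    unfolding Linf_norm_def by (intro esssup_I) auto
  show "ereal m \<le> Linf_norm u"
  proof (rule ccontr)
    assume "\<not> ereal m \<le> Linf_norm u"
    then have "Linf_norm u < ereal m" by simp
    then obtain c where c: "Linf_norm u < ereal c" "c < m" using ereal_dense2 by (metis less_ereal.simps(1))
    have "AE x in lborel. ereal \<bar>u x\<bar> \<le> Linf_norm u" unfolding Linf_norm_def by (rule esssup_AE)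
    then have "AE x in lborel. U (norm (x::real^3)) < c"
    proof eventually_elim
      case (elim x)
      then have "ereal \<bar>u x\<bar> < ereal c" using c(1) by (rule le_less_trans)
      then show ?case using u[of x] by simp
    qed
    then have Uc: "AE r in lborel. r > 0 \<longrightarrow> U r < c" by (subst (asm) AE_radial) auto
    have "eventually (\<lambda>r. V r > c) (at_right 0)" by (rule order_tendstoD(1)[OF V.w_lim c(2)])
    then obtain d where d: "d > 0" "\<And>r. 0 < r \<Longrightarrow> r < d \<Longrightarrow> V r > c"
      unfolding eventually_at_right_field by blast
    have "AE r in lborel. r > 0 \<longrightarrow> U r = V r \<and> U r < c"
      using UV Uc by eventually_elim auto
    then obtain r where "0 < r" "r < d" "U r = V r \<and> U r < c"
      by (rule AE_pos_ex_in_interval[of _ 0 d]) (use d in auto)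
    with d(2)[of r] show False by simp
  qed
qed

lemma W_eq_talenti: "W x = talenti (norm x)"
  by (simp add: W_def talenti_def)

lemma talenti'_abs_le: "r > 0 \<Longrightarrow> \<bar>talenti' r\<bar> \<le> 1"
proof -
  assume r: "r > 0"
  have t: "0 \<le> talenti r" "talenti r \<le> 1" using talenti_le(1) less_imp_le[OF talenti_pos] by auto
  have "r * talenti r \<le> 2" using talenti_le(2)[OF r] r by (simp add: field_simps)
  moreover have "(talenti r)\<^sup>2 \<le> 1" using t by (simp add: power_le_one)
  ultimately have "(r * talenti r) * (talenti r)\<^sup>2 \<le> 2 * 1" using t r by (intro mult_mono) auto
  then have "r * talenti r ^ 3 \<le> 3" by (simp add: eval_nat_numeral mult.assoc)
  then show ?thesis using r t by (simp add: talenti'_def abs_mult)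
qed

lemma weak_grad_W: "weak_grad W (radial_field talenti')"
proof (rule weak_grad_radial_C1[where w=talenti and B=1 and L=1])
  show "isCont talenti' r" if "r > 0" for r using talenti'_deriv[OF that] by (rule DERIV_isCont)
  show "\<bar>talenti r\<bar> \<le> 1" for r using talenti_le(1)[of r] by (simp add: abs_of_pos)
  show "W \<in> borel_measurable lborel" unfolding W_def[abs_def] by measurable
qed (auto intro: talenti_deriv talenti'_abs_le simp: W_eq_talenti)

lemma radial_field_distance:
  assumes "\<And>r. r > 0 \<Longrightarrow> isCont w1 r"
  shows "(\<integral>\<^sup>+x. ennreal ((norm (radial_field w1 x - radial_field talenti' x))\<^sup>2) \<partial>lborel)
    = (\<integral>\<^sup>+r. ennreal (polar_density r * (w1 r - talenti' r)\<^sup>2) \<partial>lborel)"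
proof -
  define k where "k r = indicator {0<..} r *\<^sub>R (w1 r - talenti' r)" for r
  have [measurable]: "k \<in> borel_measurable borel" unfolding k_def
    by (rule borel_measurable_continuous_on_indicator)
       (use assms DERIV_isCont[OF talenti'_deriv] in \<open>auto intro!: continuous_at_imp_continuous_on isCont_diff\<close>)
  have "norm (radial_field w1 x - radial_field talenti' x) = \<bar>k (norm x)\<bar>" for x
  proof (cases "x = 0")
    case False
    have "radial_field w1 x - radial_field talenti' x = (k (norm x) / norm x) *\<^sub>R x"
      using False by (simp add: radial_field_def k_def scaleR_diff_left[symmetric] diff_divide_distrib)
    then show ?thesis using False by simp
  qed (simp add: radial_field_def k_def)
  then have "(\<integral>\<^sup>+x. ennreal ((norm (radial_field w1 x - radial_field talenti' x))\<^sup>2) \<partial>lborel)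
      = (\<integral>\<^sup>+x. ennreal ((k (norm (x::real^3)))\<^sup>2) \<partial>lborel)" by simp
  also have "\<dots> = (\<integral>\<^sup>+r. ennreal (polar_density r) * ennreal ((k r)\<^sup>2) \<partial>lborel)"
    by (rule nn_integral_radial) measurable
  also have "\<dots> = (\<integral>\<^sup>+r. ennreal (polar_density r * (w1 r - talenti' r)\<^sup>2) \<partial>lborel)"
    by (intro nn_integral_cong) (auto simp: ennreal_mult[symmetric] k_def polar_density_def split: split_indicator)
  finally show ?thesis .
qed

lemma power_distance_radial:
  assumes w: "\<And>r. r > 0 \<Longrightarrow> isCont w r" and v: "AE x in lborel. v x = w (norm (x::real^3))"
    and [measurable]: "v \<in> borel_measurable lborel"
  shows "(\<integral>\<^sup>+x. ennreal (\<bar>v x - W x\<bar> powr q) \<partial>lborel)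
    = (\<integral>\<^sup>+r. ennreal (polar_density r * \<bar>w r - talenti r\<bar> powr q) \<partial>lborel)"
proof -
  define k where "k r = indicator {0<..} r *\<^sub>R (w r - talenti r)" for r
  have [measurable]: "k \<in> borel_measurable borel" unfolding k_def
    by (rule borel_measurable_continuous_on_indicator)
       (use w DERIV_isCont[OF talenti_deriv] in \<open>auto intro!: continuous_at_imp_continuous_on isCont_diff\<close>)
  have "AE x in lborel. x \<noteq> (0::real^3)" by (rule AE_lborel_singleton)
  with v have vk: "AE x in lborel. v x - W x = k (norm x)"
    by eventually_elim (simp add: k_def W_eq_talenti)
  have "(\<integral>\<^sup>+x. ennreal (\<bar>v x - W x\<bar> powr q) \<partial>lborel) = (\<integral>\<^sup>+x. ennreal (\<bar>k (norm (x::real^3))\<bar> powr q) \<partial>lborel)"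
    by (intro nn_integral_cong_AE eventually_mono[OF vk]) simp
  also have "\<dots> = (\<integral>\<^sup>+r. ennreal (polar_density r) * ennreal (\<bar>k r\<bar> powr q) \<partial>lborel)"
    by (rule nn_integral_radial) measurable
  also have "\<dots> = (\<integral>\<^sup>+r. ennreal (polar_density r * \<bar>w r - talenti r\<bar> powr q) \<partial>lborel)"
    by (intro nn_integral_cong) (auto simp: ennreal_mult[symmetric] k_def polar_density_def split: split_indicator)
  finally show ?thesis .
qed

lemma radial_profile:
  fixes u :: "real^3 \<Rightarrow> real"
  assumes p: "1 < p" "p < 5" and \<alpha>: "0 < \<alpha>"
    and u: "H1 u" "weak_solution p \<alpha> u" "\<And>x. u x > 0" and radial: "\<And>x y. norm x = norm y \<Longrightarrow> u x = u y"
  obtains m V V1 where "radial_ode p \<alpha> 1 m V V1" "Linf_norm u = ereal m"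
    "AE x in lborel. u ((1 / m\<^sup>2) *\<^sub>R x) / m = V (norm x / m\<^sup>2) / m"
proof -
  define U where "U r = u (r *\<^sub>R axis 1 1)" for r
  have um: "u \<in> borel_measurable borel" using u(1) by (simp add: H1_def)
  have Um: "U \<in> borel_measurable borel" unfolding U_def[abs_def] by (rule measurable_compose[OF _ um]) measurable
  have uU: "u x = U (norm x)" for x unfolding U_def by (rule radial) simp
  have Upos: "U r > 0" for r using u(3) by (simp add: U_def)
  interpret radial_weak_solution p \<alpha> u U
  proof
    show "U \<in> borel_measurable borel" by (rule Um)
    show "u x = U (norm x)" for x by (rule uU)
    show "U r > 0" for r by (rule Upos)
  qed fact+
  obtain V V1 m where V: "AE r in lborel. r > 0 \<longrightarrow> U r = V r" "radial_ode p \<alpha> 1 m V V1"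
    by (rule regular_representative)
  interpret V: radial_ode p \<alpha> 1 m V V1 by (rule V(2))
  have "Linf_norm u = ereal m"
    by (rule Linf_norm_eq[OF _ Um uU U_pos V]) (use um in simp)
  moreover have "AE x in lborel. u ((1 / m\<^sup>2) *\<^sub>R x) / m = V (norm x / m\<^sup>2) / m"
  proof -
    have "AE r in lborel. (1 / m\<^sup>2) * r > 0 \<longrightarrow> U ((1 / m\<^sup>2) * r) = V ((1 / m\<^sup>2) * r)"
      by (rule AE_lborel_scale[OF V(1)]) (use V.m_pos in simp)
    then have "AE r in lborel. r > 0 \<longrightarrow> U (r / m\<^sup>2) = V (r / m\<^sup>2)"
      by eventually_elim (use V.m_pos in auto)
    then have "AE x in lborel. U (norm (x::real^3) / m\<^sup>2) = V (norm x / m\<^sup>2)" by (rule AE_radialI)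
    then show ?thesis by eventually_elim (simp add: uU)
  qed
  ultimately show ?thesis using V(2) by (intro that)
qed

theorem theorem2p4:
  fixes p \<omega>0 :: real and u :: "real \<Rightarrow> real^3 \<Rightarrow> real"
  assumes p: "1 < p" "p < 3"
    and \<omega>0: "0 < \<omega>0"
    and sol: "\<And>\<omega>. \<omega> \<in> {0<..<\<omega>0} \<Longrightarrow>
               H1 (u \<omega>) \<and> weak_solution p \<omega> (u \<omega>) \<and> (\<forall>x. u \<omega> x > 0)"
    and radial: "\<And>\<omega> x y. \<omega> \<in> {0<..<\<omega>0} \<Longrightarrow> norm x = norm y \<Longrightarrow> u \<omega> x = u \<omega> y"
    and blowup: "((\<lambda>\<omega>. Linf_norm (u \<omega>)) \<longlongrightarrow> \<infinity>) (at_right 0)"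
  defines "M \<equiv> (\<lambda>\<omega>. real_of_ereal (Linf_norm (u \<omega>)))"
  defines "ut \<equiv> (\<lambda>\<omega> x. u \<omega> ((1 / (M \<omega>)\<^sup>2) *\<^sub>R x) / M \<omega>)"
  shows "\<exists>G H. weak_grad W H \<and> (\<forall>\<omega>\<in>{0<..<\<omega>0}. weak_grad (ut \<omega>) (G \<omega>)) \<and>
           ((\<lambda>\<omega>. \<integral>\<^sup>+x. ennreal ((norm (G \<omega> x - H x))\<^sup>2) \<partial>lborel) \<longlongrightarrow> 0) (at_right 0) \<and>
           (\<forall>q>3. ((\<lambda>\<omega>. \<integral>\<^sup>+x. ennreal (\<bar>ut \<omega> x - W x\<bar> powr q) \<partial>lborel) \<longlongrightarrow> 0) (at_right 0))"
proof -
  \<comment> \<open>Pairs the rescaled profile with its derivative so that a single choice over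
    \<omega> provides both.\<close>
  define profile where "profile \<omega> ww \<longleftrightarrow> radial_ode p (\<omega> / M \<omega> ^ 4) (M \<omega> powr (p - 5)) 1 (fst ww) (snd ww)
      \<and> (AE x in lborel. ut \<omega> x = fst ww (norm x)) \<and> Linf_norm (u \<omega>) = ereal (M \<omega>)" for \<omega> ww
  have "\<exists>ww. profile \<omega> ww" if \<omega>: "\<omega> \<in> {0<..<\<omega>0}" for \<omega>
  proof -
    have "p < 5" "0 < \<omega>" using p \<omega> by auto
    have s: "H1 (u \<omega>)" "weak_solution p \<omega> (u \<omega>)" "u \<omega> x > 0" for x using sol[OF \<omega>] by auto
    obtain m V V1 where V: "radial_ode p \<omega> 1 m V V1" "Linf_norm (u \<omega>) = ereal m"
        "AE x in lborel. u \<omega> ((1 / m\<^sup>2) *\<^sub>R x) / m = V (norm x / m\<^sup>2) / m"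
      by (rule radial_profile[OF p(1) \<open>p < 5\<close> \<open>0 < \<omega>\<close> s]) (erule radial[OF \<omega>], blast)
    have "M \<omega> = m" using V(2) by (simp add: M_def)
    then have "profile \<omega> (\<lambda>r. V (r / m\<^sup>2) / m, \<lambda>r. V1 (r / m\<^sup>2) / m ^ 3)"
      using radial_ode_rescale[OF V(1)] V(2,3) by (simp add: profile_def ut_def)
    then show ?thesis by blast
  qed
  then obtain f where f: "\<forall>\<omega>\<in>{0<..<\<omega>0}. profile \<omega> (f \<omega>)" using bchoice[of "{0<..<\<omega>0}" profile] by blast
  define w where "w \<omega> = fst (f \<omega>)" for \<omega>
  define w1 where "w1 \<omega> = snd (f \<omega>)" for \<omega>
  have ode: "radial_ode p (\<omega> / M \<omega> ^ 4) (M \<omega> powr (p - 5)) 1 (w \<omega>) (w1 \<omega>)"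
    and w: "AE x in lborel. ut \<omega> x = w \<omega> (norm x)"
    and Linf: "Linf_norm (u \<omega>) = ereal (M \<omega>)" if "\<omega> \<in> {0<..<\<omega>0}" for \<omega>
    using bspec[OF f that] unfolding profile_def w_def w1_def by blast+
  have utm: "ut \<omega> \<in> borel_measurable lborel" if "\<omega> \<in> {0<..<\<omega>0}" for \<omega>
  proof -
    have [measurable]: "u \<omega> \<in> borel_measurable borel" using sol[OF that] by (simp add: H1_def)
    show ?thesis unfolding ut_def by measurable
  qed
  have w_cont: "isCont (w \<omega>) r" "isCont (w1 \<omega>) r" if "\<omega> \<in> {0<..<\<omega>0}" "r > 0" for \<omega> r
  proof -
    interpret radial_ode p "\<omega> / M \<omega> ^ 4" "M \<omega> powr (p - 5)" 1 "w \<omega>" "w1 \<omega>" by (rule ode[OF that(1)])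
    show "isCont (w \<omega>) r" "isCont (w1 \<omega>) r"
      using w_deriv[OF that(2)] w1_deriv[OF that(2)] by (auto intro: DERIV_isCont)
  qed
  have wg: "weak_grad (ut \<omega>) (radial_field (w1 \<omega>))" if \<omega>: "\<omega> \<in> {0<..<\<omega>0}" for \<omega>
  proof -
    interpret radial_ode p "\<omega> / M \<omega> ^ 4" "M \<omega> powr (p - 5)" 1 "w \<omega>" "w1 \<omega>" by (rule ode[OF \<omega>])
    obtain L where "\<forall>r>0. \<bar>w1 \<omega> r\<bar> \<le> L" using w1_bounded by blast
    then have L: "\<bar>w1 \<omega> r\<bar> \<le> L" if "r > 0" for r using that by blast
    show ?thesis
    proof (rule weak_grad_radial_C1[OF w_deriv w_cont(2)[OF \<omega>] _ L utm[OF \<omega>] w[OF \<omega>]])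
      show "\<bar>w \<omega> r\<bar> \<le> 1" if "r > 0" for r using w_le_m[OF that] w_nonneg[OF that] by simp
    qed
  qed
  \<comment> \<open>The sum \<alpha> + \<beta> of the rescaled equation, the only quantity through
    which \<omega> enters the error bounds.\<close>
  define \<kappa> where "\<kappa> \<omega> = \<omega> / M \<omega> ^ 4 + M \<omega> powr (p - 5)" for \<omega>
  have ev: "eventually (\<lambda>\<omega>. \<omega> \<in> {0<..<\<omega>0}) (at_right 0)"
    using \<omega>0 by (auto simp: eventually_at_right_field)
  have "((\<lambda>\<omega>. ereal (M \<omega>)) \<longlongrightarrow> \<infinity>) (at_right 0)"
    by (rule Lim_transform_eventually[OF blowup]) (use ev in \<open>eventually_elim, simp add: Linf\<close>)
  then have M: "filterlim M at_top (at_right 0)" by (simp add: tendsto_PInfty_eq_at_top)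
  have id0: "((\<lambda>\<omega>::real. \<omega>) \<longlongrightarrow> 0) (at_right 0)" by (rule tendsto_ident_at)
  have inv: "((\<lambda>\<omega>. inverse (M \<omega>)) \<longlongrightarrow> 0) (at_right 0)"
    by (rule tendsto_inverse_0_at_top[OF M])
  have \<alpha>_lim: "((\<lambda>\<omega>. \<omega> / M \<omega> ^ 4) \<longlongrightarrow> 0) (at_right 0)"
  proof -
    have "((\<lambda>\<omega>. \<omega> * inverse (M \<omega>) ^ 4) \<longlongrightarrow> 0 * 0 ^ 4) (at_right 0)"
      by (intro tendsto_intros id0 inv)
    then show ?thesis by (simp add: divide_inverse power_inverse)
  qed
  have "((\<lambda>\<omega>. M \<omega> powr (p - 5)) \<longlongrightarrow> 0) (at_right 0)"
    by (rule tendsto_neg_powr[OF _ M]) (use p in simp)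
  from tendsto_add[OF \<alpha>_lim this] have \<kappa>: "(\<kappa> \<longlongrightarrow> 0) (at_right 0)" by (simp add: \<kappa>_def[abs_def])
  \<comment> \<open>The bound required by \<open>normalized_radial_ode\<close> is guaranteed for
    small \<omega>, so the estimates hold eventually.\<close>
  have "eventually (\<lambda>\<omega>. \<omega> / M \<omega> ^ 4 < 1/4) (at_right 0)" by (rule order_tendstoD(2)[OF \<alpha>_lim]) simp
  with ev have norm_ev: "eventually (\<lambda>\<omega>. \<omega> \<in> {0<..<\<omega>0} \<and> normalized_radial_ode p (\<omega> / M \<omega> ^ 4) (M \<omega> powr (p - 5)) (w \<omega>) (w1 \<omega>)) (at_right 0)"
  proof eventually_elim
    case (elim \<omega>)
    interpret radial_ode p "\<omega> / M \<omega> ^ 4" "M \<omega> powr (p - 5)" 1 "w \<omega>" "w1 \<omega>" by (rule ode[OF elim(1)])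
    have "normalized_radial_ode p (\<omega> / M \<omega> ^ 4) (M \<omega> powr (p - 5)) (w \<omega>) (w1 \<omega>)"
      by unfold_locales (use elim in simp)
    with elim show ?case by simp
  qed
  have \<kappa>pos: "eventually (\<lambda>\<omega>. 0 \<le> \<kappa> \<omega>) (at_right 0)"
    using norm_ev
  proof eventually_elim
    case (elim \<omega>)
    then interpret normalized_radial_ode p "\<omega> / M \<omega> ^ 4" "M \<omega> powr (p - 5)" "w \<omega>" "w1 \<omega>" by simp
    show ?case using \<alpha> \<beta> by (simp add: \<kappa>_def)
  qed
  have inv0: "((\<lambda>R::real. c / R) \<longlongrightarrow> 0) at_top" for c
    by (rule tendsto_divide_0[OF tendsto_const]) (simp add: filterlim_at_top_imp_at_infinity filterlim_ident)
  have grad: "((\<lambda>\<omega>. \<integral>\<^sup>+x. ennreal ((norm (radial_field (w1 \<omega>) x - radial_field talenti' x))\<^sup>2) \<partial>lborel) \<longlongrightarrow> 0) (at_right 0)"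
  proof (rule tendsto_0_two_parameters)
    fix R :: real assume R: "R \<ge> 1"
    let ?B = "\<lambda>R \<omega>. 4 * pi * (R ^ 3 * (\<kappa> \<omega> * exp (4 * R))\<^sup>2 + (16 * (2 / R + 32 / R ^ 3 + 2 * \<kappa> \<omega> * R) + 32 / R))"
    show "eventually (\<lambda>\<omega>. (\<integral>\<^sup>+x. ennreal ((norm (radial_field (w1 \<omega>) x - radial_field talenti' x))\<^sup>2) \<partial>lborel) \<le> ennreal (?B R \<omega>)) (at_right 0)"
      using norm_ev
    proof eventually_elim
      case (elim \<omega>)
      then interpret normalized_radial_ode p "\<omega> / M \<omega> ^ 4" "M \<omega> powr (p - 5)" "w \<omega>" "w1 \<omega>" by simp
      show ?case
        using gradient_distance[OF R] radial_field_distance[OF w_cont(2)] elim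
        by (simp add: gradient_error_def \<kappa>_def)
    qed
    \<comment> \<open>At fixed R the limit in \<omega> removes everything but the tail terms, which
      vanish as R grows.\<close>
    show "(?B R \<longlongrightarrow> 4 * pi * (R ^ 3 * (0 * exp (4 * R))\<^sup>2 + (16 * (2 / R + 32 / R ^ 3 + 2 * 0 * R) + 32 / R))) (at_right 0)"
      by (intro tendsto_intros \<kappa>)
  next
    have "((\<lambda>R. 4 * pi * (16 * (2 / R + 32 * (1 / R) ^ 3) + 32 / R)) \<longlongrightarrow> 4 * pi * (16 * (0 + 32 * 0 ^ 3) + 0)) at_top"
      by (intro tendsto_intros inv0)
    then show "((\<lambda>R::real. 4 * pi * (R ^ 3 * (0 * exp (4 * R))\<^sup>2 + (16 * (2 / R + 32 / R ^ 3 + 2 * 0 * R) + 32 / R))) \<longlongrightarrow> 0) at_top"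
      by (simp add: power_divide)
  qed
  have pow: "((\<lambda>\<omega>. \<integral>\<^sup>+x. ennreal (\<bar>ut \<omega> x - W x\<bar> powr q) \<partial>lborel) \<longlongrightarrow> 0) (at_right 0)" if q: "q > 3" for q
  proof (rule tendsto_0_two_parameters)
    fix R :: real assume R: "R \<ge> 1"
    let ?B = "\<lambda>R \<omega>. 4 * pi * (R ^ 3 * (\<kappa> \<omega> * exp (4 * R)) powr q + 2 powr q * R powr (3 - q) / (q - 3))"
    show "eventually (\<lambda>\<omega>. (\<integral>\<^sup>+x. ennreal (\<bar>ut \<omega> x - W x\<bar> powr q) \<partial>lborel) \<le> ennreal (?B R \<omega>)) (at_right 0)"
      using norm_ev
    proof eventually_elim
      case (elim \<omega>)
      then interpret normalized_radial_ode p "\<omega> / M \<omega> ^ 4" "M \<omega> powr (p - 5)" "w \<omega>" "w1 \<omega>" by simp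
      have \<omega>: "\<omega> \<in> {0<..<\<omega>0}" using elim by simp
      have "(\<integral>\<^sup>+x. ennreal (\<bar>ut \<omega> x - W x\<bar> powr q) \<partial>lborel) = (\<integral>\<^sup>+r. ennreal (polar_density r * \<bar>w \<omega> r - talenti r\<bar> powr q) \<partial>lborel)"
        by (rule power_distance_radial[OF w_cont(1)[OF \<omega>] w[OF \<omega>] utm[OF \<omega>]])
      then show ?case unfolding \<kappa>_def using power_distance[OF R q] by simp
    qed
    have k: "((\<lambda>\<omega>. (\<kappa> \<omega> * exp (4 * R)) powr q) \<longlongrightarrow> (0 * exp (4 * R)) powr q) (at_right 0)"
      by (rule tendsto_powr'[OF tendsto_mult[OF \<kappa> tendsto_const] tendsto_const])
         (use \<kappa>pos q in \<open>auto elim: eventually_mono\<close>)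
    show "(?B R \<longlongrightarrow> 4 * pi * (R ^ 3 * (0 * exp (4 * R)) powr q + 2 powr q * R powr (3 - q) / (q - 3))) (at_right 0)"
      by (rule tendsto_mult[OF tendsto_const tendsto_add[OF tendsto_mult[OF tendsto_const k] tendsto_const]])
  next
    have "((\<lambda>R::real. R powr (3 - q)) \<longlongrightarrow> 0) at_top"
      by (rule tendsto_neg_powr[OF _ filterlim_ident]) (use q in simp)
    then have "((\<lambda>R::real. 4 * pi * (2 powr q * R powr (3 - q) / (q - 3))) \<longlongrightarrow> 4 * pi * (2 powr q * 0 / (q - 3))) at_top"
      by (intro tendsto_intros) (use q in auto)
    then show "((\<lambda>R::real. 4 * pi * (R ^ 3 * (0 * exp (4 * R)) powr q + 2 powr q * R powr (3 - q) / (q - 3))) \<longlongrightarrow> 0) at_top"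
      using q by simp
  qed
  show ?thesis
    by (rule exI[of _ "\<lambda>\<omega>. radial_field (w1 \<omega>)"], rule exI[of _ "radial_field talenti'"])
       (use weak_grad_W wg grad pow in auto)
qed

end
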